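(* Let $(H,R)$ be a finite dimensional semisimple and cosemisimple quasi-triangular Hopf algebra over a field $k$, let $D$ be a minimal $H$-adjoint-stable subcoalgebra of $H_R$, and let $W$ be a finite dimensional nonzero left $D$-comodule. Then $N_W$ is $H$-simple as a left $H$-comodule algebra.
   Context: $H$ has coproduct $\Delta(h)=\sum h_{(1)}\otimes h_{(2)}$, counit $\varepsilon$ and antipode $S$. Quasi-triangular: $R=\sum R^1\otimes R^2\in H\otimes H$ is invertible with $\sum R^1h_{(1)}\otimes R^2h_{(2)}=\sum h_{(2)}R^1\otimes h_{(1)}R^2$ for all $h\in H$, $(\Delta\otimes id)(R)=R^{13}R^{23}$, $(id\otimes\Delta)(R)=R^{13}R^{12}$. Left adjoint action: $h\cdot_{ad}a=\sum h_{(1)}aS(h_{(2)})$. Transmuted braided group $H_R$: the vector space $H$ with the action $\cdot_{ad}$ and the (coassociative) coproduct $\Delta_R(h)=\sum h_{(1)}S(R^2)\otimes R^1\cdot_{ad}h_{(2)}$ and counit $\varepsilon$. A minimal $H$-adjoint-stable subcoalgebra is a nonzero subcoalgebra of $(H_R,\Delta_R)$ stable under $\cdot_{ad}$ and minimal with these properties. For a left $D$-comodule $W$ (with $w\mapsto\sum w^{\langle-1\rangle}\otimes w^{\langle0\rangle}$, $D$ a coalgebra via $\Delta_R$), $H\otimes W$ is a left $D$-comodule via $\rho_R(h\otimes w)=\sum h_{(1)}\cdot_{ad}w^{\langle-1\rangle}\otimes h_{(2)}\otimes w^{\langle0\rangle}$. For finite dimensional $W$, $W^*$ is a right $D$-comodule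 via $\sum\langle w^{*\langle0\rangle},w\rangle w^{*\langle1\rangle}=\sum w^{\langle-1\rangle}\langle w^*,w^{\langle0\rangle}\rangle$. The $R$-adjoint-stable algebra of $W$ is the cotensor product $N_W=W^*\square_D(H\otimes W)\subseteq W^*\otimes H\otimes W$ with multiplication $$x\circ y=\sum_{i,j}w_i^*\otimes h_ig_j\otimes\langle v_j^*,w_i\rangle v_j\quad\text{for }x=\sum_jv_j^*\otimes g_j\otimes v_j,\ y=\sum_iw_i^*\otimes h_i\otimes w_i,$$ and unit $\sum_ie_i^*\otimes1_H\otimes e_i$ for a dual basis $\{e_i,e_i^*\}$ of $W$. It is a left $H$-comodule algebra via $\rho(x)=\sum_iS(h_{i(2)})\otimes w_i^*\otimes h_{i(1)}\otimes w_i$ for $x=\sum_iw_i^*\otimes h_i\otimes w_i$. An $H$-comodule algebra is $H$-simple if it has no non-trivial $H$-costable (two-sided) ideal. *)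

theory Defs
  imports "HOL-Analysis.Analysis"
begin

text \<open>
  A finite-dimensional vector space over the field \<open>'k\<close> is given in coordinates, as \<open>'k ^ 'n\<close> for a
  finite index type \<open>'n\<close> (of arbitrary size), so that the tensor product of \<open>'k ^ 'a\<close> and \<open>'k ^ 'b\<close>
  is \<open>'k ^ ('a \<times> 'b)\<close>. All structure maps are arbitrary linear maps; coordinates are only used to
  construct the tensor product and the dual space.

  \<open>tsum t \<beta>\<close> is the value at \<open>t\<close> of the linear map on the tensor product induced by the bilinear
  map \<open>\<beta>\<close>. It renders Sweedler notation: if \<open>t = \<Sum> x \<otimes> y\<close>, then \<open>tsum t (\<lambda>x y. \<beta> x y) = \<Sum> \<beta> x y\<close>
  (see \<open>tsum_tens\<close> and \<open>tsum_sum_tens\<close>).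
\<close>

abbreviation lin :: "('k::field ^ 'a \<Rightarrow> 'k ^ 'b) \<Rightarrow> bool"
  where "lin f \<equiv> Vector_Spaces.linear (*s) (*s) f"

abbreviation lin_form :: "('k::field ^ 'a \<Rightarrow> 'k) \<Rightarrow> bool"
  where "lin_form f \<equiv> Vector_Spaces.linear (*s) (*) f"

definition bilin :: "('k::field ^ 'a \<Rightarrow> 'k ^ 'b \<Rightarrow> 'k ^ 'c) \<Rightarrow> bool"
  where "bilin \<beta> \<longleftrightarrow> (\<forall>x. lin (\<beta> x)) \<and> (\<forall>y. lin (\<lambda>x. \<beta> x y))"

definition tens :: "'k::field ^ 'a \<Rightarrow> 'k ^ 'b \<Rightarrow> 'k ^ ('a \<times> 'b)"  (infixr "\<otimes>\<^sub>k" 75)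
  where "v \<otimes>\<^sub>k w = (\<chi> p. v $ fst p * w $ snd p)"

definition tsum :: "'k::field ^ ('a \<times> 'b) \<Rightarrow> ('k ^ 'a \<Rightarrow> 'k ^ 'b \<Rightarrow> 'k ^ 'c) \<Rightarrow> 'k ^ 'c"
  where "tsum t \<beta> = (\<Sum>i\<in>UNIV. \<Sum>j\<in>UNIV. t $ (i, j) *s \<beta> (axis i 1) (axis j 1))"

definition tens_space :: "('k::field ^ 'a) set \<Rightarrow> ('k ^ 'b) set \<Rightarrow> ('k ^ ('a \<times> 'b)) set"
  where "tens_space A B = vec.span {a \<otimes>\<^sub>k b | a b. a \<in> A \<and> b \<in> B}"

lemma lin_basis_expansion:
  assumes "lin f"
  shows "f v = (\<Sum>i\<in>UNIV. v $ i *s f (axis i 1))"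
proof -
  interpret f: Vector_Spaces.linear "(*s)" "(*s)" f by (rule assms)
  have "f v = f (\<Sum>i\<in>UNIV. v $ i *s axis i 1)"
    by (simp add: basis_expansion)
  then show ?thesis
    by (simp add: f.sum f.scale)
qed

lemma tsum_tens:
  assumes "bilin \<beta>"
  shows "tsum (v \<otimes>\<^sub>k w) \<beta> = \<beta> v w"
proof -
  have l: "lin (\<beta> x)" "lin (\<lambda>x. \<beta> x y)" for x y
    using assms by (auto simp: bilin_def)
  have "\<beta> v w = (\<Sum>i\<in>UNIV. v $ i *s \<beta> (axis i 1) w)"
    by (rule lin_basis_expansion[OF l(2)])
  also have "\<dots> = (\<Sum>i\<in>UNIV. v $ i *s (\<Sum>j\<in>UNIV. w $ j *s \<beta> (axis i 1) (axis j 1)))"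
    by (subst lin_basis_expansion[OF l(1)]) (rule refl)
  also have "\<dots> = tsum (v \<otimes>\<^sub>k w) \<beta>"
    by (simp add: tsum_def tens_def vec.scale_sum_right)
  finally show ?thesis by simp
qed

lemma lin_tsum: "lin (\<lambda>t. tsum t \<beta>)"
  by unfold_locales
    (simp_all add: tsum_def vec.scale_left_distrib sum.distrib vec.scale_sum_right)

lemma tsum_sum_tens:
  assumes "bilin \<beta>"
  shows "tsum (\<Sum>i\<in>I. v i \<otimes>\<^sub>k w i) \<beta> = (\<Sum>i\<in>I. \<beta> (v i) (w i))"
proof -
  interpret f: Vector_Spaces.linear "(*s)" "(*s)" "\<lambda>t. tsum t \<beta>" by (rule lin_tsum)
  show ?thesis by (simp add: f.sum tsum_tens[OF assms])
qed

text \<open>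
  In the predicates relative to a subspace \<open>N\<close> or \<open>M\<close> the structure maps are linear on the ambient
  space, and the axioms are only required on the subspace. (Every linear map on a subspace extends to
  the ambient space; linearity there is needed to evaluate \<open>tsum\<close>.)
\<close>

definition algebra_on ::
  "('k::field ^ 'a) set \<Rightarrow> ('k ^ 'a \<Rightarrow> 'k ^ 'a \<Rightarrow> 'k ^ 'a) \<Rightarrow> 'k ^ 'a \<Rightarrow> bool"
  where "algebra_on N m u \<longleftrightarrow>
    vec.subspace N \<and> bilin m \<and> u \<in> N \<and> (\<forall>x\<in>N. \<forall>y\<in>N. m x y \<in> N) \<and>
    (\<forall>x\<in>N. \<forall>y\<in>N. \<forall>z\<in>N. m (m x y) z = m x (m y z)) \<and>
    (\<forall>x\<in>N. m u x = x \<and> m x u = x)"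

definition tensor_mult ::
  "('k::field ^ 'a \<Rightarrow> 'k ^ 'a \<Rightarrow> 'k ^ 'a) \<Rightarrow> ('k ^ 'b \<Rightarrow> 'k ^ 'b \<Rightarrow> 'k ^ 'b) \<Rightarrow>
    'k ^ ('a \<times> 'b) \<Rightarrow> 'k ^ ('a \<times> 'b) \<Rightarrow> 'k ^ ('a \<times> 'b)"
  where "tensor_mult m\<^sub>1 m\<^sub>2 s t = tsum s (\<lambda>a b. tsum t (\<lambda>c d. m\<^sub>1 a c \<otimes>\<^sub>k m\<^sub>2 b d))"

definition coalgebra ::
  "('k::field ^ 'n \<Rightarrow> 'k ^ ('n \<times> 'n)) \<Rightarrow> ('k ^ 'n \<Rightarrow> 'k) \<Rightarrow> bool"
  where "coalgebra \<Delta> \<epsilon> \<longleftrightarrow>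
    lin \<Delta> \<and> lin_form \<epsilon> \<and>
    (\<forall>h. tsum (\<Delta> h) (\<lambda>x y. tsum (\<Delta> x) (\<lambda>a b. a \<otimes>\<^sub>k b \<otimes>\<^sub>k y)) = tsum (\<Delta> h) (\<lambda>x y. x \<otimes>\<^sub>k \<Delta> y)) \<and>
    (\<forall>h. tsum (\<Delta> h) (\<lambda>x y. \<epsilon> x *s y) = h) \<and>
    (\<forall>h. tsum (\<Delta> h) (\<lambda>x y. \<epsilon> y *s x) = h)"

definition subcoalgebra :: "('k::field ^ 'n \<Rightarrow> 'k ^ ('n \<times> 'n)) \<Rightarrow> ('k ^ 'n) set \<Rightarrow> bool"
  where "subcoalgebra \<Delta> C \<longleftrightarrow> vec.subspace C \<and> (\<forall>c\<in>C. \<Delta> c \<in> tens_space C C)"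

definition left_comodule ::
  "('k::field ^ 'n \<Rightarrow> 'k ^ ('n \<times> 'n)) \<Rightarrow> ('k ^ 'n \<Rightarrow> 'k) \<Rightarrow> ('k ^ 'n) set \<Rightarrow>
    ('k ^ 'm) set \<Rightarrow> ('k ^ 'm \<Rightarrow> 'k ^ ('n \<times> 'm)) \<Rightarrow> bool"
  where "left_comodule \<Delta> \<epsilon> D M \<delta> \<longleftrightarrow>
    vec.subspace M \<and> lin \<delta> \<and> (\<forall>x\<in>M. \<delta> x \<in> tens_space D M) \<and>
    (\<forall>x\<in>M. tsum (\<delta> x) (\<lambda>d v. tsum (\<Delta> d) (\<lambda>a b. a \<otimes>\<^sub>k b \<otimes>\<^sub>k v)) = tsum (\<delta> x) (\<lambda>d v. d \<otimes>\<^sub>k \<delta> v)) \<and>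
    (\<forall>x\<in>M. tsum (\<delta> x) (\<lambda>d v. \<epsilon> d *s v) = x)"

record ('k, 'n) hopf_data =
  mult :: "'k ^ 'n \<Rightarrow> 'k ^ 'n \<Rightarrow> 'k ^ 'n"
  unit :: "'k ^ 'n"
  comult :: "'k ^ 'n \<Rightarrow> 'k ^ ('n \<times> 'n)"
  counit :: "'k ^ 'n \<Rightarrow> 'k"
  antipode :: "'k ^ 'n \<Rightarrow> 'k ^ 'n"

definition hopf_algebra :: "('k::field, 'n::finite) hopf_data \<Rightarrow> bool"
  where "hopf_algebra H \<longleftrightarrow>
    algebra_on UNIV (mult H) (unit H) \<and>
    coalgebra (comult H) (counit H) \<and>
    (\<forall>x y. comult H (mult H x y) = tensor_mult (mult H) (mult H) (comult H x) (comult H y)) \<and>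
    comult H (unit H) = unit H \<otimes>\<^sub>k unit H \<and>
    (\<forall>x y. counit H (mult H x y) = counit H x * counit H y) \<and>
    counit H (unit H) = 1 \<and>
    lin (antipode H) \<and>
    (\<forall>h. tsum (comult H h) (\<lambda>x y. mult H (antipode H x) y) = counit H h *s unit H) \<and>
    (\<forall>h. tsum (comult H h) (\<lambda>x y. mult H x (antipode H y)) = counit H h *s unit H)"

definition left_ideal :: "('k::field, 'n::finite) hopf_data \<Rightarrow> ('k ^ 'n) set \<Rightarrow> bool"
  where "left_ideal H I \<longleftrightarrow> vec.subspace I \<and> (\<forall>h. \<forall>x\<in>I. mult H h x \<in> I)"

definition minimal_left_ideal :: "('k::field, 'n::finite) hopf_data \<Rightarrow> ('k ^ 'n) set \<Rightarrow> bool"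
  where "minimal_left_ideal H I \<longleftrightarrow>
    left_ideal H I \<and> I \<noteq> {0} \<and> (\<forall>J. left_ideal H J \<and> J \<noteq> {0} \<and> J \<subseteq> I \<longrightarrow> J = I)"

text \<open>
  Semisimplicity and cosemisimplicity are stated as: the left regular module is a sum of simple
  submodules, and the coalgebra is a sum of simple subcoalgebras.
\<close>

definition semisimple :: "('k::field, 'n::finite) hopf_data \<Rightarrow> bool"
  where "semisimple H \<longleftrightarrow> vec.span (\<Union>{I. minimal_left_ideal H I}) = UNIV"

definition simple_subcoalgebra :: "('k::field ^ 'n \<Rightarrow> 'k ^ ('n \<times> 'n)) \<Rightarrow> ('k ^ 'n) set \<Rightarrow> bool"
  where "simple_subcoalgebra \<Delta> C \<longleftrightarrow>
    subcoalgebra \<Delta> C \<and> C \<noteq> {0} \<and> (\<forall>E. subcoalgebra \<Delta> E \<and> E \<noteq> {0} \<and> E \<subseteq> C \<longrightarrow> E = C)"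

definition cosemisimple :: "('k::field, 'n::finite) hopf_data \<Rightarrow> bool"
  where "cosemisimple H \<longleftrightarrow> vec.span (\<Union>{C. simple_subcoalgebra (comult H) C}) = UNIV"

definition quasitriangular ::
  "('k::field, 'n::finite) hopf_data \<Rightarrow> 'k ^ ('n \<times> 'n) \<Rightarrow> bool"
  where "quasitriangular H R \<longleftrightarrow>
    (let mult2 = tensor_mult (mult H) (mult H);
         mult3 = tensor_mult (mult H) mult2;
         R12 = tsum R (\<lambda>a b. a \<otimes>\<^sub>k b \<otimes>\<^sub>k unit H);
         R13 = tsum R (\<lambda>a b. a \<otimes>\<^sub>k unit H \<otimes>\<^sub>k b);
         R23 = tsum R (\<lambda>a b. unit H \<otimes>\<^sub>k a \<otimes>\<^sub>k b)
     in
      (\<exists>Q. mult2 R Q = unit H \<otimes>\<^sub>k unit H \<and> mult2 Q R = unit H \<otimes>\<^sub>k unit H) \<and>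
      (\<forall>h. tsum R (\<lambda>r1 r2. tsum (comult H h) (\<lambda>h1 h2. mult H r1 h1 \<otimes>\<^sub>k mult H r2 h2)) =
           tsum R (\<lambda>r1 r2. tsum (comult H h) (\<lambda>h1 h2. mult H h2 r1 \<otimes>\<^sub>k mult H h1 r2))) \<and>
      tsum R (\<lambda>r1 r2. tsum (comult H r1) (\<lambda>a b. a \<otimes>\<^sub>k b \<otimes>\<^sub>k r2)) = mult3 R13 R23 \<and>
      tsum R (\<lambda>r1 r2. r1 \<otimes>\<^sub>k comult H r2) = mult3 R13 R12)"

definition adj :: "('k::field, 'n::finite) hopf_data \<Rightarrow> 'k ^ 'n \<Rightarrow> 'k ^ 'n \<Rightarrow> 'k ^ 'n"
  where "adj H h a = tsum (comult H h) (\<lambda>h1 h2. mult H (mult H h1 a) (antipode H h2))"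

definition comultR ::
  "('k::field, 'n::finite) hopf_data \<Rightarrow> 'k ^ ('n \<times> 'n) \<Rightarrow> 'k ^ 'n \<Rightarrow> 'k ^ ('n \<times> 'n)"
  where "comultR H R h =
    tsum (comult H h) (\<lambda>h1 h2. tsum R (\<lambda>r1 r2. mult H h1 (antipode H r2) \<otimes>\<^sub>k adj H r1 h2))"

definition adj_stable_subcoalgebra ::
  "('k::field, 'n::finite) hopf_data \<Rightarrow> 'k ^ ('n \<times> 'n) \<Rightarrow> ('k ^ 'n) set \<Rightarrow> bool"
  where "adj_stable_subcoalgebra H R D \<longleftrightarrow>
    subcoalgebra (comultR H R) D \<and> D \<noteq> {0} \<and> (\<forall>h. \<forall>d\<in>D. adj H h d \<in> D)"

definition minimal_adj_stable_subcoalgebra ::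
  "('k::field, 'n::finite) hopf_data \<Rightarrow> 'k ^ ('n \<times> 'n) \<Rightarrow> ('k ^ 'n) set \<Rightarrow> bool"
  where "minimal_adj_stable_subcoalgebra H R D \<longleftrightarrow>
    adj_stable_subcoalgebra H R D \<and>
    (\<forall>E. adj_stable_subcoalgebra H R E \<and> E \<subseteq> D \<longrightarrow> E = D)"

text \<open>
  The dual of \<open>'k ^ 'w\<close> is again \<open>'k ^ 'w\<close>, in the dual basis; \<open>pairing\<close> is the evaluation.
  The formula for \<open>dual_coaction\<close> is the one forced by its defining property; see
  \<open>dual_coaction_unique\<close>.
\<close>

definition pairing :: "'k::field ^ 'w \<Rightarrow> 'k ^ 'w \<Rightarrow> 'k"
  where "pairing f w = (\<Sum>i\<in>UNIV. f $ i * w $ i)"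

definition dual_coaction ::
  "('k::field ^ 'w \<Rightarrow> 'k ^ ('n::finite \<times> 'w)) \<Rightarrow> 'k ^ 'w \<Rightarrow> 'k ^ ('w \<times> 'n)"
  where "dual_coaction \<delta> f =
    (\<Sum>i\<in>UNIV. axis i 1 \<otimes>\<^sub>k tsum (\<delta> (axis i 1)) (\<lambda>d v. pairing f v *s d))"

lemma tsum_pairing_component:
  fixes t :: "'k::field ^ ('w::finite \<times> 'n::finite)"
  shows "tsum t (\<lambda>g d. pairing g (axis i 1) *s d) $ a = t $ (i, a)"
proof -
  have "pairing (axis j 1) (axis i 1 :: 'k ^ 'w) = (if j = i then 1 else 0)" for j
  proof -
    have "axis j 1 $ k * (axis i 1 :: 'k ^ 'w) $ k = (if k = i then if j = i then 1 else 0 else 0)" for k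
      by (simp add: axis_def)
    then show ?thesis
      by (simp add: pairing_def)
  qed
  then have "tsum t (\<lambda>g d. pairing g (axis i 1) *s d) =
      (\<Sum>j\<in>UNIV. if j = i then (\<Sum>b\<in>UNIV. t $ (j, b) *s axis b 1) else 0)"
    unfolding tsum_def by (intro sum.cong) auto
  then show ?thesis
    by (simp add: axis_def if_distrib cong: if_cong)
qed

lemma dual_coaction_unique:
  fixes \<delta> :: "'k::field ^ 'w \<Rightarrow> 'k ^ ('n::finite \<times> 'w)"
  assumes "lin \<delta>"
  shows "t = dual_coaction \<delta> f \<longleftrightarrow>
    (\<forall>w. tsum t (\<lambda>g d. pairing g w *s d) = tsum (\<delta> w) (\<lambda>d v. pairing f v *s d))"
proof -
  have comp: "dual_coaction \<delta> f $ (i, a) = tsum (\<delta> (axis i 1)) (\<lambda>d v. pairing f v *s d) $ a" for i a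
    by (simp add: dual_coaction_def tens_def axis_def if_distrib if_distribR cong: if_cong)
  have p: "pairing g (v + w) = pairing g v + pairing g w" "pairing g (c *s v) = c * pairing g v"
    for g v w :: "'k ^ 'w" and c
    by (simp_all add: pairing_def distrib_left sum.distrib sum_distrib_left mult.left_commute)
  have l1: "lin (\<lambda>w. tsum s (\<lambda>g d. pairing g w *s d))" for s :: "'k ^ ('w \<times> 'n)"
    by unfold_locales
      (simp_all add: tsum_def p vec.scale_left_distrib vec.scale_right_distrib sum.distrib
        vec.scale_sum_right mult.assoc mult.left_commute)
  have l2: "lin (\<lambda>w. tsum (\<delta> w) (\<lambda>d v. pairing f v *s d))"
    using Vector_Spaces.linear_compose[OF assms lin_tsum] by (simp add: o_def)
  show ?thesis
  proof
    assume t: "t = dual_coaction \<delta> f"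
    have "tsum t (\<lambda>g d. pairing g (axis i 1) *s d)
        = tsum (\<delta> (axis i 1)) (\<lambda>d v. pairing f v *s d)" for i
      by (simp add: vec_eq_iff t tsum_pairing_component comp)
    then show "\<forall>w. tsum t (\<lambda>g d. pairing g w *s d) = tsum (\<delta> w) (\<lambda>d v. pairing f v *s d)"
      by (subst lin_basis_expansion[OF l1], subst lin_basis_expansion[OF l2]) simp
  next
    assume "\<forall>w. tsum t (\<lambda>g d. pairing g w *s d) = tsum (\<delta> w) (\<lambda>d v. pairing f v *s d)"
    then have "t $ (i, a) = dual_coaction \<delta> f $ (i, a)" for i a
      by (subst tsum_pairing_component[symmetric]) (simp add: comp)
    then show "t = dual_coaction \<delta> f"
      by (simp add: vec_eq_iff)
  qed
qed

definition rhoR ::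
  "('k::field, 'n::finite) hopf_data \<Rightarrow> ('k ^ 'w \<Rightarrow> 'k ^ ('n \<times> 'w)) \<Rightarrow>
    'k ^ ('n \<times> 'w) \<Rightarrow> 'k ^ ('n \<times> ('n \<times> 'w))"
  where "rhoR H \<delta> t = tsum t (\<lambda>h w.
    tsum (comult H h) (\<lambda>h1 h2. tsum (\<delta> w) (\<lambda>d v. adj H h1 d \<otimes>\<^sub>k h2 \<otimes>\<^sub>k v)))"

text \<open>Cotensor product of a right comodule with coaction \<open>\<gamma>\<close> and a left comodule with coaction \<open>\<rho>\<close>.\<close>

definition cotensor ::
  "('k::field ^ 'a \<Rightarrow> 'k ^ ('a \<times> 'n::finite)) \<Rightarrow> ('k ^ 'b \<Rightarrow> 'k ^ ('n \<times> 'b)) \<Rightarrow> ('k ^ ('a \<times> 'b)) set"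
  where "cotensor \<gamma> \<rho> =
    {x. tsum x (\<lambda>f t. tsum (\<gamma> f) (\<lambda>g d. g \<otimes>\<^sub>k d \<otimes>\<^sub>k t)) = tsum x (\<lambda>f t. f \<otimes>\<^sub>k \<rho> t)}"

definition NW ::
  "('k::field, 'n::finite) hopf_data \<Rightarrow> ('k ^ 'w \<Rightarrow> 'k ^ ('n \<times> 'w)) \<Rightarrow> ('k ^ ('w \<times> ('n \<times> 'w))) set"
  where "NW H \<delta> = cotensor (dual_coaction \<delta>) (rhoR H \<delta>)"

definition NW_mult ::
  "('k::field, 'n::finite) hopf_data \<Rightarrow>
    'k ^ ('w::finite \<times> ('n \<times> 'w)) \<Rightarrow> 'k ^ ('w \<times> ('n \<times> 'w)) \<Rightarrow> 'k ^ ('w \<times> ('n \<times> 'w))"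
  where "NW_mult H x y =
    tsum x (\<lambda>v' gv. tsum gv (\<lambda>g v.
      tsum y (\<lambda>w' hw. tsum hw (\<lambda>h w.
        w' \<otimes>\<^sub>k mult H h g \<otimes>\<^sub>k (pairing v' w *s v)))))"

definition NW_unit :: "('k::field, 'n::finite) hopf_data \<Rightarrow> 'k ^ ('w::finite \<times> ('n \<times> 'w))"
  where "NW_unit H = (\<Sum>i\<in>UNIV. axis i 1 \<otimes>\<^sub>k unit H \<otimes>\<^sub>k axis i 1)"

definition NW_coaction ::
  "('k::field, 'n::finite) hopf_data \<Rightarrow>
    'k ^ ('w::finite \<times> ('n \<times> 'w)) \<Rightarrow> 'k ^ ('n \<times> ('w \<times> ('n \<times> 'w)))"
  where "NW_coaction H x =
    tsum x (\<lambda>w' hw. tsum hw (\<lambda>h w.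
      tsum (comult H h) (\<lambda>h1 h2. antipode H h2 \<otimes>\<^sub>k w' \<otimes>\<^sub>k h1 \<otimes>\<^sub>k w)))"

definition left_comodule_algebra ::
  "('k::field, 'n::finite) hopf_data \<Rightarrow> ('k ^ 'a) set \<Rightarrow>
    ('k ^ 'a \<Rightarrow> 'k ^ 'a \<Rightarrow> 'k ^ 'a) \<Rightarrow> 'k ^ 'a \<Rightarrow> ('k ^ 'a \<Rightarrow> 'k ^ ('n \<times> 'a)) \<Rightarrow> bool"
  where "left_comodule_algebra H N m u \<rho> \<longleftrightarrow>
    algebra_on N m u \<and>
    left_comodule (comult H) (counit H) UNIV N \<rho> \<and>
    (\<forall>x\<in>N. \<forall>y\<in>N. \<rho> (m x y) = tensor_mult (mult H) m (\<rho> x) (\<rho> y)) \<and>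
    \<rho> u = unit H \<otimes>\<^sub>k u"

definition costable_ideal ::
  "('k::field ^ 'a) set \<Rightarrow> ('k ^ 'a \<Rightarrow> 'k ^ 'a \<Rightarrow> 'k ^ 'a) \<Rightarrow>
    ('k ^ 'a \<Rightarrow> 'k ^ ('n::finite \<times> 'a)) \<Rightarrow> ('k ^ 'a) set \<Rightarrow> bool"
  where "costable_ideal N m \<rho> I \<longleftrightarrow>
    vec.subspace I \<and> I \<subseteq> N \<and>
    (\<forall>x\<in>N. \<forall>y\<in>I. m x y \<in> I \<and> m y x \<in> I) \<and>
    (\<forall>y\<in>I. \<rho> y \<in> tens_space UNIV I)"

definition H_simple ::
  "('k::field, 'n::finite) hopf_data \<Rightarrow> ('k ^ 'a) set \<Rightarrow>
    ('k ^ 'a \<Rightarrow> 'k ^ 'a \<Rightarrow> 'k ^ 'a) \<Rightarrow> 'k ^ 'a \<Rightarrow> ('k ^ 'a \<Rightarrow> 'k ^ ('n \<times> 'a)) \<Rightarrow> bool"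
  where "H_simple H N m u \<rho> \<longleftrightarrow>
    left_comodule_algebra H N m u \<rho> \<and>
    (\<forall>I. costable_ideal N m \<rho> I \<longrightarrow> I = {0} \<or> I = N)"

end

theory Submission
  imports Defs
begin

text \<open>
  The elements of \<open>N\<^sub>W\<close> are the \<open>D\<close>-colinear maps \<open>W \<rightarrow> H \<otimes> W\<close>. Such a map extends to an \<open>H\<close>-linear and
  \<open>D\<close>-colinear endomorphism of \<open>H \<otimes> W\<close>, and the product of \<open>N\<^sub>W\<close> is composition of these endomorphisms
  (\<open>NW_iff_colinear\<close>, \<open>lin_form_ap_mult\<close>). That \<open>N\<^sub>W\<close> is a comodule algebra then expresses that \<open>\<rho>\<^sub>R\<close> is
  compatible with left multiplication by \<open>H\<close> and commutes with the right coaction given by the coproduct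
  of \<open>H\<close>.

  Simplicity rests on one tool, a coseparability form \<open>B\<close> for the transmuted coproduct \<open>\<Delta>\<^sub>R\<close>. By
  cosemisimplicity there is a normalised integral \<open>lam\<close> of the dual, and by semisimplicity a normalised
  integral \<open>\<Lambda>\<close> of \<open>H\<close>. Together they yield bijectivity of the antipode \<open>S\<close> and the trace rule
  \<open>lam (h y) = lam (y S\<^sup>2(h))\<close>, so that \<open>lam\<close> is invariant under the adjoint action (\<open>lam_adjoint\<close>). With
  this invariance, \<open>B x y = \<Sum> lam (x R\<^sup>2 S(R\<^sup>1 . y))\<close> satisfies \<open>\<Sum> B x\<^sub>1 x\<^sub>2 = \<epsilon> x\<close> and
  \<open>\<Sum> x\<^sub>1 B x\<^sub>2 y = \<Sum> B x y\<^sub>1 y\<^sub>2\<close>, the coproducts being \<open>\<Delta>\<^sub>R\<close> (\<open>B_comultR\<close>, \<open>B_balanced\<close>). Hence any linear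
  map between comodules can be averaged to a colinear one (\<open>colinear_average\<close>).

  Let \<open>I\<close> be a nonzero costable ideal of \<open>N\<^sub>W\<close>, and let \<open>T\<close> be the submodule of \<open>H \<otimes> W\<close> generated by the
  images of its elements. Costability makes \<open>T\<close> a Hopf submodule, so \<open>T = H \<otimes> U\<close> for a subspace \<open>U\<close> of \<open>W\<close>,
  which is a subcomodule. As \<open>I\<close> is an ideal, every element of \<open>N\<^sub>W\<close> maps \<open>U\<close> into \<open>H \<otimes> U\<close>.

  Suppose \<open>U\<close> is proper. Averages of rank one maps are elements of \<open>N\<^sub>W\<close>, and that they preserve \<open>U\<close> says
  that \<open>B(c, h . c') = 0\<close> for all \<open>h\<close>, all coefficients \<open>c\<close> of \<open>U\<close> and all coefficients \<open>c'\<close> of \<open>W / U\<close>. The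
  elements \<open>h . c'\<close> span an adjoint-stable subcoalgebra, which is all of \<open>D\<close> by minimality. Therefore
  \<open>\<epsilon> c = \<Sum> B c\<^sub>1 c\<^sub>2 = 0\<close>, and \<open>U = 0\<close>, contrary to \<open>I \<noteq> 0\<close> (\<open>U_full\<close>). So \<open>U = W\<close>, which means that
  \<open>\<one> \<otimes> w\<close> lies in \<open>T\<close> for every \<open>w\<close>. Averaging a linear expression of \<open>w \<mapsto> \<one> \<otimes> w\<close> through the
  generators of \<open>T\<close> writes the unit of \<open>N\<^sub>W\<close> as a sum of products \<open>x \<circ> y\<close> with \<open>x \<in> I\<close>
  (\<open>unit_in_ideal\<close>), and \<open>I = N\<^sub>W\<close>.
\<close>

section \<open>Multilinear forms on tensor products\<close>

text \<open>
  The scalar-valued counterpart of \<open>tsum\<close>. Every identity between tensors below is tested against all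
  multilinear forms, so that a Sweedler sum \<open>\<Sum> \<phi> (h1, h2)\<close> becomes the number \<open>tev (\<Delta> h) \<phi>\<close>. A
  coassociativity, antipode or counit axiom is then a rewrite rule for nested \<open>tev\<close>, and its only side
  condition is that the integrand is multilinear.
\<close>

definition tev :: "'k::field ^ ('a::finite \<times> 'b::finite) \<Rightarrow> ('k ^ 'a \<Rightarrow> 'k ^ 'b \<Rightarrow> 'k) \<Rightarrow> 'k"
  where "tev t \<phi> = (\<Sum>i\<in>UNIV. \<Sum>j\<in>UNIV. t $ (i, j) * \<phi> (axis i 1) (axis j 1))"

definition bform :: "('k::field ^ 'a::finite \<Rightarrow> 'k ^ 'b::finite \<Rightarrow> 'k) \<Rightarrow> bool"
  where "bform \<phi> \<longleftrightarrow> (\<forall>x. lin_form (\<phi> x)) \<and> (\<forall>y. lin_form (\<lambda>x. \<phi> x y))"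

definition tform :: "('k::field ^ 'a::finite \<Rightarrow> 'k ^ 'b::finite \<Rightarrow> 'k ^ 'c::finite \<Rightarrow> 'k) \<Rightarrow> bool"
  where "tform \<phi> \<longleftrightarrow> (\<forall>x. bform (\<phi> x)) \<and> (\<forall>y z. lin_form (\<lambda>x. \<phi> x y z))"

lemma lin_form_iff:
  "lin_form f \<longleftrightarrow> (\<forall>x y. f (x + y) = f x + f y) \<and> (\<forall>c x. f (c *s x) = c * f x)"
proof -
  have "vector_space ((*) :: 'a \<Rightarrow> 'a \<Rightarrow> 'a)"
    by unfold_locales (simp_all add: algebra_simps)
  then show ?thesis
    unfolding Vector_Spaces.linear_iff by (simp add: vec.vector_space_axioms)
qed

lemma lin_iff:
  "lin f \<longleftrightarrow> (\<forall>x y. f (x + y) = f x + f y) \<and> (\<forall>c x. f (c *s x) = c *s f x)"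
  unfolding Vector_Spaces.linear_iff by (auto simp: vec.vector_space_axioms)

lemma lin_formD:
  assumes "lin_form f"
  shows "f (x + y) = f x + f y" "f (c *s x) = c * f x" "f 0 = 0" "f (x - y) = f x - f y"
    "f (- x) = - f x"
proof -
  interpret f: Vector_Spaces.linear "(*s)" "(*)" f by (rule assms)
  show "f (x + y) = f x + f y" "f (c *s x) = c * f x" "f 0 = 0" "f (x - y) = f x - f y"
    "f (- x) = - f x"
    by (fact f.add f.scale f.zero f.diff f.neg)+
qed

lemma lin_form_sum:
  assumes "lin_form f"
  shows "f (\<Sum>i\<in>I. g i) = (\<Sum>i\<in>I. f (g i))"
  by (induction I rule: infinite_finite_induct) (simp_all add: lin_formD[OF assms])

lemma lin_form_expansion:
  assumes "lin_form f"
  shows "f v = (\<Sum>i\<in>UNIV. v $ i * f (axis i 1))"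
proof -
  have "f v = f (\<Sum>i\<in>UNIV. v $ i *s axis i 1)"
    by (simp add: basis_expansion)
  then show ?thesis
    by (simp add: lin_form_sum[OF assms] lin_formD[OF assms])
qed

lemma lin_form_nth: "lin_form (\<lambda>x. x $ i)"
  by (simp add: lin_form_iff)

lemma vec_eq_formI:
  assumes "\<And>f. lin_form f \<Longrightarrow> f x = f y"
  shows "x = y"
  using assms[OF lin_form_nth] by (simp add: vec_eq_iff)

lemma bformD:
  assumes "bform \<phi>"
  shows "\<phi> (x + x') y = \<phi> x y + \<phi> x' y" "\<phi> (c *s x) y = c * \<phi> x y"
    "\<phi> x (y + y') = \<phi> x y + \<phi> x y'" "\<phi> x (c *s y) = c * \<phi> x y"
    "lin_form (\<phi> x)" "lin_form (\<lambda>x. \<phi> x y)"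
  using assms by (simp_all add: bform_def lin_form_iff)

text \<open>
  The same linearity statements for partial applications, which is the shape that an eta-contracted
  integrand of \<open>tev\<close> has.
\<close>

lemma bformD_fun:
  assumes "bform \<phi>"
  shows "\<phi> (x + x') = (\<lambda>y. \<phi> x y + \<phi> x' y)" "\<phi> (c *s x) = (\<lambda>y. c * \<phi> x y)"
  by (simp_all add: fun_eq_iff bformD[OF assms])

lemma tformD:
  assumes "tform \<phi>"
  shows "\<phi> (x + x') y z = \<phi> x y z + \<phi> x' y z" "\<phi> (c *s x) y z = c * \<phi> x y z"
    "\<phi> x (y + y') z = \<phi> x y z + \<phi> x y' z" "\<phi> x (c *s y) z = c * \<phi> x y z"
    "\<phi> x y (z + z') = \<phi> x y z + \<phi> x y z'" "\<phi> x y (c *s z) = c * \<phi> x y z"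
    "bform (\<phi> x)" "bform (\<lambda>x. \<phi> x y)" "bform (\<lambda>x y. \<phi> x y z)"
  using assms by (simp_all add: tform_def bform_def lin_form_iff)

lemma tformD_fun:
  assumes "tform \<phi>"
  shows "\<phi> (x + x') = (\<lambda>y z. \<phi> x y z + \<phi> x' y z)" "\<phi> (c *s x) = (\<lambda>y z. c * \<phi> x y z)"
    "\<phi> x (y + y') = (\<lambda>z. \<phi> x y z + \<phi> x y' z)" "\<phi> x (c *s y) = (\<lambda>z. c * \<phi> x y z)"
  by (simp_all add: fun_eq_iff tformD[OF assms])

lemmas form_defs = tform_def bform_def lin_form_iff

lemma tev_add_left: "tev (s + t) \<phi> = tev s \<phi> + tev t \<phi>"
  by (simp add: tev_def distrib_right sum.distrib)
lemma tev_scale_left: "tev (c *s t) \<phi> = c * tev t \<phi>"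
  by (simp add: tev_def sum_distrib_left mult.assoc)
lemma tev_add: "tev t (\<lambda>x y. F x y + G x y) = tev t F + tev t G"
  by (simp add: tev_def distrib_left sum.distrib)
lemma tev_scale: "tev t (\<lambda>x y. c * F x y) = c * tev t F"
  by (simp add: tev_def sum_distrib_left mult.left_commute)
lemma tev_scale2: "tev t (\<lambda>x y. F x y * c) = tev t F * c"
  by (simp add: tev_def sum_distrib_right mult.assoc)
lemma tev_zero: "tev t (\<lambda>x y. 0) = 0"
  by (simp add: tev_def)
lemma tev_diff: "tev t (\<lambda>x y. F x y - G x y) = tev t F - tev t G"
  by (simp add: tev_def right_diff_distrib sum_subtractf)
lemma tev_sum: "tev t (\<lambda>x y. \<Sum>i\<in>I. F i x y) = (\<Sum>i\<in>I. tev t (F i))"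
  by (induction I rule: infinite_finite_induct) (simp_all add: tev_zero tev_add)

lemma lin_form_tev: "lin_form (\<lambda>t. tev t \<phi>)"
  by (simp add: lin_form_iff tev_add_left tev_scale_left)

lemma tev_swap: "tev s (\<lambda>a b. tev t (\<lambda>c d. F a b c d)) = tev t (\<lambda>c d. tev s (\<lambda>a b. F a b c d))"
proof -
  have tev_pairs: "tev u \<psi> = (\<Sum>p\<in>UNIV. u $ p * \<psi> (axis (fst p) 1) (axis (snd p) 1))"
    for u :: "'a ^ ('x::finite \<times> 'y::finite)" and \<psi>
    by (simp add: tev_def sum.cartesian_product case_prod_beta)
  show ?thesis
    unfolding tev_pairs sum_distrib_left by (subst sum.swap) (simp add: mult.left_commute)
qed

lemma tev_tens:
  assumes "bform \<phi>"
  shows "tev (v \<otimes>\<^sub>k w) \<phi> = \<phi> v w"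
proof -
  have "\<phi> v w = (\<Sum>i\<in>UNIV. v $ i * \<phi> (axis i 1) w)"
    by (rule lin_form_expansion[OF bformD(6)[OF assms]])
  also have "\<dots> = (\<Sum>i\<in>UNIV. v $ i * (\<Sum>j\<in>UNIV. w $ j * \<phi> (axis i 1) (axis j 1)))"
    by (subst lin_form_expansion[OF bformD(5)[OF assms]]) (rule refl)
  finally show ?thesis
    by (simp add: tev_def tens_def sum_distrib_left mult.assoc)
qed

lemma tens_simps:
  "(v + v') \<otimes>\<^sub>k w = v \<otimes>\<^sub>k w + v' \<otimes>\<^sub>k w" "v \<otimes>\<^sub>k (w + w') = v \<otimes>\<^sub>k w + v \<otimes>\<^sub>k w'"
  "(c *s v) \<otimes>\<^sub>k w = c *s (v \<otimes>\<^sub>k w)" "v \<otimes>\<^sub>k (c *s w) = c *s (v \<otimes>\<^sub>k w)"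
  by (simp_all add: tens_def vec_eq_iff algebra_simps)

lemma tev_nth: "t $ (i, j) = tev t (\<lambda>x y. x $ i * y $ j)"
proof -
  have "(\<Sum>j'\<in>UNIV. t $ (i', j') * (axis i' 1 $ i * axis j' 1 $ j)) = (if i = i' then t $ (i, j) else 0)"
    for i'
    by (cases "i = i'") (simp_all add: axis_def if_distrib cong: if_cong)
  then show ?thesis
    by (simp add: tev_def)
qed

lemma lin_form_tens_expansion:
  assumes "lin_form f"
  shows "f t = tev t (\<lambda>x y. f (x \<otimes>\<^sub>k y))"
proof -
  have ax: "axis i 1 \<otimes>\<^sub>k axis j 1 = axis (i, j) 1" for i :: 'b and j :: 'c
    by (auto simp: vec_eq_iff tens_def axis_def)
  have "f t = (\<Sum>p\<in>UNIV. t $ p * f (axis p 1))"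
    by (rule lin_form_expansion[OF assms])
  also have "\<dots> = (\<Sum>i\<in>UNIV. \<Sum>j\<in>UNIV. t $ (i, j) * f (axis (i, j) 1))"
    by (simp add: sum.cartesian_product flip: UNIV_Times_UNIV)
  finally show ?thesis
    by (simp add: tev_def ax)
qed

lemma tens_eqI:
  assumes "\<And>\<phi>. bform \<phi> \<Longrightarrow> tev s \<phi> = tev t \<phi>"
  shows "s = t"
proof -
  have "s $ (i, j) = t $ (i, j)" for i j
    unfolding tev_nth by (rule assms) (simp add: form_defs algebra_simps)
  then show ?thesis
    by (simp add: vec_eq_iff)
qed

lemma lin_form_tsum:
  assumes "lin_form f"
  shows "f (tsum t \<beta>) = tev t (\<lambda>x y. f (\<beta> x y))"
  by (simp add: tsum_def tev_def lin_form_sum[OF assms] lin_formD[OF assms])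

lemma tev_tsum: "tev (tsum t \<beta>) \<phi> = tev t (\<lambda>x y. tev (\<beta> x y) \<phi>)"
  by (rule lin_form_tsum[OF lin_form_tev])

lemma tsum_add_left: "tsum (s + t) \<beta> = tsum s \<beta> + tsum t \<beta>"
  using lin_tsum[unfolded lin_iff] by blast
lemma tsum_scale_left: "tsum (c *s t) \<beta> = c *s tsum t \<beta>"
  using lin_tsum[unfolded lin_iff] by blast
lemma tsum_add: "tsum t (\<lambda>x y. F x y + G x y) = tsum t F + tsum t G"
  by (simp add: tsum_def vec.scale_right_distrib sum.distrib)
lemma tsum_scale: "tsum t (\<lambda>x y. c *s F x y) = c *s tsum t F"
  by (simp add: tsum_def vec.scale_sum_right mult.commute)

lemma lin_form_lin: "lin_form f \<Longrightarrow> lin g \<Longrightarrow> lin_form (\<lambda>x. f (g x))"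
  by (simp add: lin_form_iff lin_iff)

lemmas lin_simps = tev_add_left tev_scale_left tev_add tev_scale tens_simps tsum_add_left
  tsum_scale_left tsum_add tsum_scale

section \<open>Sweedler calculus in a Hopf algebra\<close>

locale hopf =
  fixes H :: "('k::field, 'n::finite) hopf_data"
  assumes hopf_algebra: "hopf_algebra H"
begin

abbreviation mul (infixl "\<cdot>" 70) where "x \<cdot> y \<equiv> mult H x y"
abbreviation one ("\<one>") where "\<one> \<equiv> unit H"
abbreviation eps ("\<epsilon>") where "\<epsilon> \<equiv> counit H"
abbreviation S where "S \<equiv> antipode H"
abbreviation sw where "sw h \<equiv> tev (comult H h)"

lemma bilin_mult: "bilin (mult H)" and lin_comult: "lin (comult H)"
  and lin_form_counit: "lin_form \<epsilon>" and lin_antipode: "lin S"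
  using hopf_algebra by (simp_all add: hopf_algebra_def algebra_on_def coalgebra_def)

lemma mult_assoc: "(x \<cdot> y) \<cdot> z = x \<cdot> (y \<cdot> z)"
  and mult_unit: "\<one> \<cdot> x = x" "x \<cdot> \<one> = x"
  and counit_mult: "\<epsilon> (x \<cdot> y) = \<epsilon> x * \<epsilon> y"
  and counit_unit: "\<epsilon> \<one> = 1"
  using hopf_algebra by (simp_all add: hopf_algebra_def algebra_on_def)

lemma hopf_linear:
  "(x + x') \<cdot> y = x \<cdot> y + x' \<cdot> y" "x \<cdot> (y + y') = x \<cdot> y + x \<cdot> y'"
  "(c *s x) \<cdot> y = c *s (x \<cdot> y)" "x \<cdot> (c *s y) = c *s (x \<cdot> y)"
  "comult H (x + x') = comult H x + comult H x'" "comult H (c *s x) = c *s comult H x"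
  "\<epsilon> (x + x') = \<epsilon> x + \<epsilon> x'" "\<epsilon> (c *s x) = c * \<epsilon> x"
  "S (x + x') = S x + S x'" "S (c *s x) = c *s S x"
  using bilin_mult lin_comult lin_form_counit lin_antipode
  by (simp_all add: bilin_def lin_iff lin_form_iff)

text \<open>
  These rules pull sums and scalars out of all structure maps. With the definitions of multilinear forms
  among them, they prove the multilinearity conditions of the Sweedler rules.
\<close>

lemmas lin_rules = hopf_linear lin_simps form_defs mult_assoc mult_unit counit_mult counit_unit
  distrib_left distrib_right tev_scale2 mult.assoc mult.left_commute mult.commute

lemma counit_l: "lin_form f \<Longrightarrow> sw h (\<lambda>a b. \<epsilon> a * f b) = f h"
proof -
  assume f: "lin_form f"
  have "tsum (comult H h) (\<lambda>x y. \<epsilon> x *s y) = h"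
    using hopf_algebra by (simp add: hopf_algebra_def coalgebra_def)
  then show ?thesis
    using lin_form_tsum[OF f, of "comult H h" "\<lambda>x y. \<epsilon> x *s y"] by (simp add: lin_formD[OF f])
qed

lemma counit_r: "lin_form f \<Longrightarrow> sw h (\<lambda>a b. \<epsilon> b * f a) = f h"
proof -
  assume f: "lin_form f"
  have "tsum (comult H h) (\<lambda>x y. \<epsilon> y *s x) = h"
    using hopf_algebra by (simp add: hopf_algebra_def coalgebra_def)
  then show ?thesis
    using lin_form_tsum[OF f, of "comult H h" "\<lambda>x y. \<epsilon> y *s x"] by (simp add: lin_formD[OF f])
qed

lemma coassoc:
  assumes "tform \<phi>"
  shows "sw h (\<lambda>x y. sw x (\<lambda>a b. \<phi> a b y)) = sw h (\<lambda>x y. sw y (\<lambda>b c. \<phi> x b c))"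
proof -
  have eq: "tsum (comult H h) (\<lambda>x y. tsum (comult H x) (\<lambda>a b. a \<otimes>\<^sub>k b \<otimes>\<^sub>k y)) =
      tsum (comult H h) (\<lambda>x y. x \<otimes>\<^sub>k comult H y)"
    using hopf_algebra by (simp add: hopf_algebra_def coalgebra_def)
  have b: "bform (\<lambda>x t. tev t (\<phi> x))"
  proof -
    have "\<phi> (x + x') = (\<lambda>y z. \<phi> x y z + \<phi> x' y z)" "\<phi> (c *s x) = (\<lambda>y z. c * \<phi> x y z)" for x x' c
      using tformD[OF assms] by (simp_all add: fun_eq_iff)
    then show ?thesis
      by (simp add: form_defs tev_add_left tev_scale_left tev_add tev_scale)
  qed
  show ?thesis
    using arg_cong[OF eq, of "\<lambda>t. tev t (\<lambda>x t. tev t (\<phi> x))"]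
    by (simp add: tev_tsum tev_tens[OF b] tev_tens[OF tformD(7)[OF assms]])
qed

lemma comult_mult: "bform \<phi> \<Longrightarrow> sw (x \<cdot> y) \<phi> = sw x (\<lambda>a b. sw y (\<lambda>c d. \<phi> (a \<cdot> c) (b \<cdot> d)))"
proof -
  assume b: "bform \<phi>"
  have "comult H (x \<cdot> y) = tensor_mult (mult H) (mult H) (comult H x) (comult H y)"
    using hopf_algebra by (simp add: hopf_algebra_def)
  then show ?thesis
    by (simp add: tensor_mult_def tev_tsum tev_tens[OF b])
qed

lemma comult_unit: "bform \<phi> \<Longrightarrow> sw \<one> \<phi> = \<phi> \<one> \<one>"
  using hopf_algebra by (simp add: hopf_algebra_def tev_tens)

lemma antipode_l: "lin_form f \<Longrightarrow> sw h (\<lambda>a b. f (S a \<cdot> b)) = \<epsilon> h * f \<one>"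
proof -
  assume f: "lin_form f"
  have "tsum (comult H h) (\<lambda>x y. S x \<cdot> y) = \<epsilon> h *s \<one>"
    using hopf_algebra by (simp add: hopf_algebra_def)
  then show ?thesis
    by (simp add: lin_formD[OF f] flip: lin_form_tsum[OF f])
qed

lemma antipode_r: "lin_form f \<Longrightarrow> sw h (\<lambda>a b. f (a \<cdot> S b)) = \<epsilon> h * f \<one>"
proof -
  assume f: "lin_form f"
  have "tsum (comult H h) (\<lambda>x y. x \<cdot> S y) = \<epsilon> h *s \<one>"
    using hopf_algebra by (simp add: hopf_algebra_def)
  then show ?thesis
    by (simp add: lin_formD[OF f] flip: lin_form_tsum[OF f])
qed

text \<open>
  In an iterated coproduct \<open>h1 \<otimes> h2 \<otimes> h3\<close> two adjacent legs cancel when one of them carries the antipode.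
  Read from right to left, these four rules insert \<open>S h2 \<cdot> h3\<close> or \<open>h2 \<cdot> S h3\<close> anywhere in a formula; this
  is how many proofs below begin.
\<close>

lemma antipode_cancel:
  assumes "bform \<phi>"
  shows "sw h (\<lambda>a t. sw t (\<lambda>b c. \<phi> (S a \<cdot> b) c)) = \<phi> \<one> h"
    and "sw h (\<lambda>a t. sw t (\<lambda>b c. \<phi> (a \<cdot> S b) c)) = \<phi> \<one> h"
    and "sw h (\<lambda>a t. sw t (\<lambda>b c. \<phi> a (S b \<cdot> c))) = \<phi> h \<one>"
    and "sw h (\<lambda>a t. sw t (\<lambda>b c. \<phi> a (b \<cdot> S c))) = \<phi> h \<one>"
proof -
  note [simp] = bformD[OF assms]
  have "sw h (\<lambda>a t. sw t (\<lambda>b c. \<phi> (S a \<cdot> b) c)) = sw h (\<lambda>t c. sw t (\<lambda>a b. \<phi> (S a \<cdot> b) c))"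
    by (subst coassoc) (simp_all add: lin_rules)
  then show "sw h (\<lambda>a t. sw t (\<lambda>b c. \<phi> (S a \<cdot> b) c)) = \<phi> \<one> h"
    by (simp add: antipode_l[where f="\<lambda>x. \<phi> x _"] counit_l)
  have "sw h (\<lambda>a t. sw t (\<lambda>b c. \<phi> (a \<cdot> S b) c)) = sw h (\<lambda>t c. sw t (\<lambda>a b. \<phi> (a \<cdot> S b) c))"
    by (subst coassoc) (simp_all add: lin_rules)
  then show "sw h (\<lambda>a t. sw t (\<lambda>b c. \<phi> (a \<cdot> S b) c)) = \<phi> \<one> h"
    by (simp add: antipode_r[where f="\<lambda>x. \<phi> x _"] counit_l)
  show "sw h (\<lambda>a t. sw t (\<lambda>b c. \<phi> a (S b \<cdot> c))) = \<phi> h \<one>"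
    by (simp add: antipode_l[where f="\<phi> _"] counit_r[where f="\<lambda>x. \<phi> x \<one>"])
  show "sw h (\<lambda>a t. sw t (\<lambda>b c. \<phi> a (b \<cdot> S c))) = \<phi> h \<one>"
    by (simp add: antipode_r[where f="\<phi> _"] counit_r[where f="\<lambda>x. \<phi> x \<one>"])
qed

lemma antipode_unit: "S \<one> = \<one>"
proof (rule vec_eq_formI)
  fix f :: "'k ^ 'n \<Rightarrow> 'k" assume f: "lin_form f"
  note [simp] = lin_formD[OF f]
  show "f (S \<one>) = f \<one>"
    using antipode_l[OF f, of \<one>] by (simp add: comult_unit lin_rules)
qed

lemma counit_antipode: "\<epsilon> (S h) = \<epsilon> h"
proof -
  have "\<epsilon> (S h) = sw h (\<lambda>a b. \<epsilon> (S a \<cdot> b))"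
    using counit_r[of "\<lambda>x. \<epsilon> (S x)" h] by (simp add: lin_rules mult.commute)
  then show ?thesis
    by (simp add: antipode_l[OF lin_form_counit] counit_unit)
qed

text \<open>
  Both sides are convolution inverses of the product: the sum
  \<open>S y1 \<cdot> S x1 \<cdot> (x2 \<cdot> y2) \<cdot> S (x3 \<cdot> y3)\<close> collapses to \<open>S y \<cdot> S x\<close> when the last two factors cancel, and to
  \<open>S (x \<cdot> y)\<close> when the first factors cancel.
\<close>

lemma antipode_mult: "S (x \<cdot> y) = S y \<cdot> S x"
proof (rule vec_eq_formI)
  fix f :: "'k ^ 'n \<Rightarrow> 'k" assume f: "lin_form f"
  note [simp] = lin_formD[OF f]
  let ?F = "\<lambda>a b c a' b' c'. f (S a \<cdot> (S a' \<cdot> (b' \<cdot> (b \<cdot> S (c' \<cdot> c)))))"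
  have "f (S y \<cdot> S x) = sw y (\<lambda>a t. sw x (\<lambda>a' t'. \<epsilon> t * (\<epsilon> t' * f (S a \<cdot> S a'))))"
    using counit_r[of "\<lambda>a. f (S y \<cdot> S a)" x] counit_r[of "\<lambda>b. f (S b \<cdot> S a)" y for a]
    by (simp add: lin_rules counit_r)
  also have "\<dots> = sw y (\<lambda>a t. sw x (\<lambda>a' t'. sw (t' \<cdot> t) (\<lambda>p q. f (S a \<cdot> (S a' \<cdot> (p \<cdot> S q))))))"
    using antipode_r[of "\<lambda>z. f (S a \<cdot> (S a' \<cdot> z))" for a a']
    by (simp add: lin_rules)
  also have "\<dots> = sw y (\<lambda>a t. sw t (\<lambda>b c. sw x (\<lambda>a' t'. sw t' (\<lambda>b' c'. ?F a b c a' b' c'))))"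
    by (subst comult_mult, simp add: lin_rules, subst (2) tev_swap, subst (3) tev_swap) (simp add: lin_rules)
  also have "\<dots> = sw y (\<lambda>a t. sw t (\<lambda>b c. f (S a \<cdot> (b \<cdot> S (x \<cdot> c)))))"
    using antipode_cancel(1)[of "\<lambda>u c'. f (S a \<cdot> (u \<cdot> (b \<cdot> S (c' \<cdot> c))))" x for a b c]
    by (simp add: lin_rules)
  also have "\<dots> = f (S (x \<cdot> y))"
    using antipode_cancel(1)[of "\<lambda>u c. f (u \<cdot> S (x \<cdot> c))" y] by (simp add: lin_rules)
  finally show "f (S (x \<cdot> y)) = f (S y \<cdot> S x)" by simp
qed

end

section \<open>Integrals from semisimplicity and cosemisimplicity\<close>

lemma exists_projection:
  fixes U :: "('k::field ^ 'n::finite) set"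
  assumes "vec.subspace U"
  obtains p :: "'k ^ 'n \<Rightarrow> 'k ^ 'n" where "lin p" "\<And>v. p v \<in> U" "\<And>v. v \<in> U \<Longrightarrow> p v = v"
proof -
  have "\<exists>p :: 'k ^ 'n \<Rightarrow> 'k ^ 'n. p ` UNIV \<subseteq> U \<and> lin p \<and> (\<forall>v\<in>U. p (id v) = v)"
    by (rule vec.linear_exists_left_inverse_on) (use assms in \<open>simp_all add: lin_iff\<close>)
  then show ?thesis
    using that by auto
qed

text \<open>
  A coordinate of \<open>x - p x\<close> for a projection \<open>p\<close> onto \<open>U\<close>, normalised at \<open>v\<close>.
\<close>

lemma exists_separating_form:
  fixes U :: "('k::field ^ 'n::finite) set"
  assumes "vec.subspace U" "v \<notin> U"
  obtains f where "lin_form f" "f v = 1" "\<And>u. u \<in> U \<Longrightarrow> f u = 0"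
proof -
  obtain p :: "'k ^ 'n \<Rightarrow> 'k ^ 'n" where p: "lin p" "\<And>v. p v \<in> U" "\<And>v. v \<in> U \<Longrightarrow> p v = v"
    by (rule exists_projection[OF assms(1)]) blast
  have "v - p v \<noteq> 0"
    using p(2)[of v] assms(2) by auto
  then obtain i where i: "(v - p v) $ i \<noteq> 0"
    by (auto simp: vec_eq_iff)
  show ?thesis
  proof (rule that[of "\<lambda>x. (x - p x) $ i / (v - p v) $ i"])
    show "lin_form (\<lambda>x. (x - p x) $ i / (v - p v) $ i)"
      using p(1) by (simp add: lin_form_iff lin_iff field_simps add_divide_distrib diff_divide_distrib)
  qed (use i p(3) in auto)
qed

lemma subspace_tens_space: "vec.subspace (tens_space A B)"
  by (simp add: tens_space_def vec.subspace_span)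

lemma tens_in_tens_space: "a \<in> A \<Longrightarrow> b \<in> B \<Longrightarrow> a \<otimes>\<^sub>k b \<in> tens_space A B"
  unfolding tens_space_def by (rule vec.span_base) auto

lemma tens_space_mono: "A \<subseteq> A' \<Longrightarrow> B \<subseteq> B' \<Longrightarrow> tens_space A B \<subseteq> tens_space A' B'"
  unfolding tens_space_def by (rule vec.span_mono) auto

lemma tsum_in_subspace:
  fixes X :: "('k::field ^ 'c::finite) set"
  assumes "t \<in> tens_space A B" "bilin \<beta>" "vec.subspace X" "\<And>a b. a \<in> A \<Longrightarrow> b \<in> B \<Longrightarrow> \<beta> a b \<in> X"
  shows "tsum t \<beta> \<in> X"
proof -
  interpret f: Vector_Spaces.linear "(*s)" "(*s)" "\<lambda>t. tsum t \<beta>" by (rule lin_tsum)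
  have "vec.subspace {t. tsum t \<beta> \<in> X}"
    using assms(3) by (auto simp: vec.subspace_def f.add f.scale f.zero)
  then have "tens_space A B \<subseteq> {t. tsum t \<beta> \<in> X}"
    unfolding tens_space_def using tsum_tens[OF assms(2)] assms(4)
    by (intro vec.span_minimal) auto
  then show ?thesis
    using assms(1) by auto
qed

lemma tev_vanishes:
  assumes "t \<in> tens_space A B" "bform \<phi>" "\<And>a b. a \<in> A \<Longrightarrow> b \<in> B \<Longrightarrow> \<phi> a b = 0"
  shows "tev t \<phi> = 0"
proof -
  have "vec.subspace {t. tev t \<phi> = 0}"
    by (auto simp: vec.subspace_def tev_add_left tev_scale_left lin_formD[OF lin_form_tev])
  then have "tens_space A B \<subseteq> {t. tev t \<phi> = 0}"
    unfolding tens_space_def using tev_tens[OF assms(2)] assms(3)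
    by (intro vec.span_minimal) auto
  then show ?thesis
    using assms(1) by auto
qed

context hopf
begin

text \<open>
  The line spanned by \<open>\<one>\<close> is a subcoalgebra. Cosemisimplicity yields a subcoalgebra \<open>A\<close> complementary to
  it, and the projection along \<open>A\<close> is a normalised two-sided integral of the dual: on \<open>A\<close> both sides
  vanish because \<open>\<Delta> A \<subseteq> A \<otimes> A\<close>, and at \<open>\<one>\<close> both are \<open>f \<one>\<close>.
\<close>

lemma cosemisimple_imp_integral:
  assumes "cosemisimple H"
  obtains lam where "lin_form lam" "lam \<one> = 1"
    "\<And>f h. lin_form f \<Longrightarrow> sw h (\<lambda>a b. lam a * f b) = lam h * f \<one>"
    "\<And>f h. lin_form f \<Longrightarrow> sw h (\<lambda>a b. lam b * f a) = lam h * f \<one>"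
proof -
  let ?P = "\<lambda>A. subcoalgebra (comult H) A \<and> \<one> \<notin> A"
  have one_nz: "\<one> \<noteq> 0"
    using counit_unit lin_formD(3)[OF lin_form_counit] by auto
  have "comult H 0 = 0"
    using hopf_linear(6)[of 0 0] by simp
  then have "?P {0}"
    using one_nz vec.subspace_0[OF subspace_tens_space] by (auto simp: subcoalgebra_def)
  \<comment> \<open>A subcoalgebra of largest dimension among those that miss \<open>\<one>\<close> contains all of them.\<close>
  then have "\<exists>A. ?P A \<and> (\<forall>B. ?P B \<longrightarrow> vec.dim B \<le> vec.dim A)"
    by (rule ex_has_greatest_nat[where b="Suc CARD('n)"])
      (simp add: dim_subset_UNIV_cart_gen less_Suc_eq_le)
  then obtain A where A: "?P A" and max: "\<And>B. ?P B \<Longrightarrow> vec.dim B \<le> vec.dim A"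
    by blast
  have sA: "vec.subspace A"
    using A by (simp add: subcoalgebra_def)
  have sub: "C \<subseteq> A" if C: "?P C" for C
  proof -
    define E where "E = {x + y | x y. x \<in> A \<and> y \<in> C}"
    have sC: "vec.subspace C"
      using C by (simp add: subcoalgebra_def)
    have AE: "A \<subseteq> E" and CE: "C \<subseteq> E"
      using vec.subspace_0[OF sA] vec.subspace_0[OF sC] by (force simp: E_def)+
    have "comult H x \<in> tens_space E E" if "x \<in> A" for x
      using that A tens_space_mono[OF AE AE] by (auto simp: subcoalgebra_def)
    moreover have "comult H x \<in> tens_space E E" if "x \<in> C" for x
      using that C tens_space_mono[OF CE CE] by (auto simp: subcoalgebra_def)
    ultimately have "comult H (x + y) \<in> tens_space E E" if "x \<in> A" "y \<in> C" for x y
      using that by (simp add: hopf_linear vec.subspace_add[OF subspace_tens_space])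
    then have "comult H z \<in> tens_space E E" if "z \<in> E" for z
      using that unfolding E_def by blast
    then have "subcoalgebra (comult H) E"
      using vec.subspace_sums[OF sA sC] by (simp add: subcoalgebra_def E_def)
    \<comment> \<open>If \<open>\<one> = a + c\<close>, slicing \<open>\<Delta> \<one>\<close> with a form that is 1 at \<open>\<one>\<close> and 0 on \<open>A\<close> gives \<open>\<one> \<in> C\<close>.\<close>
    moreover have "\<one> \<notin> E"
    proof
      assume "\<one> \<in> E"
      then obtain a c where ac: "a \<in> A" "c \<in> C" "\<one> = a + c"
        by (auto simp: E_def)
      obtain f where f: "lin_form f" "f \<one> = 1" "\<And>u. u \<in> A \<Longrightarrow> f u = 0"
        using exists_separating_form[OF sA] A by blast
      note [simp] = lin_formD[OF f(1)]
      have bil: "bilin (\<lambda>x y. f y *s x)"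
        by (simp add: bilin_def lin_iff algebra_simps vec_eq_iff)
      have "\<one> = tsum (comult H \<one>) (\<lambda>x y. f y *s x)"
        using hopf_algebra f(2) by (simp add: hopf_algebra_def tsum_tens[OF bil])
      also have "\<dots> = tsum (comult H a) (\<lambda>x y. f y *s x) + tsum (comult H c) (\<lambda>x y. f y *s x)"
        by (simp add: ac(3) hopf_linear tsum_add_left)
      finally have eq: "\<one> = tsum (comult H a) (\<lambda>x y. f y *s x) + tsum (comult H c) (\<lambda>x y. f y *s x)" .
      have "tsum (comult H a) (\<lambda>x y. f y *s x) \<in> {0}"
        using ac A f(3) by (intro tsum_in_subspace[OF _ bil, of _ A A])
          (auto simp: subcoalgebra_def vec.subspace_def)
      moreover have "tsum (comult H c) (\<lambda>x y. f y *s x) \<in> C"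
        using ac C by (intro tsum_in_subspace[OF _ bil, of _ C C])
          (auto simp: subcoalgebra_def vec.subspace_scale)
      ultimately show False
        using C eq by simp
    qed
    ultimately have "vec.dim E \<le> vec.dim A"
      using max by blast
    then have "A = E"
      using vec.subspace_dim_equal[OF sA _ AE] vec.subspace_sums[OF sA sC] by (simp add: E_def)
    then show ?thesis
      using CE by simp
  qed
  define G where "G = {a + c *s \<one> | a c. a \<in> A}"
  have "G = {x + y | x y. x \<in> A \<and> y \<in> vec.span {\<one>}}"
    by (auto simp: G_def vec.span_singleton)
  then have sG: "vec.subspace G"
    using vec.subspace_sums[OF sA vec.subspace_span] by simp
  have "C \<subseteq> G" if C: "simple_subcoalgebra (comult H) C" for C
  proof (cases "\<one> \<in> C")
    case False
    then show ?thesis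
      using sub[of C] C by (fastforce simp: simple_subcoalgebra_def G_def intro: exI[of _ "0::'k"])
  next
    case True
    have "\<one> \<otimes>\<^sub>k \<one> \<in> tens_space (vec.span {\<one>}) (vec.span {\<one>})"
      by (intro tens_in_tens_space vec.span_base) simp_all
    then have "comult H (c *s \<one>) \<in> tens_space (vec.span {\<one>}) (vec.span {\<one>})" for c
      using hopf_algebra vec.subspace_scale[OF subspace_tens_space]
      by (simp add: hopf_linear hopf_algebra_def)
    then have "subcoalgebra (comult H) (vec.span {\<one>})"
      using vec.subspace_span[of "{\<one>}"] by (auto simp: subcoalgebra_def vec.span_singleton)
    moreover have "vec.span {\<one>} \<subseteq> C"
      using C True by (intro vec.span_minimal) (auto simp: simple_subcoalgebra_def subcoalgebra_def)
    moreover have "vec.span {\<one>} \<noteq> {0}"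
      using one_nz vec.span_base[of \<one> "{\<one>}"] by auto
    ultimately have "C = vec.span {\<one>}"
      using C by (auto simp: simple_subcoalgebra_def)
    then show ?thesis
      using vec.subspace_0[OF sA] by (force simp: G_def vec.span_singleton)
  qed
  then have "vec.span (\<Union>{C. simple_subcoalgebra (comult H) C}) \<subseteq> G"
    by (intro vec.span_minimal sG) auto
  then have G: "G = UNIV"
    using assms by (auto simp: cosemisimple_def)
  obtain lam where lam: "lin_form lam" "lam \<one> = 1" "\<And>u. u \<in> A \<Longrightarrow> lam u = 0"
    using exists_separating_form[OF sA] A by blast
  note [simp] = lin_formD[OF lam(1)]
  show ?thesis
  proof (rule that[OF lam(1,2)])
    fix f :: "'k ^ 'n \<Rightarrow> 'k" and h assume f: "lin_form f"
    note [simp] = lin_formD[OF f]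
    have "h \<in> G"
      using G by simp
    then obtain a c where h: "h = a + c *s \<one>" and a: "a \<in> A"
      by (auto simp: G_def)
    have b: "bform (\<lambda>a b. lam a * f b)" "bform (\<lambda>a b. lam b * f a)"
      by (simp_all add: lin_rules)
    have "sw a (\<lambda>a b. lam a * f b) = 0" "sw a (\<lambda>a b. lam b * f a) = 0"
      using A a b lam(3) by (auto simp: subcoalgebra_def intro!: tev_vanishes[of _ A A])
    then show "sw h (\<lambda>a b. lam a * f b) = lam h * f \<one>" "sw h (\<lambda>a b. lam b * f a) = lam h * f \<one>"
      using lam a by (simp_all add: h lin_rules comult_unit)
  qed
qed

text \<open>
  Some minimal left ideal is not killed by \<open>\<epsilon>\<close>. It meets the kernel of \<open>\<epsilon>\<close> in a smaller left ideal, that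
  is, in 0, so \<open>H\<close> acts on it through \<open>\<epsilon>\<close>.
\<close>

lemma semisimple_imp_integral:
  assumes "semisimple H"
  obtains \<Lambda> where "\<epsilon> \<Lambda> = 1" "\<And>h. h \<cdot> \<Lambda> = \<epsilon> h *s \<Lambda>"
proof -
  have sk: "vec.subspace {x. \<epsilon> x = 0}"
    by (auto simp: vec.subspace_def hopf_linear lin_formD[OF lin_form_counit])
  have "\<exists>I. minimal_left_ideal H I \<and> \<not> I \<subseteq> {x. \<epsilon> x = 0}"
  proof (rule ccontr)
    assume "\<not> ?thesis"
    then have "vec.span (\<Union>{I. minimal_left_ideal H I}) \<subseteq> {x. \<epsilon> x = 0}"
      by (intro vec.span_minimal sk) auto
    then have "\<one> \<in> {x. \<epsilon> x = 0}"
      using assms unfolding semisimple_def by blast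
    then show False
      using counit_unit by simp
  qed
  then obtain I x where I: "minimal_left_ideal H I" and x: "x \<in> I" "\<epsilon> x \<noteq> 0"
    by blast
  have sI: "vec.subspace I" and lI: "\<And>h y. y \<in> I \<Longrightarrow> h \<cdot> y \<in> I"
    using I by (auto simp: minimal_left_ideal_def left_ideal_def)
  let ?J = "I \<inter> {x. \<epsilon> x = 0}"
  have "left_ideal H ?J"
    using vec.subspace_inter[OF sI sk] lI by (auto simp: left_ideal_def counit_mult)
  moreover have "?J \<noteq> I"
    using x by auto
  ultimately have J: "?J = {0}"
    using I by (auto simp: minimal_left_ideal_def)
  define L where "L = (1 / \<epsilon> x) *s x"
  have L: "L \<in> I" "\<epsilon> L = 1"
    using x vec.subspace_scale[OF sI] by (auto simp: L_def hopf_linear)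
  have "h \<cdot> L - \<epsilon> h *s L \<in> ?J" for h
    using L lI vec.subspace_scale[OF sI L(1)] vec.subspace_diff[OF sI]
    by (simp add: lin_formD[OF lin_form_counit] counit_mult)
  then have "h \<cdot> L = \<epsilon> h *s L" for h
    using J by auto
  with L show ?thesis
    using that by blast
qed


text \<open>
  As for the product, both sides are convolution inverses of the same map, here of \<open>\<Delta>\<close>: the tensor
  \<open>(S h2 \<otimes> S h1) \<cdot> \<Delta> (h3 \<cdot> S h4)\<close> collapses to either side.
\<close>

lemma comult_antipode:
  assumes "bform \<phi>"
  shows "sw (S h) \<phi> = sw h (\<lambda>a b. \<phi> (S b) (S a))"
proof -
  note [simp] = bformD[OF assms]
  let ?X = "sw h (\<lambda>a t. sw t (\<lambda>b t. sw t (\<lambda>c d. sw (c \<cdot> S d) (\<lambda>p q. \<phi> (S b \<cdot> p) (S a \<cdot> q)))))"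
  have "?X = sw h (\<lambda>a t. sw t (\<lambda>b t. \<epsilon> t * \<phi> (S b) (S a)))"
    using antipode_r[of "\<lambda>z. sw z (\<lambda>p q. \<phi> (S b \<cdot> p) (S a \<cdot> q))" for a b]
    by (simp add: lin_rules comult_unit)
  also have "\<dots> = sw h (\<lambda>a b. \<phi> (S b) (S a))"
    using counit_r[of "\<lambda>b. \<phi> (S b) (S a)" for a] by (simp add: lin_rules)
  finally have 1: "?X = \<dots>" .
  have "?X = sw h (\<lambda>a t. sw t (\<lambda>b t. sw t (\<lambda>c d. sw c (\<lambda>c1 c2. sw (S d) (\<lambda>d1 d2. \<phi> (S b \<cdot> (c1 \<cdot> d1)) (S a \<cdot> (c2 \<cdot> d2)))))))"
    by (simp add: comult_mult lin_rules)
  also have "\<dots> = sw h (\<lambda>a t. sw t (\<lambda>b t. sw t (\<lambda>c1 t. sw t (\<lambda>c2 d. sw (S d) (\<lambda>d1 d2. \<phi> (S b \<cdot> (c1 \<cdot> d1)) (S a \<cdot> (c2 \<cdot> d2)))))))"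
    by (simp add: coassoc lin_rules)
  also have "\<dots> = sw h (\<lambda>a t. sw t (\<lambda>c2 d. sw (S d) (\<lambda>d1 d2. \<phi> d1 (S a \<cdot> (c2 \<cdot> d2)))))"
    using antipode_cancel(1)[of "\<lambda>u t. sw t (\<lambda>c2 d. sw (S d) (\<lambda>d1 d2. \<phi> (u \<cdot> d1) (S a \<cdot> (c2 \<cdot> d2))))" for a]
    by (simp add: lin_rules)
  also have "\<dots> = sw (S h) \<phi>"
    using antipode_cancel(1)[of "\<lambda>u d. sw (S d) (\<lambda>d1 d2. \<phi> d1 (u \<cdot> d2))" h]
    by (simp add: lin_rules)
  finally show ?thesis
    using 1 by simp
qed

end

section \<open>The trace property of the integral\<close>

text \<open>
  \<open>lam\<close> is a two-sided integral of the dual Hopf algebra and \<open>\<Lambda>\<close> a left integral of \<open>H\<close>, both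
  normalised. What has to be extracted from their existence is the trace rule \<open>lam_trace\<close>, from which
  \<open>lam\<close> is invariant under the adjoint action. Bijectivity of the antipode is obtained on the way.
\<close>

locale hopf_integrals = hopf H for H :: "('k::field, 'n::finite) hopf_data" +
  fixes lam :: "'k ^ 'n \<Rightarrow> 'k" and \<Lambda> :: "'k ^ 'n"
  assumes lin_lam: "lin_form lam" and lam_unit: "lam \<one> = 1"
    and lam_l: "lin_form f \<Longrightarrow> sw h (\<lambda>a b. lam a * f b) = lam h * f \<one>"
    and lam_r: "lin_form f \<Longrightarrow> sw h (\<lambda>a b. lam b * f a) = lam h * f \<one>"
    and counit_Lam: "\<epsilon> \<Lambda> = 1" and Lam_l: "h \<cdot> \<Lambda> = \<epsilon> h *s \<Lambda>"
begin

lemmas lin_lam_simps = lin_rules lin_formD(1,2)[OF lin_lam]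

text \<open>
  The elements \<open>x\<close> with \<open>lam (h \<cdot> x) = 0\<close> for all \<open>h\<close> form a left ideal and, by the integral property, a
  left coideal. On such a Hopf submodule \<open>\<epsilon> x \<cdot> lam \<one> = \<Sum> lam (S x1 \<cdot> x2) = 0\<close>, so \<open>\<epsilon>\<close> vanishes on it,
  and the counit axiom makes it zero.
\<close>

lemma lam_nondegenerate:
  assumes "\<And>h. lam (h \<cdot> x) = 0"
  shows "x = 0"
proof -
  have 1: "sw x (\<lambda>x1 x2. lam (h \<cdot> x2) * f x1) = 0" if f: "lin_form f" for h f
  proof -
    note [simp] = lin_formD(1,2)[OF f]
    \<comment> \<open>Closure under slices of the coproduct.\<close>
    have "sw x (\<lambda>x1 x2. lam (h \<cdot> x2) * f x1)
        = sw h (\<lambda>a t. sw t (\<lambda>b c. sw x (\<lambda>x1 x2. lam (c \<cdot> x2) * f (S a \<cdot> (b \<cdot> x1)))))"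
      using antipode_cancel(1)[of "\<lambda>u c. sw x (\<lambda>x1 x2. lam (c \<cdot> x2) * f (u \<cdot> x1))" h]
      by (simp add: lin_lam_simps)
    also have "\<dots> = sw h (\<lambda>a t. sw (t \<cdot> x) (\<lambda>p q. lam q * f (S a \<cdot> p)))"
      by (simp add: comult_mult lin_lam_simps)
    also have "\<dots> = 0"
      by (simp add: lam_r lin_rules assms tev_zero)
    finally show ?thesis .
  qed
  have 2: "\<epsilon> x = 0" if x: "\<And>h. lam (h \<cdot> x) = 0" 
      "\<And>h f. lin_form f \<Longrightarrow> sw x (\<lambda>x1 x2. lam (h \<cdot> x2) * f x1) = 0" for x
  proof -
    have "\<epsilon> x = sw x (\<lambda>x1 x2. lam (S x1 \<cdot> x2))"
      by (simp add: antipode_l lin_lam lam_unit)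
    also have "\<dots> = sw x (\<lambda>x1 x2. \<Sum>i\<in>UNIV. lam (S (axis i 1) \<cdot> x2) * x1 $ i)"
      by (subst lin_form_expansion[of "\<lambda>x1. lam (S x1 \<cdot> _)"]) (simp_all add: lin_lam_simps mult.commute)
    also have "\<dots> = 0"
      by (simp add: tev_sum x(2)[OF lin_form_nth])
    finally show ?thesis .
  qed
  show ?thesis
  proof (rule vec_eq_formI)
    fix f :: "'k ^ 'n \<Rightarrow> 'k" assume f: "lin_form f"
    note [simp] = lin_formD[OF f]
    let ?y = "tsum (comult H x) (\<lambda>a b. f a *s b)"
    have y: "g ?y = sw x (\<lambda>a b. g b * f a)" if "lin_form g" for g
      using that by (simp add: lin_form_tsum lin_formD mult.commute)
    have "\<epsilon> ?y = 0"
    proof (rule 2)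
      show "lam (h \<cdot> ?y) = 0" for h
        using 1[OF f] y[of "\<lambda>z. lam (h \<cdot> z)"] by (simp add: lin_lam_simps)
      fix h g assume g: "lin_form (g :: 'k ^ 'n \<Rightarrow> 'k)"
      note [simp] = lin_formD[OF g]
      have "sw ?y (\<lambda>x1 x2. lam (h \<cdot> x2) * g x1) = sw x (\<lambda>a b. sw b (\<lambda>c d. lam (h \<cdot> d) * (f a * g c)))"
        by (subst y) (simp_all add: lin_lam_simps mult.commute tev_scale2)
      also have "\<dots> = sw x (\<lambda>t d. sw t (\<lambda>a c. (f a * g c) * lam (h \<cdot> d)))"
        using coassoc[of "\<lambda>a c d. (f a * g c) * lam (h \<cdot> d)" x] by (simp add: lin_lam_simps)
      also have "\<dots> = sw x (\<lambda>t d. lam (h \<cdot> d) * sw t (\<lambda>a c. f a * g c))"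
        by (simp only: tev_scale2 mult.commute)
      also have "\<dots> = 0"
        using 1[of "\<lambda>t. sw t (\<lambda>a c. f a * g c)"] by (simp add: lin_lam_simps mult.commute)
      finally show "sw ?y (\<lambda>x1 x2. lam (h \<cdot> x2) * g x1) = 0" .
    qed
    then show "f x = f 0"
      by (simp add: y[OF lin_form_counit] counit_r[OF f])
  qed
qed

lemma lam_Lam: "lam \<Lambda> \<noteq> 0"
proof
  assume "lam \<Lambda> = 0"
  then have "\<Lambda> = 0"
    by (intro lam_nondegenerate) (simp add: Lam_l lin_lam_simps)
  then show False
    using counit_Lam lin_formD(3)[OF lin_form_counit] by simp
qed

text \<open>
  At \<open>x = \<Lambda>\<close> the left-hand side is \<open>lam \<Lambda> * f h\<close>, so this formula writes every \<open>h\<close> as a value of the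
  antipode.
\<close>

lemma lam_mult_left:
  assumes "lin_form f"
  shows "sw h (\<lambda>a b. lam (a \<cdot> x) * f b) = sw x (\<lambda>a b. lam (h \<cdot> a) * f (S b))"
proof -
  note [simp] = lin_formD(1,2)[OF assms]
  have "sw x (\<lambda>a t. lam (h \<cdot> a) * f (S t)) = sw x (\<lambda>a t. sw (h \<cdot> a) (\<lambda>p q. lam p * f (q \<cdot> S t)))"
    by (simp add: lam_l lin_rules)
  also have "\<dots> = sw h (\<lambda>a b. sw x (\<lambda>u t. sw t (\<lambda>v w. lam (a \<cdot> u) * f (b \<cdot> (v \<cdot> S w)))))"
    by (simp add: comult_mult lin_lam_simps, subst tev_swap) (simp add: coassoc lin_lam_simps)
  also have "\<dots> = sw h (\<lambda>a b. lam (a \<cdot> x) * f b)"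
    using antipode_cancel(4)[of "\<lambda>u v. lam (a \<cdot> u) * f (b \<cdot> v)" for a b] by (simp add: lin_lam_simps)
  finally show ?thesis by simp
qed

lemma Lam_antipode_l:
  assumes "bform \<phi>"
  shows "sw \<Lambda> (\<lambda>p q. \<phi> p (h \<cdot> q)) = sw \<Lambda> (\<lambda>p q. \<phi> (S h \<cdot> p) q)"
proof -
  note [simp] = bformD[OF assms] bformD_fun[OF assms]
  have "sw \<Lambda> (\<lambda>p q. \<phi> p (h \<cdot> q)) = sw h (\<lambda>a t. sw t (\<lambda>b c. sw \<Lambda> (\<lambda>p q. \<phi> (S a \<cdot> (b \<cdot> p)) (c \<cdot> q))))"
    using antipode_cancel(1)[of "\<lambda>u c. sw \<Lambda> (\<lambda>p q. \<phi> (u \<cdot> p) (c \<cdot> q))" h] by (simp add: lin_rules)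
  also have "\<dots> = sw h (\<lambda>a t. sw (t \<cdot> \<Lambda>) (\<lambda>p q. \<phi> (S a \<cdot> p) q))"
    by (simp add: comult_mult lin_rules)
  also have "\<dots> = sw h (\<lambda>a t. \<epsilon> t * sw \<Lambda> (\<lambda>p q. \<phi> (S a \<cdot> p) q))"
    by (simp add: Lam_l lin_rules)
  also have "\<dots> = sw \<Lambda> (\<lambda>p q. \<phi> (S h \<cdot> p) q)"
    by (rule counit_r) (simp add: lin_rules)
  finally show ?thesis .
qed

text \<open>
  The integral recovers \<open>h\<close> from \<open>S h\<close>: \<open>lam \<Lambda> * h = \<Sum> lam (S h \<cdot> \<Lambda>1) \<Lambda>2\<close>.
\<close>

lemma antipode_inj: "S x = S y \<Longrightarrow> x = y"
proof (rule vec_eq_formI)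
  fix f :: "'k ^ 'n \<Rightarrow> 'k" assume xy: "S x = S y" and f: "lin_form f"
  note [simp] = lin_formD[OF f]
  have "lam \<Lambda> * f h = sw \<Lambda> (\<lambda>p q. lam (S h \<cdot> p) * f q)" for h
    using Lam_antipode_l[of "\<lambda>p q. lam p * f q" h] lam_l[of "\<lambda>q. f (h \<cdot> q)" \<Lambda>]
    by (simp add: lin_lam_simps)
  then have "lam \<Lambda> * f x = lam \<Lambda> * f y"
    by (metis xy)
  then show "f x = f y"
    using lam_Lam by simp
qed

lemma antipode_surj: "\<exists>y. S y = x"
proof
  let ?y = "tsum (comult H \<Lambda>) (\<lambda>p q. (lam (x \<cdot> p) / lam \<Lambda>) *s q)"
  show "S ?y = x"
  proof (rule vec_eq_formI)
    fix f :: "'k ^ 'n \<Rightarrow> 'k" assume f: "lin_form f"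
    note [simp] = lin_formD[OF f]
    have "f (S ?y) = sw \<Lambda> (\<lambda>p q. (1 / lam \<Lambda>) * (lam (x \<cdot> p) * f (S q)))"
      by (subst lin_form_tsum[of "\<lambda>y. f (S y)"]) (simp_all add: lin_rules)
    also have "\<dots> = (1 / lam \<Lambda>) * sw x (\<lambda>a b. lam (a \<cdot> \<Lambda>) * f b)"
      by (simp only: tev_scale lam_mult_left[OF f])
    also have "\<dots> = f x"
      using counit_l[of "\<lambda>b. lam \<Lambda> * f b" x] lam_Lam by (simp add: Lam_l lin_lam_simps)
    finally show "f (S ?y) = f x" .
  qed
qed

text \<open>
  \<open>S \<Lambda>\<close> is a right integral, so \<open>\<Lambda> \<cdot> S \<Lambda>\<close> equals both \<open>S \<Lambda>\<close> and \<open>\<Lambda>\<close>. In particular \<open>\<Lambda>\<close> is two-sided.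
\<close>

lemma antipode_Lam: "S \<Lambda> = \<Lambda>"
proof -
  have "S \<Lambda> \<cdot> h = \<epsilon> h *s S \<Lambda>" for h
  proof -
    obtain k where "S k = h"
      using antipode_surj by blast
    then show ?thesis
      by (metis antipode_mult Lam_l counit_antipode hopf_linear(10))
  qed
  from this[of \<Lambda>] show ?thesis
    by (simp add: Lam_l counit_antipode counit_Lam)
qed

lemma Lam_r: "\<Lambda> \<cdot> h = \<epsilon> h *s \<Lambda>"
proof -
  obtain k where "S k = h"
    using antipode_surj by blast
  then show ?thesis
    by (metis antipode_mult Lam_l counit_antipode hopf_linear(10) antipode_Lam)
qed

lemma Lam_antipode_r:
  assumes "bform \<phi>"
  shows "sw \<Lambda> (\<lambda>p q. \<phi> (p \<cdot> h) q) = sw \<Lambda> (\<lambda>p q. \<phi> p (q \<cdot> S h))"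
proof -
  note [simp] = bformD[OF assms] bformD_fun[OF assms]
  have "sw \<Lambda> (\<lambda>p q. \<phi> (p \<cdot> h) q) = sw h (\<lambda>a t. sw t (\<lambda>b c. sw \<Lambda> (\<lambda>p q. \<phi> (p \<cdot> a) (q \<cdot> (b \<cdot> S c)))))"
    using antipode_cancel(4)[of "\<lambda>u c. sw \<Lambda> (\<lambda>p q. \<phi> (p \<cdot> u) (q \<cdot> c))" h] by (simp add: lin_rules)
  also have "\<dots> = sw h (\<lambda>t c. sw t (\<lambda>a b. sw \<Lambda> (\<lambda>p q. \<phi> (p \<cdot> a) (q \<cdot> (b \<cdot> S c)))))"
    by (simp add: coassoc lin_rules)
  also have "\<dots> = sw h (\<lambda>t c. sw (\<Lambda> \<cdot> t) (\<lambda>p q. \<phi> p (q \<cdot> S c)))"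
    by (simp add: comult_mult lin_rules, subst (2) tev_swap) (simp add: lin_rules)
  also have "\<dots> = sw h (\<lambda>t c. \<epsilon> t * sw \<Lambda> (\<lambda>p q. \<phi> p (q \<cdot> S c)))"
    by (simp add: Lam_r lin_rules)
  also have "\<dots> = sw \<Lambda> (\<lambda>p q. \<phi> p (q \<cdot> S h))"
    by (rule counit_l) (simp add: lin_rules)
  finally show ?thesis .
qed

text \<open>
  The difference \<open>g\<close> of the two sides, as a form in \<open>y\<close>, satisfies \<open>\<Sum> \<Lambda>1 \<otimes> g \<Lambda>2 = 0\<close>: moving \<open>h\<close> across
  the two legs of \<open>\<Lambda>\<close> and applying the integral property of \<open>lam\<close> turns both contributions into
  \<open>lam \<Lambda> * S h\<close>. Since \<open>\<Lambda>\<close> is a nondegenerate tensor, \<open>g = 0\<close>.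
\<close>

lemma lam_trace: "lam (h \<cdot> y) = lam (y \<cdot> S (S h))"
proof -
  define g where "g z = lam (h \<cdot> z) - lam (z \<cdot> S (S h))" for z
  have g: "lin_form g"
    by (simp add: g_def lin_lam_simps algebra_simps)
  note [simp] = lin_formD[OF g]
  have 1: "sw \<Lambda> (\<lambda>p q. f p * g q) = 0" if f: "lin_form f" for f
  proof -
    note [simp] = lin_formD[OF f]
    have "sw \<Lambda> (\<lambda>p q. lam (h \<cdot> q) * f p) = sw \<Lambda> (\<lambda>p q. lam q * f (S h \<cdot> p))"
      using Lam_antipode_l[of "\<lambda>p q. lam q * f p" h] by (simp add: lin_lam_simps)
    moreover have "sw \<Lambda> (\<lambda>p q. lam (q \<cdot> S (S h)) * f p) = sw \<Lambda> (\<lambda>p q. lam q * f (p \<cdot> S h))"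
      using Lam_antipode_r[of "\<lambda>p q. lam q * f p" "S h"] by (simp add: lin_lam_simps)
    ultimately have "sw \<Lambda> (\<lambda>p q. lam (h \<cdot> q) * f p - lam (q \<cdot> S (S h)) * f p) = 0"
      using lam_r[of "\<lambda>p. f (S h \<cdot> p)" \<Lambda>] lam_r[of "\<lambda>p. f (p \<cdot> S h)" \<Lambda>]
      by (simp add: tev_diff lin_lam_simps)
    then show ?thesis
      by (simp add: g_def algebra_simps)
  qed
  have "g z = 0" for z
  proof -
    obtain k where k: "S k = z"
      using antipode_surj by blast
    have "lam \<Lambda> * g (S k) = sw \<Lambda> (\<lambda>p q. lam p * g (q \<cdot> S k))"
      using lam_l[of "\<lambda>q. g (q \<cdot> S k)"] by (simp add: lin_rules)
    also have "\<dots> = sw \<Lambda> (\<lambda>p q. lam (p \<cdot> k) * g q)"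
      using Lam_antipode_r[of "\<lambda>p q. lam p * g q" k] by (simp add: lin_lam_simps)
    also have "\<dots> = 0"
      by (rule 1) (simp add: lin_lam_simps)
    finally show ?thesis
      using k lam_Lam by simp
  qed
  from this[of y] show ?thesis
    by (simp add: g_def)
qed

text \<open>
  By the trace rule \<open>h1\<close> moves to the right end as \<open>S (S h1)\<close>, where \<open>S h2 \<cdot> S (S h1) = S (S h1 \<cdot> h2)\<close>
  cancels.
\<close>

lemma lam_adjoint: "sw h (\<lambda>a b. lam (a \<cdot> (x \<cdot> S b))) = \<epsilon> h * lam x"
proof -
  have "lam (a \<cdot> (x \<cdot> S b)) = lam (x \<cdot> S (S a \<cdot> b))" for a b
    by (subst lam_trace) (simp add: antipode_mult mult_assoc)
  then show ?thesis
    using antipode_l[of "\<lambda>z. lam (x \<cdot> S z)" h] by (simp add: lin_lam_simps antipode_unit)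
qed

end

section \<open>The universal R-matrix\<close>

locale quasitriangular_hopf = hopf H for H :: "('k::field, 'n::finite) hopf_data" +
  fixes R :: "'k ^ ('n \<times> 'n)"
  assumes quasitriangular: "quasitriangular H R"
begin

abbreviation rr where "rr \<equiv> tev R"

lemma R_comult_left:
  assumes "tform \<phi>"
  shows "rr (\<lambda>r s. sw r (\<lambda>a b. \<phi> a b s)) = rr (\<lambda>r s. rr (\<lambda>r' s'. \<phi> r r' (s \<cdot> s')))"
proof -
  note [simp] = tformD[OF assms] tformD_fun[OF assms]
  have "tsum R (\<lambda>r s. tsum (comult H r) (\<lambda>a b. a \<otimes>\<^sub>k b \<otimes>\<^sub>k s)) =
      tensor_mult (mult H) (tensor_mult (mult H) (mult H))
        (tsum R (\<lambda>a b. a \<otimes>\<^sub>k \<one> \<otimes>\<^sub>k b)) (tsum R (\<lambda>a b. \<one> \<otimes>\<^sub>k a \<otimes>\<^sub>k b))"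
    using quasitriangular by (simp add: quasitriangular_def Let_def)
  then have "tev (tsum R (\<lambda>r s. tsum (comult H r) (\<lambda>a b. a \<otimes>\<^sub>k b \<otimes>\<^sub>k s))) (\<lambda>x t. tev t (\<phi> x)) =
      tev (tensor_mult (mult H) (tensor_mult (mult H) (mult H))
        (tsum R (\<lambda>a b. a \<otimes>\<^sub>k \<one> \<otimes>\<^sub>k b)) (tsum R (\<lambda>a b. \<one> \<otimes>\<^sub>k a \<otimes>\<^sub>k b))) (\<lambda>x t. tev t (\<phi> x))"
    by simp
  then show ?thesis
    by (simp add: tensor_mult_def tev_tsum tev_tens lin_rules)
qed

lemma R_comult_right:
  assumes "tform \<phi>"
  shows "rr (\<lambda>r s. sw s (\<lambda>a b. \<phi> r a b)) = rr (\<lambda>r s. rr (\<lambda>r' s'. \<phi> (r \<cdot> r') s' s))"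
proof -
  note [simp] = tformD[OF assms] tformD_fun[OF assms]
  have "tsum R (\<lambda>r s. r \<otimes>\<^sub>k comult H s) =
      tensor_mult (mult H) (tensor_mult (mult H) (mult H))
        (tsum R (\<lambda>a b. a \<otimes>\<^sub>k \<one> \<otimes>\<^sub>k b)) (tsum R (\<lambda>a b. a \<otimes>\<^sub>k b \<otimes>\<^sub>k \<one>))"
    using quasitriangular by (simp add: quasitriangular_def Let_def)
  then have "tev (tsum R (\<lambda>r s. r \<otimes>\<^sub>k comult H s)) (\<lambda>x t. tev t (\<phi> x)) =
      tev (tensor_mult (mult H) (tensor_mult (mult H) (mult H))
        (tsum R (\<lambda>a b. a \<otimes>\<^sub>k \<one> \<otimes>\<^sub>k b)) (tsum R (\<lambda>a b. a \<otimes>\<^sub>k b \<otimes>\<^sub>k \<one>))) (\<lambda>x t. tev t (\<phi> x))"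
    by simp
  then show ?thesis
    by (simp add: tensor_mult_def tev_tsum tev_tens lin_rules)
qed

lemma R_commute:
  assumes "bform \<phi>"
  shows "rr (\<lambda>r s. sw h (\<lambda>a b. \<phi> (r \<cdot> a) (s \<cdot> b))) = rr (\<lambda>r s. sw h (\<lambda>a b. \<phi> (b \<cdot> r) (a \<cdot> s)))"
proof -
  have "tsum R (\<lambda>r s. tsum (comult H h) (\<lambda>a b. (r \<cdot> a) \<otimes>\<^sub>k (s \<cdot> b))) =
      tsum R (\<lambda>r s. tsum (comult H h) (\<lambda>a b. (b \<cdot> r) \<otimes>\<^sub>k (a \<cdot> s)))"
    using quasitriangular by (simp add: quasitriangular_def Let_def)
  from arg_cong[OF this, of "\<lambda>t. tev t \<phi>"] show ?thesis
    by (simp add: tev_tsum tev_tens[OF assms])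
qed

text \<open>
  Applying \<open>\<epsilon>\<close> to an outer leg of \<open>(\<Delta> \<otimes> id) R = R13 R23\<close> or \<open>(id \<otimes> \<Delta>) R = R13 R12\<close> gives \<open>R = z R\<close>, and
  \<open>R\<close> is invertible.
\<close>

lemma R_counit:
  assumes "lin_form f"
  shows "rr (\<lambda>r s. \<epsilon> r * f s) = f \<one>" "rr (\<lambda>r s. \<epsilon> s * f r) = f \<one>"
proof -
  note [simp] = lin_formD(1,2)[OF assms]
  obtain Q where Q: "tensor_mult (mult H) (mult H) R Q = \<one> \<otimes>\<^sub>k \<one>"
    using quasitriangular by (auto simp: quasitriangular_def Let_def)
  have Q': "rr (\<lambda>r s. tev Q (\<lambda>p q. \<phi> (r \<cdot> p) (s \<cdot> q))) = \<phi> \<one> \<one>" if b: "bform \<phi>" for \<phi>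
    using arg_cong[OF Q, of "\<lambda>t. tev t \<phi>"] by (simp add: tensor_mult_def tev_tsum tev_tens[OF b])
  have "rr (\<lambda>r s. \<epsilon> r * f s) = rr (\<lambda>r s. rr (\<lambda>r' s'. tev Q (\<lambda>p q. \<epsilon> r * \<epsilon> (r' \<cdot> p) * f (s \<cdot> (s' \<cdot> q)))))"
    using Q'[of "\<lambda>a b. \<epsilon> a * f (s \<cdot> b)" for s] by (simp add: lin_rules)
  also have "\<dots> = rr (\<lambda>r s. sw r (\<lambda>a b. \<epsilon> a * tev Q (\<lambda>p q. \<epsilon> (b \<cdot> p) * f (s \<cdot> q))))"
    by (subst R_comult_left) (simp_all add: lin_rules)
  also have "\<dots> = rr (\<lambda>r s. tev Q (\<lambda>p q. \<epsilon> (r \<cdot> p) * f (s \<cdot> q)))"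
    by (subst counit_l) (simp_all add: lin_rules)
  also have "\<dots> = f \<one>"
    using Q'[of "\<lambda>a b. \<epsilon> a * f b"] by (simp add: lin_rules)
  finally show "rr (\<lambda>r s. \<epsilon> r * f s) = f \<one>" .
  have "rr (\<lambda>r s. \<epsilon> s * f r) = rr (\<lambda>r s. rr (\<lambda>r' s'. tev Q (\<lambda>p q. \<epsilon> s * \<epsilon> (s' \<cdot> q) * f (r \<cdot> (r' \<cdot> p)))))"
    using Q'[of "\<lambda>a b. \<epsilon> b * f (r \<cdot> a)" for r] by (simp add: lin_rules)
  also have "\<dots> = rr (\<lambda>r s. sw s (\<lambda>a b. \<epsilon> b * tev Q (\<lambda>p q. \<epsilon> (a \<cdot> q) * f (r \<cdot> p))))"
    by (subst R_comult_right) (simp_all add: lin_rules)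
  also have "\<dots> = rr (\<lambda>r s. tev Q (\<lambda>p q. \<epsilon> (s \<cdot> q) * f (r \<cdot> p)))"
    by (subst counit_r) (simp_all add: lin_rules)
  also have "\<dots> = f \<one>"
    using Q'[of "\<lambda>a b. \<epsilon> b * f a"] by (simp add: lin_rules)
  finally show "rr (\<lambda>r s. \<epsilon> s * f r) = f \<one>" .
qed

text \<open>
  \<open>(S \<otimes> id) R\<close> is inverse to \<open>R\<close>, and \<open>(id \<otimes> S) R\<close> is inverse to \<open>R\<close> in \<open>H \<otimes> H\<^sup>o\<^sup>p\<close>.
\<close>

lemma R_cancel:
  assumes "bform \<phi>"
  shows "rr (\<lambda>r s. rr (\<lambda>r' s'. \<phi> (S r \<cdot> r') (s \<cdot> s'))) = \<phi> \<one> \<one>"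
    and "rr (\<lambda>r s. rr (\<lambda>r' s'. \<phi> (r \<cdot> r') (S s' \<cdot> s))) = \<phi> \<one> \<one>"
    and "rr (\<lambda>r s. rr (\<lambda>r' s'. \<phi> (r \<cdot> r') (s' \<cdot> S s))) = \<phi> \<one> \<one>"
proof -
  note [simp] = bformD[OF assms] bformD_fun[OF assms]
  have "rr (\<lambda>r s. rr (\<lambda>r' s'. \<phi> (S r \<cdot> r') (s \<cdot> s'))) = rr (\<lambda>r s. sw r (\<lambda>a b. \<phi> (S a \<cdot> b) s))"
    by (subst R_comult_left) (simp_all add: lin_rules)
  also have "\<dots> = rr (\<lambda>r s. \<epsilon> r * \<phi> \<one> s)"
    using antipode_l[of "\<lambda>z. \<phi> z s" for s] by (simp add: lin_rules)
  finally show "rr (\<lambda>r s. rr (\<lambda>r' s'. \<phi> (S r \<cdot> r') (s \<cdot> s'))) = \<phi> \<one> \<one>"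
    by (simp add: R_counit)
  have "rr (\<lambda>r s. rr (\<lambda>r' s'. \<phi> (r \<cdot> r') (S s' \<cdot> s))) = rr (\<lambda>r s. sw s (\<lambda>a b. \<phi> r (S a \<cdot> b)))"
    by (subst R_comult_right) (simp_all add: lin_rules)
  also have "\<dots> = rr (\<lambda>r s. \<epsilon> s * \<phi> r \<one>)"
    by (simp add: antipode_l)
  finally show "rr (\<lambda>r s. rr (\<lambda>r' s'. \<phi> (r \<cdot> r') (S s' \<cdot> s))) = \<phi> \<one> \<one>"
    by (simp add: R_counit)
  have "rr (\<lambda>r s. rr (\<lambda>r' s'. \<phi> (r \<cdot> r') (s' \<cdot> S s))) = rr (\<lambda>r s. sw s (\<lambda>a b. \<phi> r (a \<cdot> S b)))"
    by (subst R_comult_right) (simp_all add: lin_rules)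
  also have "\<dots> = rr (\<lambda>r s. \<epsilon> s * \<phi> r \<one>)"
    by (simp add: antipode_r)
  finally show "rr (\<lambda>r s. rr (\<lambda>r' s'. \<phi> (r \<cdot> r') (s' \<cdot> S s))) = \<phi> \<one> \<one>"
    by (simp add: R_counit)
qed

text \<open>
  \<open>(S \<otimes> S) R\<close> and \<open>R\<close> have the same inverse \<open>(S \<otimes> id) R\<close>.
\<close>

lemma R_antipode:
  assumes "bform \<phi>"
  shows "rr (\<lambda>r s. \<phi> (S r) (S s)) = rr \<phi>"
proof -
  note [simp] = bformD[OF assms] bformD_fun[OF assms]
  have "rr (\<lambda>r s. \<phi> (S r) (S s)) =
      rr (\<lambda>r s. rr (\<lambda>r' s'. rr (\<lambda>r'' s''. \<phi> (S r \<cdot> (S r' \<cdot> r'')) (S s \<cdot> (s' \<cdot> s'')))))"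
    using R_cancel(1)[of "\<lambda>a b. \<phi> (S r \<cdot> a) (S s \<cdot> b)" for r s] by (simp add: lin_rules)
  also have "\<dots> = rr (\<lambda>r' s'. rr (\<lambda>r s. rr (\<lambda>r'' s''. \<phi> (S (r' \<cdot> r) \<cdot> r'') (S s \<cdot> (s' \<cdot> s'')))))"
    by (subst tev_swap) (simp add: antipode_mult mult_assoc)
  also have "\<dots> = rr \<phi>"
    using R_cancel(2)[of "\<lambda>a b. rr (\<lambda>r'' s''. \<phi> (S a \<cdot> r'') (b \<cdot> s''))"]
    by (simp add: lin_rules antipode_unit)
  finally show ?thesis .
qed

end

section \<open>The adjoint action and the transmuted coproduct\<close>

context hopf
begin

lemma lin_form_adj: "lin_form f \<Longrightarrow> f (adj H h x) = sw h (\<lambda>a b. f (a \<cdot> (x \<cdot> S b)))"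
  by (simp add: adj_def lin_form_tsum mult_assoc)

lemma adj_linear:
  "adj H (g + h) x = adj H g x + adj H h x" "adj H h (x + y) = adj H h x + adj H h y"
  "adj H (c *s h) x = c *s adj H h x" "adj H h (c *s x) = c *s adj H h x"
  by (simp_all add: adj_def lin_rules)

lemma adj_unit: "adj H \<one> x = x"
proof (rule vec_eq_formI)
  fix f :: "'k ^ 'n \<Rightarrow> 'k" assume f: "lin_form f"
  note [simp] = lin_formD[OF f]
  show "f (adj H \<one> x) = f x"
    by (simp add: lin_form_adj f comult_unit lin_rules antipode_unit)
qed

lemma adj_adj: "adj H g (adj H h x) = adj H (g \<cdot> h) x"
proof (rule vec_eq_formI)
  fix f :: "'k ^ 'n \<Rightarrow> 'k" assume f: "lin_form f"
  note [simp] = lin_formD[OF f]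
  show "f (adj H g (adj H h x)) = f (adj H (g \<cdot> h) x)"
    using lin_form_adj[of "\<lambda>z. f (a \<cdot> (z \<cdot> S b))" h x for a b]
    by (simp add: lin_form_adj f comult_mult lin_rules antipode_mult)
qed

lemma counit_adj: "\<epsilon> (adj H h x) = \<epsilon> h * \<epsilon> x"
  using counit_l[of "\<lambda>b. \<epsilon> b * \<epsilon> x" h]
  by (simp add: lin_form_adj lin_form_counit lin_rules counit_antipode)

lemma adj_mult:
  assumes "lin_form f"
  shows "sw h (\<lambda>a b. f (adj H a x \<cdot> b)) = f (h \<cdot> x)"
proof -
  note [simp] = lin_formD[OF assms]
  have "sw h (\<lambda>a b. f (adj H a x \<cdot> b)) = sw h (\<lambda>t c. sw t (\<lambda>a b. f (a \<cdot> (x \<cdot> (S b \<cdot> c)))))"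
    using lin_form_adj[of "\<lambda>z. f (z \<cdot> b)" _ x for b] by (simp add: lin_rules)
  also have "\<dots> = f (h \<cdot> x)"
    using antipode_cancel(3)[of "\<lambda>a c. f (a \<cdot> (x \<cdot> c))" h] by (simp add: coassoc lin_rules)
  finally show ?thesis .
qed

lemma comult_adj:
  assumes "bform \<phi>"
  shows "sw (adj H h x) \<phi> =
    sw h (\<lambda>h1 t. sw t (\<lambda>h2 h3. sw x (\<lambda>a b. \<phi> (h1 \<cdot> (a \<cdot> S h3)) (adj H h2 b))))"
proof -
  note [simp] = bformD[OF assms] bformD_fun[OF assms]
  have "sw (adj H h x) \<phi> = sw h (\<lambda>s t. sw s (\<lambda>p q. sw t (\<lambda>u v. sw x (\<lambda>a b. \<phi> (p \<cdot> (a \<cdot> S v)) (q \<cdot> (b \<cdot> S u))))))"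
    by (subst lin_form_adj[of "\<lambda>z. sw z \<phi>"])
      (simp_all add: lin_rules comult_mult comult_antipode tev_swap[of "comult H x"])
  also have "\<dots> = sw h (\<lambda>h1 t. sw t (\<lambda>h2 h3. sw h2 (\<lambda>q u. sw x (\<lambda>a b. \<phi> (h1 \<cdot> (a \<cdot> S h3)) (q \<cdot> (b \<cdot> S u))))))"
    by (simp add: coassoc lin_rules)
  also have "\<dots> = sw h (\<lambda>h1 t. sw t (\<lambda>h2 h3. sw x (\<lambda>a b. \<phi> (h1 \<cdot> (a \<cdot> S h3)) (adj H h2 b))))"
    by (subst tev_swap) (simp add: lin_form_adj lin_rules)
  finally show ?thesis .
qed

end

context quasitriangular_hopf
begin

lemmas adj_rules = lin_rules adj_linear adj_adj

abbreviation swR where "swR h \<equiv> tev (comultR H R h)"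

lemma tev_comultR:
  assumes "bform \<phi>"
  shows "swR h \<phi> = sw h (\<lambda>a b. rr (\<lambda>r s. \<phi> (a \<cdot> S s) (adj H r b)))"
  by (simp add: comultR_def tev_tsum tev_tens[OF assms])

lemma lin_comultR: "lin (comultR H R)"
  by (simp add: comultR_def lin_iff hopf_linear tsum_add_left tsum_scale_left)

text \<open>
  The ordinary coproduct is recovered from the transmuted one, because \<open>S (R\<^sup>2)\<close> in the definition of
  \<open>\<Delta>\<^sub>R\<close> is undone by a second copy of \<open>R\<close>.
\<close>

lemma comult_from_comultR:
  assumes "bform \<phi>"
  shows "swR h (\<lambda>x y. rr (\<lambda>r s. \<phi> (x \<cdot> s) (adj H r y))) = sw h \<phi>"
proof -
  note [simp] = bformD[OF assms] bformD_fun[OF assms]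
  have "swR h (\<lambda>x y. rr (\<lambda>r s. \<phi> (x \<cdot> s) (adj H r y))) =
      sw h (\<lambda>a b. rr (\<lambda>r' s'. rr (\<lambda>r s. \<phi> (a \<cdot> (S s' \<cdot> s)) (adj H (r \<cdot> r') b))))"
    by (subst tev_comultR) (simp_all add: adj_rules)
  also have "\<dots> = sw h (\<lambda>a b. rr (\<lambda>r s. rr (\<lambda>r' s'. \<phi> (a \<cdot> (S s' \<cdot> s)) (adj H (r \<cdot> r') b))))"
    by (subst (2) tev_swap) (rule refl)
  also have "\<dots> = sw h \<phi>"
    using R_cancel(2)[of "\<lambda>u v. \<phi> (a \<cdot> v) (adj H u b)" for a b] by (simp add: adj_rules adj_unit)
  finally show ?thesis .
qed

text \<open>
  \<open>\<Delta>\<^sub>R\<close> is a map of modules for the adjoint action: the coproduct of \<open>h . x\<close> has the outer factor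
  \<open>S h3\<close>, which the commutation rule of \<open>R\<close> exchanges with the \<open>h2\<close> acting on the second leg. The
  ordinary \<open>\<Delta>\<close> does not have this property in general.
\<close>

lemma comultR_adj:
  assumes "bform \<phi>"
  shows "swR (adj H h x) \<phi> = sw h (\<lambda>h1 h2. swR x (\<lambda>a b. \<phi> (adj H h1 a) (adj H h2 b)))"
proof -
  note [simp] = bformD[OF assms] bformD_fun[OF assms]
  have "swR (adj H h x) \<phi> =
      sw h (\<lambda>h1 t. sw t (\<lambda>h2 h3. sw x (\<lambda>a b. rr (\<lambda>r s. \<phi> (h1 \<cdot> (a \<cdot> S (s \<cdot> h3))) (adj H (r \<cdot> h2) b)))))"
    by (simp add: tev_comultR[OF assms], subst comult_adj) (simp_all add: adj_rules antipode_mult)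
  also have "\<dots> = sw h (\<lambda>h1 t. sw x (\<lambda>a b. rr (\<lambda>r s. sw t (\<lambda>h2 h3. \<phi> (h1 \<cdot> (a \<cdot> S (s \<cdot> h3))) (adj H (r \<cdot> h2) b)))))"
    by (subst (2) tev_swap, subst (3) tev_swap) (rule refl)
  also have "\<dots> = sw h (\<lambda>h1 t. sw x (\<lambda>a b. rr (\<lambda>r s. sw t (\<lambda>h2 h3. \<phi> (h1 \<cdot> (a \<cdot> S (h2 \<cdot> s))) (adj H (h3 \<cdot> r) b)))))"
    using R_commute[of "\<lambda>u v. \<phi> (h1 \<cdot> (a \<cdot> S v)) (adj H u b)" t for h1 a b t] by (simp add: adj_rules)
  also have "\<dots> = sw x (\<lambda>a b. rr (\<lambda>r s. sw h (\<lambda>h1 t. sw t (\<lambda>h2 h3. \<phi> (h1 \<cdot> (a \<cdot> S (h2 \<cdot> s))) (adj H (h3 \<cdot> r) b)))))"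
    by (subst tev_swap, subst (2) tev_swap) (rule refl)
  also have "\<dots> = sw x (\<lambda>a b. rr (\<lambda>r s. sw h (\<lambda>h1 h2. \<phi> (adj H h1 (a \<cdot> S s)) (adj H h2 (adj H r b)))))"
    using lin_form_adj[of "\<lambda>z. \<phi> z (adj H (k \<cdot> r) b)" for k r b] by (simp add: adj_rules coassoc antipode_mult)
  also have "\<dots> = sw h (\<lambda>h1 h2. sw x (\<lambda>a b. rr (\<lambda>r s. \<phi> (adj H h1 (a \<cdot> S s)) (adj H h2 (adj H r b)))))"
    by (subst (2) tev_swap, subst tev_swap) (rule refl)
  also have "\<dots> = sw h (\<lambda>h1 h2. swR x (\<lambda>a b. \<phi> (adj H h1 a) (adj H h2 b)))"
    by (subst tev_comultR) (simp_all add: adj_rules)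
  finally show ?thesis .
qed

lemma R_commute_antipode:
  assumes "bform \<phi>"
  shows "rr (\<lambda>r s. sw h (\<lambda>a b. \<phi> (r \<cdot> b) (S a \<cdot> s))) = rr (\<lambda>r s. sw h (\<lambda>a b. \<phi> (a \<cdot> r) (s \<cdot> S b)))"
proof -
  note [simp] = bformD[OF assms] bformD_fun[OF assms]
  have "rr (\<lambda>r s. sw h (\<lambda>a b. \<phi> (r \<cdot> b) (S a \<cdot> s))) =
      rr (\<lambda>r s. sw h (\<lambda>a t. sw t (\<lambda>b t. sw t (\<lambda>c d. \<phi> (r \<cdot> b) (S a \<cdot> (s \<cdot> (c \<cdot> S d)))))))"
    using antipode_cancel(4)[of "\<lambda>b z. \<phi> (r \<cdot> b) (S a \<cdot> (s \<cdot> z))" for r s a] by (simp add: lin_rules)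
  also have "\<dots> = rr (\<lambda>r s. sw h (\<lambda>a t. sw t (\<lambda>t d. sw t (\<lambda>b c. \<phi> (r \<cdot> b) (S a \<cdot> (s \<cdot> (c \<cdot> S d)))))))"
    by (simp add: coassoc lin_rules)
  also have "\<dots> = sw h (\<lambda>a t. sw t (\<lambda>t d. rr (\<lambda>r s. sw t (\<lambda>b c. \<phi> (r \<cdot> b) (S a \<cdot> (s \<cdot> (c \<cdot> S d)))))))"
    by (subst tev_swap, subst (2) tev_swap) (rule refl)
  also have "\<dots> = sw h (\<lambda>a t. sw t (\<lambda>t d. rr (\<lambda>r s. sw t (\<lambda>b c. \<phi> (c \<cdot> r) (S a \<cdot> (b \<cdot> (s \<cdot> S d)))))))"
    using R_commute[of "\<lambda>u v. \<phi> u (S a \<cdot> (v \<cdot> S d))" for a d] by (simp add: lin_rules)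
  also have "\<dots> = rr (\<lambda>r s. sw h (\<lambda>a t. sw t (\<lambda>t d. sw t (\<lambda>b c. \<phi> (c \<cdot> r) (S a \<cdot> (b \<cdot> (s \<cdot> S d)))))))"
    by (subst (2) tev_swap, subst tev_swap) (rule refl)
  also have "\<dots> = rr (\<lambda>r s. sw h (\<lambda>a t. sw t (\<lambda>b t. sw t (\<lambda>c d. \<phi> (c \<cdot> r) (S a \<cdot> (b \<cdot> (s \<cdot> S d)))))))"
    by (simp add: coassoc lin_rules)
  also have "\<dots> = rr (\<lambda>r s. sw h (\<lambda>a b. \<phi> (a \<cdot> r) (s \<cdot> S b)))"
    using antipode_cancel(1)[of "\<lambda>u t. sw t (\<lambda>c d. \<phi> (c \<cdot> r) (u \<cdot> (s \<cdot> S d)))" for r s] by (simp add: lin_rules)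
  finally show ?thesis .
qed

end

section \<open>Coseparability of the transmuted coalgebra\<close>

locale quasitriangular_integrals = quasitriangular_hopf H R + hopf_integrals H lam \<Lambda>
  for H :: "('k::field, 'n::finite) hopf_data" and R lam \<Lambda>
begin

text \<open>
  A coseparability form for \<open>\<Delta>\<^sub>R\<close>. For the ordinary coproduct one would take \<open>lam (x \<cdot> S y)\<close>; the copy of
  \<open>R\<close> converts between the two coproducts, as in \<open>comult_from_comultR\<close>. The form has the two
  properties that define coseparability, \<open>B_comultR\<close> (normalisation) and \<open>B_balanced\<close> (colinearity).
\<close>

definition B :: "'k ^ 'n \<Rightarrow> 'k ^ 'n \<Rightarrow> 'k"
  where "B x y = rr (\<lambda>r s. lam (x \<cdot> (s \<cdot> S (adj H r y))))"

lemmas B_rules = adj_rules lin_formD(1,2)[OF lin_lam]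

lemma bform_B: "bform B"
  by (simp add: B_def B_rules)

lemma B_comultR: "swR x B = \<epsilon> x"
proof -
  have "swR x B = sw x (\<lambda>a b. rr (\<lambda>r' s'. rr (\<lambda>r s. lam (a \<cdot> (S s' \<cdot> (s \<cdot> S (adj H (r \<cdot> r') b)))))))"
    by (simp add: tev_comultR[OF bform_B]) (simp add: B_def B_rules)
  also have "\<dots> = sw x (\<lambda>a b. rr (\<lambda>r s. rr (\<lambda>r' s'. lam (a \<cdot> (S s' \<cdot> (s \<cdot> S (adj H (r \<cdot> r') b)))))))"
    by (subst (2) tev_swap) (rule refl)
  also have "\<dots> = sw x (\<lambda>a b. lam (a \<cdot> S b))"
    using R_cancel(2)[of "\<lambda>u v. lam (a \<cdot> (v \<cdot> S (adj H u b)))" for a b] by (simp add: B_rules adj_unit)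
  also have "\<dots> = \<epsilon> x"
    by (simp add: antipode_r lin_lam lam_unit)
  finally show ?thesis .
qed

text \<open>
  The factor \<open>S h2\<close> of \<open>h1 . x\<close> is moved past \<open>R\<close>. There it meets the action on \<open>y\<close> in the form
  \<open>S ((h2 . z) h3) = S (h2 z)\<close>, and what remains is an adjoint action on the argument of \<open>lam\<close>.
\<close>

lemma B_invariant: "sw h (\<lambda>a b. B (adj H a x) (adj H b y)) = \<epsilon> h * B x y"
proof -
  have "sw h (\<lambda>a b. B (adj H a x) (adj H b y)) =
      sw h (\<lambda>a t. sw t (\<lambda>b c. rr (\<lambda>r s. lam (a \<cdot> (x \<cdot> (S b \<cdot> (s \<cdot> S (adj H (r \<cdot> c) y))))))))"
    by (simp add: lin_form_adj[of "\<lambda>z. B z (adj H b y)" for b] bformD[OF bform_B])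
      (simp add: B_def B_rules coassoc)
  also have "\<dots> = sw h (\<lambda>a t. rr (\<lambda>r s. sw t (\<lambda>b c. lam (a \<cdot> (x \<cdot> (S b \<cdot> (s \<cdot> S (adj H (r \<cdot> c) y))))))))"
    by (subst (2) tev_swap) (rule refl)
  also have "\<dots> = sw h (\<lambda>a t. rr (\<lambda>r s. sw t (\<lambda>b c. lam (a \<cdot> (x \<cdot> (s \<cdot> (S c \<cdot> S (adj H (b \<cdot> r) y))))))))"
    using R_commute_antipode[of "\<lambda>u v. lam (a \<cdot> (x \<cdot> (v \<cdot> S (adj H u y))))" for a] by (simp add: B_rules)
  also have "\<dots> = sw h (\<lambda>a t. rr (\<lambda>r s. sw t (\<lambda>b c. lam (a \<cdot> (x \<cdot> (s \<cdot> S (adj H b (adj H r y) \<cdot> c)))))))"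
    by (simp add: B_rules antipode_mult)
  also have "\<dots> = sw h (\<lambda>a t. rr (\<lambda>r s. lam (a \<cdot> (x \<cdot> (s \<cdot> S (t \<cdot> adj H r y))))))"
    using adj_mult[of "\<lambda>z. lam (a \<cdot> (x \<cdot> (s \<cdot> S z)))" t "adj H r y" for a s t r] by (simp add: B_rules)
  also have "\<dots> = rr (\<lambda>r s. sw h (\<lambda>a t. lam (a \<cdot> ((x \<cdot> (s \<cdot> S (adj H r y))) \<cdot> S t))))"
    by (subst tev_swap) (simp add: B_rules antipode_mult)
  also have "\<dots> = \<epsilon> h * B x y"
    by (simp add: lam_adjoint B_def tev_scale)
  finally show ?thesis .
qed

lemma B_adj: "B (adj H h x) y = B x (adj H (S h) y)"
proof -
  note [simp] = bformD[OF bform_B] bformD_fun[OF bform_B]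
  have "B (adj H h x) y = sw h (\<lambda>a t. sw t (\<lambda>b c. B (adj H a x) (adj H (b \<cdot> S c) y)))"
    using antipode_cancel(4)[of "\<lambda>a z. B (adj H a x) (adj H z y)" h] by (simp add: B_rules adj_unit)
  also have "\<dots> = sw h (\<lambda>t c. sw t (\<lambda>a b. B (adj H a x) (adj H b (adj H (S c) y))))"
    by (simp add: B_rules coassoc)
  also have "\<dots> = B x (adj H (S h) y)"
    unfolding B_invariant by (rule counit_l) (simp add: B_rules)
  finally show ?thesis .
qed

text \<open>
  The analogue of \<open>B_balanced\<close> for the ordinary coproduct.
\<close>

lemma lam_balanced:
  assumes "lin_form f"
  shows "sw x (\<lambda>p q. lam (q \<cdot> S y) * f p) = sw y (\<lambda>a b. lam (x \<cdot> S a) * f b)"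
proof -
  note [simp] = lin_formD(1,2)[OF assms]
  have "sw y (\<lambda>a b. lam (x \<cdot> S a) * f b) = sw y (\<lambda>a b. sw (x \<cdot> S a) (\<lambda>p q. lam q * f (p \<cdot> b)))"
    by (simp add: lam_r lin_rules)
  also have "\<dots> = sw y (\<lambda>t c. sw x (\<lambda>p q. sw t (\<lambda>a b. lam (q \<cdot> S a) * f (p \<cdot> (S b \<cdot> c)))))"
    by (simp add: B_rules comult_mult comult_antipode)
  also have "\<dots> = sw y (\<lambda>t c. sw t (\<lambda>a b. sw x (\<lambda>p q. lam (q \<cdot> S a) * f (p \<cdot> (S b \<cdot> c)))))"
    by (subst (2) tev_swap) (rule refl)
  also have "\<dots> = sw y (\<lambda>a t. sw t (\<lambda>b c. sw x (\<lambda>p q. lam (q \<cdot> S a) * f (p \<cdot> (S b \<cdot> c)))))"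
    by (rule coassoc) (simp add: B_rules)
  also have "\<dots> = sw x (\<lambda>p q. lam (q \<cdot> S y) * f p)"
    using antipode_cancel(3)[of "\<lambda>a z. sw x (\<lambda>p q. lam (q \<cdot> S a) * f (p \<cdot> z))" y] by (simp add: B_rules)
  finally show ?thesis by simp
qed

text \<open>
  Invariance and \<open>(S \<otimes> S) R = R\<close> move the copy of \<open>R\<close> inside \<open>\<Delta>\<^sub>R x\<close> over to \<open>y\<close>, where \<open>(id \<otimes> \<Delta>) R\<close>
  turns \<open>\<Delta>\<^sub>R x\<close> into the ordinary coproduct of \<open>x \<cdot> R\<^sup>2\<close>. After \<open>lam_balanced\<close> has passed to the ordinary
  coproduct of \<open>R\<^sup>1 . y\<close>, the latter is rewritten in terms of \<open>\<Delta>\<^sub>R y\<close>, and the remaining copies of \<open>R\<close>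
  cancel.
\<close>

lemma B_balanced:
  assumes "lin_form f"
  shows "swR x (\<lambda>a b. B b y * f a) = swR y (\<lambda>a b. B x a * f b)"
proof -
  note [simp] = lin_formD(1,2)[OF assms] bformD[OF bform_B] bformD_fun[OF bform_B]
  have "swR x (\<lambda>a b. B b y * f a) = sw x (\<lambda>a b. rr (\<lambda>r s. B b (adj H (S r) y) * f (a \<cdot> S s)))"
    by (subst tev_comultR) (simp_all add: B_rules B_adj)
  also have "\<dots> = sw x (\<lambda>a b. rr (\<lambda>r s. B b (adj H r y) * f (a \<cdot> s)))"
    using R_antipode[of "\<lambda>r s. B b (adj H r y) * f (a \<cdot> s)" for a b] by (simp add: B_rules)
  also have "\<dots> = sw x (\<lambda>a b. rr (\<lambda>r s. rr (\<lambda>r' s'. lam (b \<cdot> (s' \<cdot> S (adj H (r' \<cdot> r) y))) * f (a \<cdot> s))))"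
    by (simp add: B_def B_rules)
  also have "\<dots> = sw x (\<lambda>a b. rr (\<lambda>r' s'. rr (\<lambda>r s. lam (b \<cdot> (s' \<cdot> S (adj H (r' \<cdot> r) y))) * f (a \<cdot> s))))"
    by (subst (2) tev_swap) (rule refl)
  also have "\<dots> = sw x (\<lambda>a b. rr (\<lambda>r s. sw s (\<lambda>u v. lam (b \<cdot> (v \<cdot> S (adj H r y))) * f (a \<cdot> u))))"
    using R_comult_right[of "\<lambda>r u v. lam (b \<cdot> (v \<cdot> S (adj H r y))) * f (a \<cdot> u)" for a b] by (simp add: B_rules)
  also have "\<dots> = rr (\<lambda>r s. sw (x \<cdot> s) (\<lambda>p q. lam (q \<cdot> S (adj H r y)) * f p))"
    by (subst tev_swap) (simp add: B_rules comult_mult)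
  also have "\<dots> = rr (\<lambda>r s. swR (adj H r y) (\<lambda>u v. rr (\<lambda>r' s'. lam (x \<cdot> (s \<cdot> S (u \<cdot> s'))) * f (adj H r' v))))"
    by (subst lam_balanced[OF assms], subst comult_from_comultR) (simp_all add: B_rules)
  also have "\<dots> = rr (\<lambda>r s. sw r (\<lambda>p q. swR y (\<lambda>u v. rr (\<lambda>r' s'. lam (x \<cdot> (s \<cdot> S (adj H p u \<cdot> s'))) * f (adj H r' (adj H q v))))))"
    by (subst comultR_adj) (simp_all add: B_rules)
  also have "\<dots> = rr (\<lambda>r s. rr (\<lambda>p t. swR y (\<lambda>u v. rr (\<lambda>r' s'. lam (x \<cdot> (s \<cdot> (t \<cdot> S (adj H r u \<cdot> s')))) * f (adj H r' (adj H p v))))))"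
    by (subst R_comult_left) (simp_all add: B_rules)
  also have "\<dots> = rr (\<lambda>r s. swR y (\<lambda>u v. rr (\<lambda>r' s'. rr (\<lambda>p t. lam (x \<cdot> (s \<cdot> ((t \<cdot> S s') \<cdot> S (adj H r u)))) * f (adj H (r' \<cdot> p) v)))))"
    by (simp add: B_rules antipode_mult, subst (2) tev_swap, subst (3) tev_swap) (rule refl)
  also have "\<dots> = rr (\<lambda>r s. swR y (\<lambda>u v. lam (x \<cdot> (s \<cdot> S (adj H r u))) * f v))"
    using R_cancel(3)[of "\<lambda>a b. lam (x \<cdot> (s \<cdot> (b \<cdot> S (adj H r u)))) * f (adj H a v)" for r s u v]
    by (simp add: B_rules adj_unit)
  also have "\<dots> = swR y (\<lambda>a b. B x a * f b)"
    by (subst tev_swap) (simp add: B_def tev_scale2)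
  finally show ?thesis .
qed

end

section \<open>Elements of the stable algebra as linear maps\<close>

lemma pairing_linear:
  "pairing (f + g) w = pairing f w + pairing g w" "pairing f (v + w) = pairing f v + pairing f w"
  "pairing (c *s f) w = c * pairing f w" "pairing f (c *s w) = c * pairing f w"
  by (simp_all add: pairing_def distrib_left distrib_right sum.distrib sum_distrib_left mult.assoc
      mult.left_commute)

lemma pairing_axis: "pairing (axis i 1) w = w $ i"
proof -
  have "pairing (axis i 1) w = (\<Sum>j\<in>UNIV. if j = i then w $ j else 0)"
    unfolding pairing_def by (intro sum.cong) (auto simp: axis_def)
  then show ?thesis by simp
qed

text \<open>
  An element of \<open>W\<^sup>* \<otimes> V\<close> as a linear map from \<open>W\<close> to \<open>V\<close>. All reasoning about \<open>N\<^sub>W\<close> is done with these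
  maps.
\<close>

definition ap :: "'k::field ^ ('w::finite \<times> 'v::finite) \<Rightarrow> 'k ^ 'w \<Rightarrow> 'k ^ 'v"
  where "ap x u = tsum x (\<lambda>f t. pairing f u *s t)"

lemma lin_form_ap: "lin_form f \<Longrightarrow> f (ap x u) = tev x (\<lambda>g t. pairing g u * f t)"
  by (simp add: ap_def lin_form_tsum lin_formD)

lemma ap_linear:
  "ap (x + y) u = ap x u + ap y u" "ap x (u + v) = ap x u + ap x v"
  "ap (c *s x) u = c *s ap x u" "ap x (c *s u) = c *s ap x u"
  by (rule vec_eq_formI, simp add: lin_form_ap lin_formD tev_add_left tev_scale_left tev_add
      tev_scale pairing_linear distrib_right mult.assoc)+

lemma ap_eqI:
  assumes "\<And>u. ap x u = ap y u"
  shows "x = y"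
proof -
  have "x $ (i, a) = y $ (i, a)" for i a
    using assms[of "axis i 1"] tsum_pairing_component[of x i a] tsum_pairing_component[of y i a]
    by (simp add: ap_def)
  then show ?thesis
    by (simp add: vec_eq_iff)
qed

lemma ap_tens:
  fixes f u :: "'k::field ^ 'w::finite" and t :: "'k ^ 'v::finite"
  shows "ap (f \<otimes>\<^sub>k t) u = pairing f u *s t"
proof (rule vec_eq_formI)
  fix g :: "'k ^ 'v \<Rightarrow> 'k" assume g: "lin_form g"
  have "bform (\<lambda>f t. pairing f u * g t)"
    by (simp add: form_defs pairing_linear lin_formD[OF g] algebra_simps)
  then show "g (ap (f \<otimes>\<^sub>k t) u) = g (pairing f u *s t)"
    by (simp add: lin_form_ap[OF g] tev_tens lin_formD[OF g])
qed

lemma ap_sum: "ap (\<Sum>i\<in>I. x i) u = (\<Sum>i\<in>I. ap (x i) u)"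
proof -
  have "ap 0 u = 0"
    using ap_linear(3)[of 0 0 u] by simp
  then show ?thesis
    by (induction I rule: infinite_finite_induct) (simp_all add: ap_linear)
qed

lemma ap_surj:
  assumes "lin s"
  obtains x where "\<And>u. ap x u = s u"
proof (rule that)
  show "ap (\<Sum>i\<in>UNIV. axis i 1 \<otimes>\<^sub>k s (axis i 1)) u = s u" for u
    by (subst lin_basis_expansion[OF assms, of u]) (simp add: ap_sum ap_tens pairing_axis)
qed

lemma in_tens_spaceI:
  fixes t :: "'k::field ^ ('a::finite \<times> 'b::finite)"
  assumes "vec.subspace N" "\<And>i. tsum t (\<lambda>a y. a $ i *s y) \<in> N"
  shows "t \<in> tens_space UNIV N"
proof -
  have "t = (\<Sum>i\<in>UNIV. axis i 1 \<otimes>\<^sub>k tsum t (\<lambda>a y. a $ i *s y))"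
  proof (rule tens_eqI)
    fix \<phi> :: "'k ^ 'a \<Rightarrow> 'k ^ 'b \<Rightarrow> 'k" assume b: "bform \<phi>"
    have "tev (\<Sum>i\<in>UNIV. axis i 1 \<otimes>\<^sub>k tsum t (\<lambda>a y. a $ i *s y)) \<phi> =
        (\<Sum>i\<in>UNIV. tev t (\<lambda>a y. a $ i * \<phi> (axis i 1) y))"
      by (simp add: lin_form_sum[OF lin_form_tev] tev_tens[OF b] lin_form_tsum[OF bformD(5)[OF b]] bformD[OF b])
    also have "\<dots> = tev t (\<lambda>a y. \<Sum>i\<in>UNIV. a $ i * \<phi> (axis i 1) y)"
      by (simp only: tev_sum)
    also have "(\<lambda>a y. \<Sum>i\<in>UNIV. a $ i * \<phi> (axis i 1) y) = \<phi>"
      by (intro ext lin_form_expansion[OF bformD(6)[OF b], symmetric])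
    finally show "tev t \<phi> = tev (\<Sum>i\<in>UNIV. axis i 1 \<otimes>\<^sub>k tsum t (\<lambda>a y. a $ i *s y)) \<phi>"
      by simp
  qed
  moreover have "\<dots> \<in> tens_space UNIV N"
    using assms(2) by (intro vec.subspace_sum subspace_tens_space tens_in_tens_space) auto
  ultimately show ?thesis
    by simp
qed

context hopf
begin

definition left_act :: "'k ^ 'n \<Rightarrow> 'k ^ ('n \<times> 'w::finite) \<Rightarrow> 'k ^ ('n \<times> 'w)"
  where "left_act h t = tsum t (\<lambda>g v. (h \<cdot> g) \<otimes>\<^sub>k v)"

lemma left_act_linear:
  "left_act (g + h) t = left_act g t + left_act h t" "left_act h (s + t) = left_act h s + left_act h t"
  "left_act (c *s h) t = c *s left_act h t" "left_act h (c *s t) = c *s left_act h t"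
  by (simp_all add: left_act_def lin_rules)

lemma lin_form_left_act: "lin_form f \<Longrightarrow> f (left_act h t) = tev t (\<lambda>g v. f ((h \<cdot> g) \<otimes>\<^sub>k v))"
  by (simp add: left_act_def lin_form_tsum)

lemma left_act_tens: "left_act h (g \<otimes>\<^sub>k v) = (h \<cdot> g) \<otimes>\<^sub>k v"
  unfolding left_act_def by (rule tsum_tens) (simp add: bilin_def lin_iff lin_rules)

lemma left_act_left_act:
  fixes t :: "'k ^ ('n \<times> 'w::finite)"
  shows "left_act g (left_act h t) = left_act (g \<cdot> h) t"
proof (rule vec_eq_formI)
  fix f :: "'k ^ ('n \<times> 'w) \<Rightarrow> 'k" assume f: "lin_form f"
  note [simp] = lin_formD[OF f]
  show "f (left_act g (left_act h t)) = f (left_act (g \<cdot> h) t)"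
    using lin_form_left_act[of "\<lambda>z. f (left_act g z)" h t]
    by (simp add: lin_form_left_act[OF f, of "g \<cdot> h"] lin_rules left_act_linear left_act_tens)
qed

lemma left_act_unit:
  fixes t :: "'k ^ ('n \<times> 'w::finite)"
  shows "left_act \<one> t = t"
proof (rule vec_eq_formI)
  fix f :: "'k ^ ('n \<times> 'w) \<Rightarrow> 'k" assume f: "lin_form f"
  show "f (left_act \<one> t) = f t"
    by (simp add: lin_form_left_act[OF f] mult_unit flip: lin_form_tens_expansion[OF f])
qed

text \<open>
  \<open>H \<otimes> W\<close> is a right \<open>H\<close>-comodule through the coproduct of \<open>H\<close>; this is that coaction, evaluated with a
  form \<open>g\<close> on the comodule leg. It corresponds to the coaction of \<open>N\<^sub>W\<close>, see \<open>ap_NW_coaction_slice\<close>.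
\<close>

definition coact_eval :: "('k ^ 'n \<Rightarrow> 'k) \<Rightarrow> 'k ^ ('n \<times> 'w::finite) \<Rightarrow> 'k ^ ('n \<times> 'w)"
  where "coact_eval g t = tsum t (\<lambda>h w. tsum (comult H h) (\<lambda>a b. g b *s (a \<otimes>\<^sub>k w)))"

lemma lin_form_coact_eval:
  "lin_form f \<Longrightarrow> f (coact_eval g t) = tev t (\<lambda>h w. sw h (\<lambda>a b. g b * f (a \<otimes>\<^sub>k w)))"
  by (simp add: coact_eval_def lin_form_tsum lin_formD)

lemma coact_eval_linear: "coact_eval g (s + t) = coact_eval g s + coact_eval g t" "coact_eval g (c *s t) = c *s coact_eval g t"
  by (simp_all add: coact_eval_def tsum_add_left tsum_scale_left)

text \<open>
  A map \<open>W \<rightarrow> H \<otimes> W\<close> extends uniquely to an \<open>H\<close>-linear endomorphism of \<open>H \<otimes> W\<close>. Under this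
  correspondence the product of \<open>N\<^sub>W\<close> is composition, with \<open>y\<close> applied first.
\<close>

lemma lin_form_ap_mult:
  assumes "lin_form f"
  shows "f (ap (NW_mult H x y) u) = tev (ap y u) (\<lambda>h w. f (left_act h (ap x w)))"
proof -
  note [simp] = lin_formD[OF assms]
  have "f (ap (NW_mult H x y) u) = tev x (\<lambda>v' gv. tev gv (\<lambda>g v. tev y (\<lambda>w' hw. tev hw (\<lambda>h w.
      pairing w' u * (pairing v' w * f ((h \<cdot> g) \<otimes>\<^sub>k v))))))"
    using lin_form_ap[OF assms, of "NW_mult H x y" u]
    by (simp add: NW_mult_def tev_tsum tev_tens lin_rules pairing_linear)
  also have "\<dots> = tev y (\<lambda>w' hw. tev hw (\<lambda>h w. tev x (\<lambda>v' gv. tev gv (\<lambda>g v.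
      pairing w' u * (pairing v' w * f ((h \<cdot> g) \<otimes>\<^sub>k v))))))"
    by (subst (2) tev_swap, subst (3) tev_swap, subst tev_swap, subst (2) tev_swap) (rule refl)
  also have "\<dots> = tev y (\<lambda>w' hw. pairing w' u * tev hw (\<lambda>h w. tev x (\<lambda>v' gv. pairing v' w * tev gv (\<lambda>g v.
      f ((h \<cdot> g) \<otimes>\<^sub>k v)))))"
    by (simp only: tev_scale)
  also have "\<dots> = tev y (\<lambda>w' hw. pairing w' u * tev hw (\<lambda>h w. f (left_act h (ap x w))))"
    using lin_form_ap[of "\<lambda>t. f (left_act h t)" x for h]
    by (simp add: lin_rules left_act_linear lin_form_left_act[OF assms])
  also have "\<dots> = tev (ap y u) (\<lambda>h w. f (left_act h (ap x w)))"
    by (subst lin_form_ap[OF lin_form_tev]) (rule refl)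
  finally show ?thesis .
qed

lemma ap_unit: "ap (NW_unit H) u = \<one> \<otimes>\<^sub>k u"
proof -
  have "ap (NW_unit H) u = (\<Sum>i\<in>UNIV. u $ i *s (\<one> \<otimes>\<^sub>k axis i 1))"
    by (simp add: NW_unit_def ap_sum ap_tens pairing_axis)
  also have "\<dots> = \<one> \<otimes>\<^sub>k u"
    by (rule lin_basis_expansion[symmetric]) (simp add: lin_iff lin_rules)
  finally show ?thesis .
qed

lemma NW_mult_linear:
  "NW_mult H (x + x') y = NW_mult H x y + NW_mult H x' y" "NW_mult H x (y + y') = NW_mult H x y + NW_mult H x y'"
  "NW_mult H (c *s x) y = c *s NW_mult H x y" "NW_mult H x (c *s y) = c *s NW_mult H x y"
  by (simp_all add: NW_mult_def lin_rules pairing_linear)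

lemma bilin_NW_mult: "bilin (NW_mult H)"
  by (simp add: bilin_def lin_iff NW_mult_linear)

lemmas NW_rules = lin_rules left_act_linear ap_linear coact_eval_linear pairing_linear

lemma NW_mult_assoc:
  fixes x :: "'k ^ ('w::finite \<times> ('n \<times> 'w))"
  shows "NW_mult H (NW_mult H x y) z = NW_mult H x (NW_mult H y z)"
proof (rule ap_eqI, rule vec_eq_formI)
  fix u and f :: "'k ^ ('n \<times> 'w) \<Rightarrow> 'k" assume f: "lin_form f"
  note [simp] = lin_formD[OF f]
  have "f (ap (NW_mult H (NW_mult H x y) z) u) =
      tev (ap z u) (\<lambda>h w. tev (ap y w) (\<lambda>g v. f (left_act h (left_act g (ap x v)))))"
    using lin_form_ap_mult[of "\<lambda>t. f (left_act h t)" x y for h]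
    by (simp add: lin_form_ap_mult[OF f] NW_rules)
  also have "\<dots> = tev (ap z u) (\<lambda>h w. tev (left_act h (ap y w)) (\<lambda>g v. f (left_act g (ap x v))))"
    by (subst lin_form_left_act[OF lin_form_tev]) (simp add: tev_tens NW_rules left_act_left_act)
  also have "\<dots> = f (ap (NW_mult H x (NW_mult H y z)) u)"
    by (simp add: lin_form_ap_mult[OF f] lin_form_ap_mult[OF lin_form_tev])
  finally show "f (ap (NW_mult H (NW_mult H x y) z) u) = f (ap (NW_mult H x (NW_mult H y z)) u)" .
qed

lemma NW_mult_unit:
  fixes x :: "'k ^ ('w::finite \<times> ('n \<times> 'w))"
  shows "NW_mult H (NW_unit H) x = x" "NW_mult H x (NW_unit H) = x"
proof -
  show "NW_mult H (NW_unit H) x = x"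
  proof (rule ap_eqI, rule vec_eq_formI)
    fix u and f :: "'k ^ ('n \<times> 'w) \<Rightarrow> 'k" assume f: "lin_form f"
    show "f (ap (NW_mult H (NW_unit H) x) u) = f (ap x u)"
      by (simp add: lin_form_ap_mult[OF f] ap_unit left_act_tens mult_unit
          flip: lin_form_tens_expansion[OF f])
  qed
  show "NW_mult H x (NW_unit H) = x"
  proof (rule ap_eqI, rule vec_eq_formI)
    fix u and f :: "'k ^ ('n \<times> 'w) \<Rightarrow> 'k" assume f: "lin_form f"
    note [simp] = lin_formD[OF f]
    show "f (ap (NW_mult H x (NW_unit H)) u) = f (ap x u)"
      by (simp add: lin_form_ap_mult[OF f] ap_unit tev_tens NW_rules left_act_unit)
  qed
qed

lemma tev_NW_coaction:
  assumes "bform \<psi>"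
  shows "tev (NW_coaction H x) \<psi> = tev x (\<lambda>f t. tev t (\<lambda>h w. sw h (\<lambda>a b. \<psi> (S b) (f \<otimes>\<^sub>k a \<otimes>\<^sub>k w))))"
  by (simp add: NW_coaction_def tev_tsum tev_tens[OF assms])

lemma lin_NW_coaction: "lin (NW_coaction H)"
  by (simp add: lin_iff NW_coaction_def lin_rules)

lemma ap_NW_coaction_slice:
  fixes x :: "'k ^ ('w::finite \<times> ('n \<times> 'w))"
  assumes "lin_form g"
  shows "ap (tsum (NW_coaction H x) (\<lambda>a y. g a *s y)) u = coact_eval (\<lambda>b. g (S b)) (ap x u)"
proof (rule vec_eq_formI)
  fix f :: "'k ^ ('n \<times> 'w) \<Rightarrow> 'k" assume f: "lin_form f"
  note [simp] = lin_formD[OF f] lin_formD[OF assms]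
  have "f (ap (tsum (NW_coaction H x) (\<lambda>a y. g a *s y)) u) = tev (NW_coaction H x) (\<lambda>a y. g a * f (ap y u))"
    by (subst lin_form_tsum[of "\<lambda>z. f (ap z u)"]) (simp_all add: NW_rules)
  also have "\<dots> = tev x (\<lambda>v t. pairing v u * tev t (\<lambda>h w. sw h (\<lambda>a b. g (S b) * f (a \<otimes>\<^sub>k w))))"
    by (subst tev_NW_coaction) (simp_all add: NW_rules ap_tens)
  also have "\<dots> = f (coact_eval (\<lambda>b. g (S b)) (ap x u))"
    by (simp add: lin_form_coact_eval[OF f] lin_form_ap[OF lin_form_tev])
  finally show "f (ap (tsum (NW_coaction H x) (\<lambda>a y. g a *s y)) u) = f (coact_eval (\<lambda>b. g (S b)) (ap x u))" .
qed

lemma NW_coaction_counit: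
  fixes x :: "'k ^ ('w::finite \<times> ('n \<times> 'w))"
  shows "tsum (NW_coaction H x) (\<lambda>d v. \<epsilon> d *s v) = x"
proof (rule ap_eqI, rule vec_eq_formI)
  fix u and f :: "'k ^ ('n \<times> 'w) \<Rightarrow> 'k" assume f: "lin_form f"
  note [simp] = lin_formD[OF f]
  have "f (coact_eval (\<lambda>b. \<epsilon> (S b)) (ap x u)) = f (ap x u)"
    using counit_r[of "\<lambda>a. f (a \<otimes>\<^sub>k w)" for w]
    by (simp add: lin_form_coact_eval[OF f] counit_antipode lin_rules flip: lin_form_tens_expansion[OF f])
  then show "f (ap (tsum (NW_coaction H x) (\<lambda>d v. \<epsilon> d *s v)) u) = f (ap x u)"
    by (simp add: ap_NW_coaction_slice lin_form_counit)
qed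

lemma NW_coaction_coassoc:
  fixes x :: "'k ^ ('w::finite \<times> ('n \<times> 'w))"
  shows "tsum (NW_coaction H x) (\<lambda>d v. tsum (comult H d) (\<lambda>a b. a \<otimes>\<^sub>k b \<otimes>\<^sub>k v)) =
    tsum (NW_coaction H x) (\<lambda>d v. d \<otimes>\<^sub>k NW_coaction H v)"
proof (rule tens_eqI)
  fix \<phi> :: "'k ^ 'n \<Rightarrow> 'k ^ ('n \<times> ('w \<times> ('n \<times> 'w))) \<Rightarrow> 'k" assume b: "bform \<phi>"
  note [simp] = bformD[OF b] bformD_fun[OF b]
  have 1: "\<phi> d (NW_coaction H v) = tev v (\<lambda>f t. tev t (\<lambda>h w. sw h (\<lambda>a b. \<phi> d (S b \<otimes>\<^sub>k f \<otimes>\<^sub>k a \<otimes>\<^sub>k w))))" for d v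
    by (subst lin_form_tens_expansion[OF bformD(5)[OF b]], subst tev_NW_coaction) (simp_all add: NW_rules)
  have "tev (tsum (NW_coaction H x) (\<lambda>d v. d \<otimes>\<^sub>k NW_coaction H v)) \<phi> =
      tev x (\<lambda>f t. tev t (\<lambda>h w. sw h (\<lambda>a b. sw a (\<lambda>c d. \<phi> (S b) (S d \<otimes>\<^sub>k f \<otimes>\<^sub>k c \<otimes>\<^sub>k w)))))"
    by (simp add: tev_tsum tev_tens[OF b] 1, subst tev_NW_coaction) (simp_all add: NW_rules tev_tens)
  moreover have "tev (tsum (NW_coaction H x) (\<lambda>d v. tsum (comult H d) (\<lambda>a b. a \<otimes>\<^sub>k b \<otimes>\<^sub>k v))) \<phi> =
      tev x (\<lambda>f t. tev t (\<lambda>h w. sw h (\<lambda>a b. sw b (\<lambda>c d. \<phi> (S d) (S c \<otimes>\<^sub>k f \<otimes>\<^sub>k a \<otimes>\<^sub>k w)))))"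
    by (simp add: tev_tsum tev_tens[OF b], subst tev_NW_coaction) (simp_all add: NW_rules comult_antipode)
  ultimately show "tev (tsum (NW_coaction H x) (\<lambda>d v. tsum (comult H d) (\<lambda>a b. a \<otimes>\<^sub>k b \<otimes>\<^sub>k v))) \<phi> =
      tev (tsum (NW_coaction H x) (\<lambda>d v. d \<otimes>\<^sub>k NW_coaction H v)) \<phi>"
    by (simp add: coassoc NW_rules)
qed

lemma tev_NW_mult:
  assumes "bform \<psi>"
  shows "tev (NW_mult H x y) \<psi> = tev x (\<lambda>v' gv. tev gv (\<lambda>g v. tev y (\<lambda>w' hw. tev hw (\<lambda>h w.
      pairing v' w * \<psi> w' ((h \<cdot> g) \<otimes>\<^sub>k v)))))"
  by (simp add: NW_mult_def tev_tsum tev_tens[OF assms] lin_rules bformD[OF assms])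

lemma NW_mult_tens:
  fixes v v' w w' :: "'k ^ 'w::finite"
  shows "NW_mult H (v' \<otimes>\<^sub>k g \<otimes>\<^sub>k v) (w' \<otimes>\<^sub>k h \<otimes>\<^sub>k w) = pairing v' w *s (w' \<otimes>\<^sub>k (h \<cdot> g) \<otimes>\<^sub>k v)"
proof (rule tens_eqI)
  fix \<phi> :: "'k ^ 'w \<Rightarrow> 'k ^ ('n \<times> 'w) \<Rightarrow> 'k" assume b: "bform \<phi>"
  note [simp] = bformD[OF b] bformD_fun[OF b]
  show "tev (NW_mult H (v' \<otimes>\<^sub>k g \<otimes>\<^sub>k v) (w' \<otimes>\<^sub>k h \<otimes>\<^sub>k w)) \<phi> = tev (pairing v' w *s (w' \<otimes>\<^sub>k (h \<cdot> g) \<otimes>\<^sub>k v)) \<phi>"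
    by (simp add: tev_NW_mult[OF b] tev_tens NW_rules)
qed

lemma NW_coaction_mult:
  fixes x y :: "'k ^ ('w::finite \<times> ('n \<times> 'w))"
  shows "NW_coaction H (NW_mult H x y) = tensor_mult (mult H) (NW_mult H) (NW_coaction H x) (NW_coaction H y)"
proof (rule tens_eqI)
  fix \<phi> :: "'k ^ 'n \<Rightarrow> 'k ^ ('w \<times> ('n \<times> 'w)) \<Rightarrow> 'k" assume b: "bform \<phi>"
  note [simp] = bformD[OF b] bformD_fun[OF b]
  have "tev (tensor_mult (mult H) (NW_mult H) (NW_coaction H x) (NW_coaction H y)) \<phi> =
      tev (NW_coaction H x) (\<lambda>a b. tev (NW_coaction H y) (\<lambda>c d. \<phi> (a \<cdot> c) (NW_mult H b d)))"
    by (simp add: tensor_mult_def tev_tsum tev_tens[OF b])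
  also have "\<dots> = tev x (\<lambda>v' gv. tev gv (\<lambda>g v. sw g (\<lambda>c d. tev y (\<lambda>w' hw. tev hw (\<lambda>h w. sw h (\<lambda>a b.
      pairing v' w * \<phi> (S d \<cdot> S b) (w' \<otimes>\<^sub>k (a \<cdot> c) \<otimes>\<^sub>k v)))))))"
    by (subst tev_NW_coaction, simp add: NW_rules NW_mult_linear, subst tev_NW_coaction)
      (simp_all add: NW_rules NW_mult_linear NW_mult_tens)
  also have "\<dots> = tev x (\<lambda>v' gv. tev gv (\<lambda>g v. tev y (\<lambda>w' hw. tev hw (\<lambda>h w. sw h (\<lambda>a b. sw g (\<lambda>c d.
      pairing v' w * \<phi> (S d \<cdot> S b) (w' \<otimes>\<^sub>k (a \<cdot> c) \<otimes>\<^sub>k v)))))))"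
    by (subst tev_swap, subst (3) tev_swap, subst (3) tev_swap) (rule refl)
  also have "\<dots> = tev (NW_coaction H (NW_mult H x y)) \<phi>"
    by (subst tev_NW_coaction[OF b], subst tev_NW_mult)
      (simp_all add: NW_rules tev_tens comult_mult antipode_mult)
  finally show "tev (NW_coaction H (NW_mult H x y)) \<phi> =
      tev (tensor_mult (mult H) (NW_mult H) (NW_coaction H x) (NW_coaction H y)) \<phi>" by simp
qed

lemma NW_coaction_unit: "NW_coaction H (NW_unit H :: 'k ^ ('w::finite \<times> ('n \<times> 'w))) = \<one> \<otimes>\<^sub>k NW_unit H"
proof (rule tens_eqI)
  fix \<phi> :: "'k ^ 'n \<Rightarrow> 'k ^ ('w \<times> ('n \<times> 'w)) \<Rightarrow> 'k" assume b: "bform \<phi>"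
  note [simp] = bformD[OF b] bformD_fun[OF b]
  show "tev (NW_coaction H (NW_unit H)) \<phi> = tev (\<one> \<otimes>\<^sub>k NW_unit H) \<phi>"
    by (simp add: tev_NW_coaction[OF b] tev_tens[OF b], simp add: NW_unit_def lin_form_sum[OF lin_form_tev]
        tev_tens NW_rules comult_unit antipode_unit lin_form_sum[OF bformD(5)[OF b]])
qed

end

section \<open>The stable algebra is a comodule algebra\<close>

context quasitriangular_hopf
begin

definition Rcomodule :: "('k ^ 'v::finite \<Rightarrow> 'k ^ ('n \<times> 'v)) \<Rightarrow> bool"
  where "Rcomodule \<rho> \<longleftrightarrow> lin \<rho> \<and>
    (\<forall>x \<phi>. tform \<phi> \<longrightarrow> tev (\<rho> x) (\<lambda>d v. swR d (\<lambda>a b. \<phi> a b v)) = tev (\<rho> x) (\<lambda>d v. tev (\<rho> v) (\<lambda>b u. \<phi> d b u))) \<and>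
    (\<forall>x f. lin_form f \<longrightarrow> tev (\<rho> x) (\<lambda>d v. \<epsilon> d * f v) = f x)"

definition colinear ::
  "('k ^ 'u::finite \<Rightarrow> 'k ^ ('n \<times> 'u)) \<Rightarrow> ('k ^ 'v::finite \<Rightarrow> 'k ^ ('n \<times> 'v)) \<Rightarrow> ('k ^ 'u \<Rightarrow> 'k ^ 'v) \<Rightarrow> bool"
  where "colinear \<rho> \<sigma> f \<longleftrightarrow> (\<forall>u \<psi>. bform \<psi> \<longrightarrow> tev (\<rho> u) (\<lambda>d v. \<psi> d (f v)) = tev (\<sigma> (f u)) \<psi>)"

lemma left_comodule_imp_Rcomodule:
  fixes \<delta> :: "'k ^ 'w::finite \<Rightarrow> 'k ^ ('n \<times> 'w)"
  assumes "left_comodule (comultR H R) \<epsilon> D UNIV \<delta>"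
  shows "Rcomodule \<delta>"
  unfolding Rcomodule_def
proof (intro conjI allI impI)
  show "lin \<delta>"
    using assms by (simp add: left_comodule_def)
next
  fix x and \<phi> :: "'k ^ 'n \<Rightarrow> 'k ^ 'n \<Rightarrow> 'k ^ 'w \<Rightarrow> 'k" assume t: "tform \<phi>"
  note [simp] = tformD[OF t] tformD_fun[OF t]
  have "tsum (\<delta> x) (\<lambda>d v. tsum (comultR H R d) (\<lambda>a b. a \<otimes>\<^sub>k b \<otimes>\<^sub>k v)) = tsum (\<delta> x) (\<lambda>d v. d \<otimes>\<^sub>k \<delta> v)"
    using assms by (simp add: left_comodule_def)
  then have "tev (tsum (\<delta> x) (\<lambda>d v. tsum (comultR H R d) (\<lambda>a b. a \<otimes>\<^sub>k b \<otimes>\<^sub>k v))) (\<lambda>a t. tev t (\<phi> a)) =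
      tev (tsum (\<delta> x) (\<lambda>d v. d \<otimes>\<^sub>k \<delta> v)) (\<lambda>a t. tev t (\<phi> a))"
    by simp
  then show "tev (\<delta> x) (\<lambda>d v. swR d (\<lambda>a b. \<phi> a b v)) = tev (\<delta> x) (\<lambda>d v. tev (\<delta> v) (\<lambda>b u. \<phi> d b u))"
    by (simp add: tev_tsum tev_tens lin_rules)
next
  fix x and f :: "'k ^ 'w \<Rightarrow> 'k" assume f: "lin_form f"
  have "tsum (\<delta> x) (\<lambda>d v. \<epsilon> d *s v) = x"
    using assms by (simp add: left_comodule_def)
  then show "tev (\<delta> x) (\<lambda>d v. \<epsilon> d * f v) = f x"
    using lin_form_tsum[OF f, of "\<delta> x" "\<lambda>d v. \<epsilon> d *s v"] by (simp add: lin_formD[OF f])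
qed

lemma comultR_linear:
  "comultR H R (x + y) = comultR H R x + comultR H R y" "comultR H R (c *s x) = c *s comultR H R x"
  using lin_comultR by (simp_all add: lin_iff)

end

locale R_comodule = quasitriangular_hopf H R for H :: "('k::field, 'n::finite) hopf_data" and R +
  fixes \<delta> :: "'k ^ 'w::finite \<Rightarrow> 'k ^ ('n \<times> 'w)"
  assumes Rcomodule_delta: "Rcomodule \<delta>"
begin

lemma delta_linear: "\<delta> (x + y) = \<delta> x + \<delta> y" "\<delta> (c *s x) = c *s \<delta> x"
  using Rcomodule_delta by (simp_all add: Rcomodule_def lin_iff)

lemma delta_coassoc:
  "tform \<phi> \<Longrightarrow> tev (\<delta> x) (\<lambda>d v. swR d (\<lambda>a b. \<phi> a b v)) = tev (\<delta> x) (\<lambda>d v. tev (\<delta> v) (\<lambda>b u. \<phi> d b u))"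
  using Rcomodule_delta by (simp add: Rcomodule_def)

lemma delta_counit: "lin_form f \<Longrightarrow> tev (\<delta> x) (\<lambda>d v. \<epsilon> d * f v) = f x"
  using Rcomodule_delta by (simp add: Rcomodule_def)

lemma rhoR_linear:
  "rhoR H \<delta> (s + t) = rhoR H \<delta> s + rhoR H \<delta> t" "rhoR H \<delta> (c *s t) = c *s rhoR H \<delta> t"
  by (simp_all add: rhoR_def tsum_add_left tsum_scale_left)

lemmas coaction_rules = NW_rules adj_linear adj_adj delta_linear rhoR_linear comultR_linear

lemma tev_rhoR:
  assumes "bform \<psi>"
  shows "tev (rhoR H \<delta> t) \<psi> =
    tev t (\<lambda>h w. sw h (\<lambda>h1 h2. tev (\<delta> w) (\<lambda>d v. \<psi> (adj H h1 d) (h2 \<otimes>\<^sub>k v))))"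
  by (simp add: rhoR_def tev_tsum tev_tens[OF assms])

lemma tev_rhoR_tens:
  assumes "bform \<psi>"
  shows "tev (rhoR H \<delta> (h \<otimes>\<^sub>k w)) \<psi> = sw h (\<lambda>h1 h2. tev (\<delta> w) (\<lambda>d v. \<psi> (adj H h1 d) (h2 \<otimes>\<^sub>k v)))"
proof -
  note [simp] = bformD[OF assms] bformD_fun[OF assms]
  show ?thesis
    by (simp add: tev_rhoR[OF assms] tev_tens coaction_rules)
qed

text \<open>
  \<open>\<rho>\<^sub>R\<close> is compatible with left multiplication as for Yetter-Drinfeld modules,
  \<open>\<rho>\<^sub>R (h t) = \<Sum> h1 . t\<^sub>-\<^sub>1 \<otimes> h2 t\<^sub>0\<close>. This makes the linear extension of a colinear map colinear.
\<close>

lemma tev_rhoR_left_act: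
  assumes "bform \<psi>"
  shows "tev (rhoR H \<delta> (left_act h t)) \<psi> =
    sw h (\<lambda>a b. tev (rhoR H \<delta> t) (\<lambda>d v. \<psi> (adj H a d) (left_act b v)))"
proof -
  note [simp] = bformD[OF assms] bformD_fun[OF assms]
  have "tev (rhoR H \<delta> (left_act h t)) \<psi> = tev t (\<lambda>g w. tev (rhoR H \<delta> ((h \<cdot> g) \<otimes>\<^sub>k w)) \<psi>)"
    by (rule lin_form_left_act) (simp add: coaction_rules)
  also have "\<dots> = tev t (\<lambda>g w. sw h (\<lambda>a b. sw g (\<lambda>c e. tev (\<delta> w) (\<lambda>d v. \<psi> (adj H (a \<cdot> c) d) ((b \<cdot> e) \<otimes>\<^sub>k v)))))"
    by (simp add: tev_rhoR_tens[OF assms] comult_mult coaction_rules)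
  also have "\<dots> = sw h (\<lambda>a b. tev t (\<lambda>g w. sw g (\<lambda>c e. tev (\<delta> w) (\<lambda>d v. \<psi> (adj H (a \<cdot> c) d) ((b \<cdot> e) \<otimes>\<^sub>k v)))))"
    by (subst tev_swap) (rule refl)
  also have "\<dots> = sw h (\<lambda>a b. tev (rhoR H \<delta> t) (\<lambda>d v. \<psi> (adj H a d) (left_act b v)))"
    by (subst tev_rhoR) (simp_all add: coaction_rules left_act_tens)
  finally show ?thesis .
qed

lemma lin_form_coact_eval_tens:
  assumes "lin_form f" "lin_form g"
  shows "f (coact_eval g (h \<otimes>\<^sub>k w)) = sw h (\<lambda>a b. g b * f (a \<otimes>\<^sub>k w))"
  by (simp add: lin_form_coact_eval[OF assms(1)] tev_tens coaction_rules lin_formD[OF assms(1)] lin_formD[OF assms(2)])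

text \<open>
  The left coaction \<open>\<rho>\<^sub>R\<close> commutes with the right coaction given by the coproduct of \<open>H\<close>.
\<close>

lemma tev_rhoR_coact_eval:
  assumes "bform \<psi>" "lin_form g"
  shows "tev (rhoR H \<delta> (coact_eval g t)) \<psi> = tev (rhoR H \<delta> t) (\<lambda>d v. \<psi> d (coact_eval g v))"
proof -
  note [simp] = bformD[OF assms(1)] bformD_fun[OF assms(1)] lin_formD[OF assms(2)]
  have "tev (rhoR H \<delta> (coact_eval g t)) \<psi> =
      tev t (\<lambda>h w. sw h (\<lambda>a b. g b * sw a (\<lambda>h1 h2. tev (\<delta> w) (\<lambda>d v. \<psi> (adj H h1 d) (h2 \<otimes>\<^sub>k v)))))"
    using lin_form_coact_eval[of "\<lambda>t. tev (rhoR H \<delta> t) \<psi>" g t]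
    by (simp add: coaction_rules tev_rhoR_tens[OF assms(1)])
  also have "\<dots> = tev t (\<lambda>h w. sw h (\<lambda>a t. sw t (\<lambda>b c. tev (\<delta> w) (\<lambda>d v. g c * \<psi> (adj H a d) (b \<otimes>\<^sub>k v)))))"
    using coassoc[of "\<lambda>a b c. g c * tev (\<delta> w) (\<lambda>d v. \<psi> (adj H a d) (b \<otimes>\<^sub>k v))" for w]
    by (simp add: coaction_rules)
  also have "\<dots> = tev t (\<lambda>h w. sw h (\<lambda>a t. tev (\<delta> w) (\<lambda>d v. sw t (\<lambda>b c. g c * \<psi> (adj H a d) (b \<otimes>\<^sub>k v)))))"
    by (subst (2) tev_swap) (rule refl)
  also have "\<dots> = tev (rhoR H \<delta> t) (\<lambda>d v. \<psi> d (coact_eval g v))"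
    by (subst tev_rhoR) (simp_all add: coaction_rules lin_form_coact_eval_tens[OF _ assms(2)])
  finally show ?thesis .
qed

text \<open>
  Coassociativity of \<open>\<rho>\<^sub>R\<close> uses that \<open>\<Delta>\<^sub>R\<close> is a map of modules for the adjoint action.
\<close>

lemma Rcomodule_rhoR: "Rcomodule (rhoR H \<delta>)"
  unfolding Rcomodule_def
proof (intro conjI allI impI)
  show "lin (rhoR H \<delta>)"
    by (simp add: lin_iff rhoR_linear)
next
  fix t and \<phi> :: "'k ^ 'n \<Rightarrow> 'k ^ 'n \<Rightarrow> 'k ^ ('n \<times> 'w) \<Rightarrow> 'k" assume t: "tform \<phi>"
  note [simp] = tformD[OF t] tformD_fun[OF t]
  have "tev (rhoR H \<delta> t) (\<lambda>d v. swR d (\<lambda>a b. \<phi> a b v)) =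
      tev t (\<lambda>h w. sw h (\<lambda>h1 h2. tev (\<delta> w) (\<lambda>d v. sw h1 (\<lambda>p q. swR d (\<lambda>a b. \<phi> (adj H p a) (adj H q b) (h2 \<otimes>\<^sub>k v))))))"
    by (subst tev_rhoR) (simp_all add: coaction_rules comultR_adj)
  also have "\<dots> = tev t (\<lambda>h w. sw h (\<lambda>h1 h2. sw h1 (\<lambda>p q. tev (\<delta> w) (\<lambda>d v. swR d (\<lambda>a b. \<phi> (adj H p a) (adj H q b) (h2 \<otimes>\<^sub>k v))))))"
    by (subst (2) tev_swap) (rule refl)
  also have "\<dots> = tev t (\<lambda>h w. sw h (\<lambda>h1 h2. sw h1 (\<lambda>p q. tev (\<delta> w) (\<lambda>d v. tev (\<delta> v) (\<lambda>b u. \<phi> (adj H p d) (adj H q b) (h2 \<otimes>\<^sub>k u))))))"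
    using delta_coassoc[of "\<lambda>a b v. \<phi> (adj H p a) (adj H q b) (h2 \<otimes>\<^sub>k v)" for p q h2] by (simp add: coaction_rules)
  also have "\<dots> = tev t (\<lambda>h w. sw h (\<lambda>p t. sw t (\<lambda>q h2. tev (\<delta> w) (\<lambda>d v. tev (\<delta> v) (\<lambda>b u. \<phi> (adj H p d) (adj H q b) (h2 \<otimes>\<^sub>k u))))))"
    by (simp add: coassoc coaction_rules)
  also have "\<dots> = tev t (\<lambda>h w. sw h (\<lambda>p t. tev (\<delta> w) (\<lambda>d v. sw t (\<lambda>q h2. tev (\<delta> v) (\<lambda>b u. \<phi> (adj H p d) (adj H q b) (h2 \<otimes>\<^sub>k u))))))"
    by (subst (2) tev_swap) (rule refl)
  also have "\<dots> = tev (rhoR H \<delta> t) (\<lambda>d v. tev (rhoR H \<delta> v) (\<lambda>b u. \<phi> d b u))"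
    by (subst tev_rhoR) (simp_all add: coaction_rules tev_rhoR_tens)
  finally show "tev (rhoR H \<delta> t) (\<lambda>d v. swR d (\<lambda>a b. \<phi> a b v)) =
      tev (rhoR H \<delta> t) (\<lambda>d v. tev (rhoR H \<delta> v) (\<lambda>b u. \<phi> d b u))" .
next
  fix t and f :: "'k ^ ('n \<times> 'w) \<Rightarrow> 'k" assume f: "lin_form f"
  note [simp] = lin_formD[OF f]
  have "tev (rhoR H \<delta> t) (\<lambda>d v. \<epsilon> d * f v) =
      tev t (\<lambda>h w. sw h (\<lambda>h1 h2. \<epsilon> h1 * tev (\<delta> w) (\<lambda>d v. \<epsilon> d * f (h2 \<otimes>\<^sub>k v))))"
    by (subst tev_rhoR) (simp_all add: coaction_rules counit_adj)
  also have "\<dots> = tev t (\<lambda>h w. f (h \<otimes>\<^sub>k w))"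
    by (simp add: delta_counit coaction_rules counit_l[of "\<lambda>h. f (h \<otimes>\<^sub>k w)" for w] del: mult.commute)
  also have "\<dots> = f t"
    by (rule lin_form_tens_expansion[OF f, symmetric])
  finally show "tev (rhoR H \<delta> t) (\<lambda>d v. \<epsilon> d * f v) = f t" .
qed

text \<open>
  The two maps whose equaliser is the cotensor product express the two sides of colinearity, once the
  right coaction on the dual is unfolded by its defining property.
\<close>

lemma NW_iff_colinear: "x \<in> NW H \<delta> \<longleftrightarrow> colinear \<delta> (rhoR H \<delta>) (ap x)"
proof -
  let ?L = "tsum x (\<lambda>f t. tsum (dual_coaction \<delta> f) (\<lambda>g d. g \<otimes>\<^sub>k d \<otimes>\<^sub>k t))"
  let ?M = "tsum x (\<lambda>f t. f \<otimes>\<^sub>k rhoR H \<delta> t)"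
  have L: "tev (ap ?L u) \<psi> = tev (\<delta> u) (\<lambda>d v. \<psi> d (ap x v))" if b: "bform \<psi>" for u \<psi>
  proof -
    note [simp] = bformD[OF b] bformD_fun[OF b]
    have dual: "tev (dual_coaction \<delta> f) (\<lambda>g d. pairing g u * \<psi> d t) = tev (\<delta> u) (\<lambda>d v. pairing f v * \<psi> d t)" for f t
    proof -
      have "lin \<delta>"
        using Rcomodule_delta by (simp add: Rcomodule_def)
      then have "tsum (dual_coaction \<delta> f) (\<lambda>g d. pairing g u *s d) = tsum (\<delta> u) (\<lambda>d v. pairing f v *s d)"
        using dual_coaction_unique[of \<delta> "dual_coaction \<delta> f" f] by simp
      from arg_cong[OF this, of "\<lambda>z. \<psi> z t"] show ?thesis
        by (simp add: lin_form_tsum[of "\<lambda>z. \<psi> z t"])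
    qed
    have "tev (ap ?L u) \<psi> = tev x (\<lambda>f t. tev (dual_coaction \<delta> f) (\<lambda>g d. pairing g u * \<psi> d t))"
      by (simp add: lin_form_ap[OF lin_form_tev] tev_tsum, subst tev_tens) (simp_all add: coaction_rules tev_tens)
    also have "\<dots> = tev (\<delta> u) (\<lambda>d v. tev x (\<lambda>f t. pairing f v * \<psi> d t))"
      unfolding dual by (rule tev_swap)
    finally show ?thesis
      by (simp add: lin_form_ap[OF bformD(5)[OF b]])
  qed
  have M: "tev (ap ?M u) \<psi> = tev (rhoR H \<delta> (ap x u)) \<psi>" for u \<psi>
    using lin_form_ap[of "\<lambda>t. tev (rhoR H \<delta> t) \<psi>" x u]
    by (simp add: lin_form_ap[OF lin_form_tev] tev_tsum tev_tens coaction_rules)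
  have "x \<in> NW H \<delta> \<longleftrightarrow> (\<forall>u. ap ?L u = ap ?M u)"
    using ap_eqI[of ?L ?M] by (auto simp: NW_def cotensor_def)
  also have "\<dots> \<longleftrightarrow> (\<forall>u \<psi>. bform \<psi> \<longrightarrow> tev (ap ?L u) \<psi> = tev (ap ?M u) \<psi>)"
    using tens_eqI by (metis (no_types))
  also have "\<dots> \<longleftrightarrow> colinear \<delta> (rhoR H \<delta>) (ap x)"
    by (simp add: colinear_def L M)
  finally show ?thesis .
qed

lemma NW_colinear:
  "x \<in> NW H \<delta> \<Longrightarrow> bform \<psi> \<Longrightarrow> tev (\<delta> u) (\<lambda>d v. \<psi> d (ap x v)) = tev (rhoR H \<delta> (ap x u)) \<psi>"
  by (simp add: NW_iff_colinear colinear_def)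

lemma NW_subspace: "vec.subspace (NW H \<delta>)"
proof -
  have z: "ap 0 u = 0" "rhoR H \<delta> 0 = 0" for u :: "'k ^ 'w"
    using ap_linear(3)[of 0 0 u] rhoR_linear(2)[of 0 0] by simp_all
  have "colinear \<delta> (rhoR H \<delta>) (ap 0)"
    by (auto simp: colinear_def z lin_formD bformD lin_formD(3)[OF lin_form_tev] tev_zero)
  moreover have "colinear \<delta> (rhoR H \<delta>) (ap (x + y))" if "colinear \<delta> (rhoR H \<delta>) (ap x)" "colinear \<delta> (rhoR H \<delta>) (ap y)" for x y
    using that by (simp add: colinear_def ap_linear rhoR_linear bformD tev_add tev_add_left)
  moreover have "colinear \<delta> (rhoR H \<delta>) (ap (c *s x))" if "colinear \<delta> (rhoR H \<delta>) (ap x)" for c x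
    using that by (simp add: colinear_def ap_linear rhoR_linear bformD tev_scale tev_scale_left)
  ultimately show ?thesis
    by (simp add: vec.subspace_def NW_iff_colinear)
qed

lemma NW_mult_closed:
  assumes "x \<in> NW H \<delta>" "y \<in> NW H \<delta>"
  shows "NW_mult H x y \<in> NW H \<delta>"
  unfolding NW_iff_colinear colinear_def
proof (intro allI impI)
  fix u and \<psi> :: "'k ^ 'n \<Rightarrow> 'k ^ ('n \<times> 'w) \<Rightarrow> 'k" assume b: "bform \<psi>"
  note [simp] = bformD[OF b] bformD_fun[OF b]
  have "tev (\<delta> u) (\<lambda>d v. \<psi> d (ap (NW_mult H x y) v)) =
      tev (\<delta> u) (\<lambda>d v. tev (ap y v) (\<lambda>h w. \<psi> d (left_act h (ap x w))))"
    by (simp add: lin_form_ap_mult)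
  also have "\<dots> = tev (rhoR H \<delta> (ap y u)) (\<lambda>d t. tev t (\<lambda>h w. \<psi> d (left_act h (ap x w))))"
    using NW_colinear[OF assms(2), of "\<lambda>d t. tev t (\<lambda>h w. \<psi> d (left_act h (ap x w)))" u]
    by (simp add: coaction_rules)
  also have "\<dots> = tev (ap y u) (\<lambda>h w. sw h (\<lambda>a b. tev (\<delta> w) (\<lambda>d v. \<psi> (adj H a d) (left_act b (ap x v)))))"
    by (subst tev_rhoR) (simp_all add: coaction_rules tev_tens)
  also have "\<dots> = tev (ap y u) (\<lambda>h w. tev (rhoR H \<delta> (left_act h (ap x w))) \<psi>)"
    using NW_colinear[OF assms(1), of "\<lambda>d t. \<psi> (adj H a d) (left_act b t)" for a b]
    by (simp add: tev_rhoR_left_act[OF b] coaction_rules)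
  also have "\<dots> = tev (rhoR H \<delta> (ap (NW_mult H x y) u)) \<psi>"
    using lin_form_ap_mult[of "\<lambda>t. tev (rhoR H \<delta> t) \<psi>" x y u] by (simp add: coaction_rules)
  finally show "tev (\<delta> u) (\<lambda>d v. \<psi> d (ap (NW_mult H x y) v)) = tev (rhoR H \<delta> (ap (NW_mult H x y) u)) \<psi>" .
qed

lemma NW_unit_in: "NW_unit H \<in> NW H \<delta>"
  unfolding NW_iff_colinear colinear_def
proof (intro allI impI)
  fix u and \<psi> :: "'k ^ 'n \<Rightarrow> 'k ^ ('n \<times> 'w) \<Rightarrow> 'k" assume b: "bform \<psi>"
  note [simp] = bformD[OF b] bformD_fun[OF b]
  show "tev (\<delta> u) (\<lambda>d v. \<psi> d (ap (NW_unit H) v)) = tev (rhoR H \<delta> (ap (NW_unit H) u)) \<psi>"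
    by (simp add: ap_unit tev_rhoR_tens[OF b] comult_unit coaction_rules adj_unit)
qed

lemma NW_slice:
  assumes "x \<in> NW H \<delta>" "lin_form g"
  shows "tsum (NW_coaction H x) (\<lambda>a y. g a *s y) \<in> NW H \<delta>"
  unfolding NW_iff_colinear colinear_def
proof (intro allI impI)
  fix u and \<psi> :: "'k ^ 'n \<Rightarrow> 'k ^ ('n \<times> 'w) \<Rightarrow> 'k" assume b: "bform \<psi>"
  note [simp] = bformD[OF b] bformD_fun[OF b] lin_formD[OF assms(2)]
  have "lin_form (\<lambda>b. g (S b))"
    by (simp add: coaction_rules)
  then show "tev (\<delta> u) (\<lambda>d v. \<psi> d (ap (tsum (NW_coaction H x) (\<lambda>a y. g a *s y)) v)) =
      tev (rhoR H \<delta> (ap (tsum (NW_coaction H x) (\<lambda>a y. g a *s y)) u)) \<psi>"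
    using NW_colinear[OF assms(1), of "\<lambda>d t. \<psi> d (coact_eval (\<lambda>b. g (S b)) t)"]
    by (simp add: ap_NW_coaction_slice[OF assms(2)] tev_rhoR_coact_eval[OF b] coaction_rules)
qed

theorem NW_comodule_algebra:
  "left_comodule_algebra H (NW H \<delta>) (NW_mult H) (NW_unit H) (NW_coaction H)"
proof -
  have "NW_coaction H x \<in> tens_space UNIV (NW H \<delta>)" if "x \<in> NW H \<delta>" for x
    by (intro in_tens_spaceI NW_subspace NW_slice that lin_form_nth)
  then show ?thesis
    by (simp add: left_comodule_algebra_def algebra_on_def left_comodule_def NW_subspace bilin_NW_mult
        NW_unit_in NW_mult_closed NW_mult_assoc NW_mult_unit lin_NW_coaction NW_coaction_coassoc
        NW_coaction_counit NW_coaction_mult NW_coaction_unit)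
qed

end

section \<open>Averaging to colinear maps\<close>

lemma subspace_tsum:
  assumes "vec.subspace X" "\<And>a b. \<beta> a b \<in> X"
  shows "tsum t \<beta> \<in> X"
  unfolding tsum_def by (intro vec.subspace_sum vec.subspace_scale assms)

context hopf_integrals
begin

lemma inv_antipode: "S (inv S x) = x" "inv S (S x) = x"
proof -
  have "surj S"
    unfolding surj_def using antipode_surj by metis
  moreover have "inj S"
    by (rule injI) (rule antipode_inj)
  ultimately show "S (inv S x) = x" "inv S (S x) = x"
    by (simp_all add: surj_f_inv_f)
qed

lemma inv_antipode_linear:
  "inv S (x + y) = inv S x + inv S y" "inv S (c *s x) = c *s inv S x"
  by (rule antipode_inj, simp add: inv_antipode hopf_linear)+

text \<open>
  The inverse antipode is an antipode for the opposite coproduct.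
\<close>

lemma inv_antipode_cancel:
  assumes "lin_form f"
  shows "sw h (\<lambda>a b. f (inv S b \<cdot> a)) = \<epsilon> h * f \<one>"
proof -
  note [simp] = lin_formD[OF assms]
  have "sw (S (inv S h)) (\<lambda>a b. f (inv S b \<cdot> a)) = \<epsilon> (inv S h) * f \<one>"
    by (subst comult_antipode) (simp_all add: lin_rules inv_antipode_linear inv_antipode antipode_r)
  also have "\<epsilon> (inv S h) = \<epsilon> h"
    by (metis counit_antipode inv_antipode(1))
  finally show ?thesis
    by (simp add: inv_antipode)
qed

end

context quasitriangular_integrals
begin

text \<open>
  \<open>u \<mapsto> \<Sum> B (u\<^sub>-\<^sub>1, s(u\<^sub>0)\<^sub>-\<^sub>1) s(u\<^sub>0)\<^sub>0\<close>: the colinear map obtained from an arbitrary linear map \<open>s\<close> by averaging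
  with the coseparability form. Averaging commutes with composition with colinear maps and fixes
  colinear maps.
\<close>

definition average ::
  "('k ^ 'u::finite \<Rightarrow> 'k ^ ('n \<times> 'u)) \<Rightarrow> ('k ^ 'v::finite \<Rightarrow> 'k ^ ('n \<times> 'v)) \<Rightarrow> ('k ^ 'u \<Rightarrow> 'k ^ 'v) \<Rightarrow>
    'k ^ 'u \<Rightarrow> 'k ^ 'v"
  where "average \<rho> \<sigma> s u = tsum (\<rho> u) (\<lambda>d v. tsum (\<sigma> (s v)) (\<lambda>d' v'. B d d' *s v'))"

lemma lin_form_average:
  "lin_form f \<Longrightarrow> f (average \<rho> \<sigma> s u) = tev (\<rho> u) (\<lambda>d v. tev (\<sigma> (s v)) (\<lambda>d' v'. B d d' * f v'))"
  by (simp add: average_def lin_form_tsum lin_formD)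

lemma Rcomodule_linear:
  assumes "Rcomodule \<rho>"
  shows "\<rho> (x + y) = \<rho> x + \<rho> y" "\<rho> (c *s x) = c *s \<rho> x"
  using assms by (simp_all add: Rcomodule_def lin_iff)

lemma lin_average: "Rcomodule \<rho> \<Longrightarrow> lin (average \<rho> \<sigma> s)"
  by (simp add: lin_iff average_def Rcomodule_linear tsum_add_left tsum_scale_left)

text \<open>
  \<open>B_balanced\<close> carries the leg split off from \<open>s u\<close> over to \<open>u\<close>; coassociativity on both sides does the
  rest.
\<close>

lemma colinear_average:
  fixes \<rho> :: "'k ^ 'u::finite \<Rightarrow> 'k ^ ('n \<times> 'u)" and \<sigma> :: "'k ^ 'v::finite \<Rightarrow> 'k ^ ('n \<times> 'v)"
  assumes \<rho>: "Rcomodule \<rho>" and \<sigma>: "Rcomodule \<sigma>" and s: "lin s"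
  shows "colinear \<rho> \<sigma> (average \<rho> \<sigma> s)"
  unfolding colinear_def
proof (intro allI impI)
  fix u and \<psi> :: "'k ^ 'n \<Rightarrow> 'k ^ 'v \<Rightarrow> 'k" assume b: "bform \<psi>"
  have ls: "s (x + y) = s x + s y" "s (c *s x) = c *s s x" for x y c
    using s by (simp_all add: lin_iff)
  note [simp] = bformD[OF b] bformD_fun[OF b] bformD[OF bform_B] bformD_fun[OF bform_B]
  note l = lin_rules ls Rcomodule_linear[OF \<rho>] Rcomodule_linear[OF \<sigma>]
  have \<rho>c: "tev (\<rho> x) (\<lambda>d v. swR d (\<lambda>a b. \<phi> a b v)) = tev (\<rho> x) (\<lambda>d v. tev (\<rho> v) (\<lambda>b u. \<phi> d b u))"
    if "tform \<phi>" for x \<phi>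
    using that \<rho> by (simp add: Rcomodule_def)
  have \<sigma>c: "tev (\<sigma> x) (\<lambda>d v. swR d (\<lambda>a b. \<phi> a b v)) = tev (\<sigma> x) (\<lambda>d v. tev (\<sigma> v) (\<lambda>b u. \<phi> d b u))"
    if "tform \<phi>" for x \<phi>
    using that \<sigma> by (simp add: Rcomodule_def)
  have "tev (\<sigma> (average \<rho> \<sigma> s u)) \<psi> = tev (\<rho> u) (\<lambda>d v. tev (\<sigma> (s v)) (\<lambda>e v'. tev (\<sigma> v') (\<lambda>e' w. B d e * \<psi> e' w)))"
    using lin_form_average[of "\<lambda>t. tev (\<sigma> t) \<psi>" \<rho> \<sigma> s u] by (simp add: l)
  also have "\<dots> = tev (\<rho> u) (\<lambda>d v. tev (\<sigma> (s v)) (\<lambda>e v'. swR e (\<lambda>e1 e2. B d e1 * \<psi> e2 v')))"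
    using \<sigma>c[of "\<lambda>e e' w. B d e * \<psi> e' w" for d] by (simp add: l)
  also have "\<dots> = tev (\<rho> u) (\<lambda>d v. tev (\<sigma> (s v)) (\<lambda>e v'. swR d (\<lambda>d1 d2. B d2 e * \<psi> d1 v')))"
    by (simp add: B_balanced[of "\<lambda>z. \<psi> z _"])
  also have "\<dots> = tev (\<rho> u) (\<lambda>d v. swR d (\<lambda>d1 d2. tev (\<sigma> (s v)) (\<lambda>e v'. B d2 e * \<psi> d1 v')))"
    by (subst (2) tev_swap) (rule refl)
  also have "\<dots> = tev (\<rho> u) (\<lambda>d v. tev (\<rho> v) (\<lambda>d2 v2. tev (\<sigma> (s v2)) (\<lambda>e v'. B d2 e * \<psi> d v')))"
    by (rule \<rho>c) (simp add: l)
  also have "\<dots> = tev (\<rho> u) (\<lambda>d v. \<psi> d (average \<rho> \<sigma> s v))"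
    by (simp add: lin_form_average)
  finally show "tev (\<rho> u) (\<lambda>d v. \<psi> d (average \<rho> \<sigma> s v)) = tev (\<sigma> (average \<rho> \<sigma> s u)) \<psi>" by simp
qed

end

locale R_comodule_integrals = R_comodule H R \<delta> + quasitriangular_integrals H R lam \<Lambda>
  for H :: "('k::field, 'n::finite) hopf_data" and R and \<delta> :: "'k ^ 'w::finite \<Rightarrow> 'k ^ ('n \<times> 'w)"
    and lam \<Lambda>
begin

abbreviation HW_average where "HW_average \<equiv> average \<delta> (rhoR H \<delta>)"

lemma average_in_NW:
  assumes "lin s"
  obtains y where "y \<in> NW H \<delta>" "\<And>u. ap y u = HW_average s u"
proof -
  obtain y where y: "\<And>u. ap y u = HW_average s u"
    using ap_surj[OF lin_average[OF Rcomodule_delta]] by blast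
  then have "ap y = HW_average s"
    by (rule ext)
  then have "y \<in> NW H \<delta>"
    by (simp add: NW_iff_colinear colinear_average Rcomodule_delta Rcomodule_rhoR assms)
  then show ?thesis
    using y that by blast
qed

definition counit_part :: "'k ^ ('n \<times> 'w) \<Rightarrow> 'k ^ 'w"
  where "counit_part t = tsum t (\<lambda>h w. \<epsilon> h *s w)"

lemma lin_form_counit_part: "lin_form f \<Longrightarrow> f (counit_part t) = tev t (\<lambda>h w. \<epsilon> h * f w)"
  by (simp add: counit_part_def lin_form_tsum lin_formD)

lemma counit_part_linear: "counit_part (s + t) = counit_part s + counit_part t" "counit_part (c *s t) = c *s counit_part t"
  by (simp_all add: counit_part_def tsum_add_left tsum_scale_left)

lemma counit_part_tens: "counit_part (h \<otimes>\<^sub>k w) = \<epsilon> h *s w"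
proof (rule vec_eq_formI)
  fix f :: "'k ^ 'w \<Rightarrow> 'k" assume f: "lin_form f"
  note [simp] = lin_formD[OF f]
  show "f (counit_part (h \<otimes>\<^sub>k w)) = f (\<epsilon> h *s w)"
    by (simp add: lin_form_counit_part[OF f] tev_tens lin_rules)
qed

lemma counit_part_coact_eval: "lin_form g \<Longrightarrow> counit_part (coact_eval g t) = tsum t (\<lambda>h w. g h *s w)"
proof (rule vec_eq_formI)
  fix f :: "'k ^ 'w \<Rightarrow> 'k" assume f: "lin_form f" and g: "lin_form g"
  note [simp] = lin_formD[OF f] lin_formD[OF g]
  show "f (counit_part (coact_eval g t)) = f (tsum t (\<lambda>h w. g h *s w))"
    using lin_form_coact_eval[of "\<lambda>z. f (counit_part z)" g t] counit_l[OF g]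
    by (simp add: lin_rules counit_part_linear counit_part_tens lin_form_tsum[OF f])
qed

text \<open>
  The projection onto coinvariants in the structure theorem of Hopf modules: for \<open>t = h \<otimes> w\<close> the sum is
  \<open>\<Sum> S\<^sup>-\<^sup>1(h2) h1 \<otimes> w = \<epsilon> h \<one> \<otimes> w\<close>.
\<close>

lemma unit_tens_counit_part:
  "\<one> \<otimes>\<^sub>k counit_part t = (\<Sum>i\<in>UNIV. left_act (inv S (axis i 1)) (coact_eval (\<lambda>b. b $ i) t))"
proof (rule vec_eq_formI)
  fix f :: "'k ^ ('n \<times> 'w) \<Rightarrow> 'k" assume f: "lin_form f"
  note [simp] = lin_formD[OF f]
  have inv_expand: "(\<Sum>i\<in>UNIV. b $ i * f ((inv S (axis i 1) \<cdot> a) \<otimes>\<^sub>k w)) = f ((inv S b \<cdot> a) \<otimes>\<^sub>k w)" for a b w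
    by (rule lin_form_expansion[symmetric, of "\<lambda>b. f ((inv S b \<cdot> a) \<otimes>\<^sub>k w)"])
      (simp add: lin_rules inv_antipode_linear)
  have "f (\<Sum>i\<in>UNIV. left_act (inv S (axis i 1)) (coact_eval (\<lambda>b. b $ i) t)) =
      (\<Sum>i\<in>UNIV. tev t (\<lambda>h w. sw h (\<lambda>a b. b $ i * f ((inv S (axis i 1) \<cdot> a) \<otimes>\<^sub>k w))))"
    using lin_form_coact_eval[of "\<lambda>z. f (left_act h z)" "\<lambda>b. b $ i" t for h i]
    by (simp add: lin_form_sum[OF f] coaction_rules left_act_tens)
  also have "\<dots> = tev t (\<lambda>h w. sw h (\<lambda>a b. f ((inv S b \<cdot> a) \<otimes>\<^sub>k w)))"
    by (simp only: inv_expand flip: tev_sum)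
  also have "\<dots> = f (\<one> \<otimes>\<^sub>k counit_part t)"
    using inv_antipode_cancel[of "\<lambda>z. f (z \<otimes>\<^sub>k w)" for w] lin_form_counit_part[of "\<lambda>w. f (\<one> \<otimes>\<^sub>k w)" t]
    by (simp add: lin_rules)
  finally show "f (\<one> \<otimes>\<^sub>k counit_part t) = f (\<Sum>i\<in>UNIV. left_act (inv S (axis i 1)) (coact_eval (\<lambda>b. b $ i) t))" by simp
qed

end

section \<open>The subcomodule attached to a costable ideal\<close>

locale costable_ideal_of_NW = R_comodule_integrals H R \<delta> lam \<Lambda>
  for H :: "('k::field, 'n::finite) hopf_data" and R and \<delta> :: "'k ^ 'w::finite \<Rightarrow> 'k ^ ('n \<times> 'w)"
    and lam \<Lambda> +
  fixes I
  assumes costable: "costable_ideal (NW H \<delta>) (NW_mult H) (NW_coaction H) I"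
begin

lemma ideal: "vec.subspace I" "x \<in> I \<Longrightarrow> x \<in> NW H \<delta>"
  "y \<in> NW H \<delta> \<Longrightarrow> x \<in> I \<Longrightarrow> NW_mult H y x \<in> I" "y \<in> NW H \<delta> \<Longrightarrow> x \<in> I \<Longrightarrow> NW_mult H x y \<in> I"
  "x \<in> I \<Longrightarrow> NW_coaction H x \<in> tens_space UNIV I"
  using costable by (auto simp: costable_ideal_def)

text \<open>
  \<open>T\<close> is the image of the ideal, a submodule of \<open>H \<otimes> W\<close>. As the ideal is costable, \<open>T\<close> is a Hopf
  submodule and hence of the form \<open>H \<otimes> U\<close>. The two inclusions that are used are \<open>ap_in_HU\<close> and
  \<open>unit_tens_in_T\<close>.
\<close>

definition T where "T = vec.span {left_act h (ap x u) | h x u. x \<in> I}"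
definition U where "U = vec.span {counit_part (ap x u) | x u. x \<in> I}"

text \<open>
  The coaction of \<open>N\<^sub>W\<close> involves \<open>S h2\<close>; slicing it with \<open>g \<circ> S\<^sup>-\<^sup>1\<close> removes the antipode.
\<close>

lemma coact_eval_ideal:
  assumes x: "x \<in> I" and g: "lin_form g"
  obtains x' where "x' \<in> I" "\<And>u. ap x' u = coact_eval g (ap x u)"
proof -
  have g': "lin_form (\<lambda>b. g (inv S b))"
    by (simp add: lin_form_iff inv_antipode_linear lin_formD[OF g])
  have "bilin (\<lambda>a y. g (inv S a) *s y)"
    by (simp add: bilin_def lin_iff lin_formD[OF g'] vec.scale_left_distrib vec.scale_right_distrib mult.commute)
  then have "tsum (NW_coaction H x) (\<lambda>a y. g (inv S a) *s y) \<in> I"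
    by (rule tsum_in_subspace[OF ideal(5)[OF x]]) (simp_all add: ideal(1) vec.subspace_scale)
  then show ?thesis
    by (rule that) (simp add: ap_NW_coaction_slice[OF g'] inv_antipode)
qed

lemma ap_in_HU:
  assumes "x \<in> I"
  shows "ap x u \<in> tens_space UNIV U"
proof (rule in_tens_spaceI)
  show "vec.subspace U"
    by (simp add: U_def vec.subspace_span)
  fix i
  obtain x' where "x' \<in> I" "\<And>u. ap x' u = coact_eval (\<lambda>b. b $ i) (ap x u)"
    using coact_eval_ideal[OF assms lin_form_nth] by blast
  then have "counit_part (coact_eval (\<lambda>b. b $ i) (ap x u)) \<in> U"
    unfolding U_def by (metis (mono_tags, lifting) mem_Collect_eq vec.span_base)
  then show "tsum (ap x u) (\<lambda>a y. a $ i *s y) \<in> U"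
    by (simp add: counit_part_coact_eval lin_form_nth)
qed

lemma unit_tens_in_T:
  assumes "v \<in> U"
  shows "\<one> \<otimes>\<^sub>k v \<in> T"
proof -
  have sT: "vec.subspace T"
    by (simp add: T_def vec.subspace_span)
  have "\<one> \<otimes>\<^sub>k counit_part (ap x u) \<in> T" if x: "x \<in> I" for x u
    unfolding unit_tens_counit_part
  proof (intro vec.subspace_sum sT)
    fix i
    obtain x' where "x' \<in> I" "\<And>u. ap x' u = coact_eval (\<lambda>b. b $ i) (ap x u)"
      using coact_eval_ideal[OF x lin_form_nth] by blast
    then show "left_act (inv S (axis i 1)) (coact_eval (\<lambda>b. b $ i) (ap x u)) \<in> T"
      unfolding T_def by (metis (mono_tags, lifting) mem_Collect_eq vec.span_base)
  qed
  moreover have "\<one> \<otimes>\<^sub>k (0 :: 'k ^ 'w) = 0"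
    by (simp add: tens_def vec_eq_iff)
  then have "vec.subspace {v :: 'k ^ 'w. \<one> \<otimes>\<^sub>k v \<in> T}"
    using sT by (simp add: vec.subspace_def tens_simps)
  ultimately have "U \<subseteq> {v. \<one> \<otimes>\<^sub>k v \<in> T}"
    unfolding U_def by (intro vec.span_minimal) auto
  then show ?thesis
    using assms by auto
qed

lemma left_act_HU:
  assumes "t \<in> tens_space UNIV U"
  shows "left_act h t \<in> tens_space UNIV U"
  unfolding left_act_def
proof (rule tsum_in_subspace[OF assms _ subspace_tens_space])
  show "bilin (\<lambda>g (v :: 'k ^ 'w). (h \<cdot> g) \<otimes>\<^sub>k v)"
    by (simp add: bilin_def lin_iff hopf_linear tens_simps)
qed (rule tens_in_tens_space, simp_all)

lemma T_vanishes:
  assumes "lin_form F" "\<And>h x u. x \<in> I \<Longrightarrow> F (left_act h (ap x u)) = 0" "t \<in> T"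
  shows "F t = 0"
proof -
  have "vec.subspace {t. F t = 0}"
    by (auto simp: vec.subspace_def lin_formD[OF assms(1)])
  then have "T \<subseteq> {t. F t = 0}"
    unfolding T_def using assms(2) by (intro vec.span_minimal) auto
  then show ?thesis
    using assms(3) by auto
qed

lemma counit_part_vanishes:
  assumes "lin_form k" "\<And>v. v \<in> U \<Longrightarrow> k v = 0" "t \<in> tens_space UNIV U"
  shows "k (counit_part t) = 0"
  unfolding lin_form_counit_part[OF assms(1)]
proof (rule tev_vanishes[OF assms(3)])
  show "bform (\<lambda>h v. \<epsilon> h * k v)"
    by (simp add: lin_rules lin_formD[OF assms(1)])
qed (simp add: assms(2))

text \<open>
  \<open>T\<close> is mapped into itself by the extension of every \<open>y\<close> in \<open>N\<^sub>W\<close>, as \<open>y \<circ> x\<close> is again in the ideal. The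
  conclusion is phrased with a form \<open>k\<close> that vanishes on \<open>U\<close>.
\<close>

lemma U_stable:
  assumes "y \<in> NW H \<delta>" "v \<in> U" "lin_form k" "\<And>v. v \<in> U \<Longrightarrow> k v = 0"
  shows "k (counit_part (ap y v)) = 0"
proof -
  note [simp] = lin_formD[OF assms(3)]
  define F where "F t = tev t (\<lambda>h w. k (counit_part (left_act h (ap y w))))" for t
  have "F (\<one> \<otimes>\<^sub>k v) = 0"
  proof (rule T_vanishes[OF _ _ unit_tens_in_T[OF assms(2)]])
    show "lin_form F"
      by (simp add: F_def lin_form_iff tev_add_left tev_scale_left)
    fix h x u assume x: "x \<in> I"
    have "F (left_act h (ap x u)) = tev (ap x u) (\<lambda>g w. k (counit_part (left_act h (left_act g (ap y w)))))"
      unfolding F_def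
      by (subst lin_form_left_act[OF lin_form_tev]) (simp add: tev_tens coaction_rules counit_part_linear left_act_left_act)
    also have "\<dots> = k (counit_part (left_act h (ap (NW_mult H y x) u)))"
      using lin_form_ap_mult[of "\<lambda>t. k (counit_part (left_act h t))" y x u] by (simp add: coaction_rules counit_part_linear)
    also have "\<dots> = 0"
      by (rule counit_part_vanishes[OF assms(3,4) left_act_HU[OF ap_in_HU[OF ideal(3)[OF assms(1) x]]]])
    finally show "F (left_act h (ap x u)) = 0" .
  qed
  then show ?thesis
    by (simp add: F_def tev_tens coaction_rules counit_part_linear left_act_unit)
qed

text \<open>
  \<open>T\<close> is a subcomodule of \<open>H \<otimes> W\<close>, since it is the image of colinear maps, and \<open>\<rho>\<^sub>R (\<one> \<otimes> v)\<close> is the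
  coaction of \<open>v\<close>.
\<close>

lemma U_subcomodule:
  assumes "v \<in> U" "lin_form k" "\<And>v. v \<in> U \<Longrightarrow> k v = 0" "lin_form g"
  shows "tev (\<delta> v) (\<lambda>d w. g d * k w) = 0"
proof -
  note [simp] = lin_formD[OF assms(2)] lin_formD[OF assms(4)]
  define F where "F t = tev (rhoR H \<delta> t) (\<lambda>d t. g d * k (counit_part t))" for t
  have b: "bform (\<lambda>d t. g d * k (counit_part t))"
    by (simp add: coaction_rules counit_part_linear)
  have "F (\<one> \<otimes>\<^sub>k v) = 0"
  proof (rule T_vanishes[OF _ _ unit_tens_in_T[OF assms(1)]])
    show "lin_form F"
      by (simp add: F_def coaction_rules)
    fix h x u assume x: "x \<in> I"
    have "F (left_act h (ap x u)) = sw h (\<lambda>a b. tev (\<delta> u) (\<lambda>d w. g (adj H a d) * k (counit_part (left_act b (ap x w)))))"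
      using NW_colinear[OF ideal(2)[OF x], of "\<lambda>d t. g (adj H a d) * k (counit_part (left_act b t))" for a b]
      by (simp add: F_def tev_rhoR_left_act[OF b] coaction_rules counit_part_linear)
    also have "\<dots> = 0"
      using counit_part_vanishes[OF assms(2,3) left_act_HU[OF ap_in_HU[OF x]]] by (simp add: tev_zero)
    finally show "F (left_act h (ap x u)) = 0" .
  qed
  then show ?thesis
    by (simp add: F_def tev_rhoR_tens[OF b] comult_unit coaction_rules counit_part_linear counit_part_tens adj_unit)
qed

end

section \<open>Minimality forces costable ideals to be trivial\<close>

context R_comodule
begin

text \<open>
  A matrix coefficient \<open>\<Sum> w\<^sub>-\<^sub>1 k(w\<^sub>0)\<close> of the comodule \<open>W\<close>.
\<close>

definition coef :: "'k ^ 'w \<Rightarrow> ('k ^ 'w \<Rightarrow> 'k) \<Rightarrow> 'k ^ 'n"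
  where "coef w k = tsum (\<delta> w) (\<lambda>d v. k v *s d)"

lemma lin_form_coef: "lin_form f \<Longrightarrow> f (coef w k) = tev (\<delta> w) (\<lambda>d v. k v * f d)"
  by (simp add: coef_def lin_form_tsum lin_formD)

lemma coef_linear: "coef (v + w) k = coef v k + coef w k" "coef (c *s w) k = c *s coef w k"
  by (simp_all add: coef_def delta_linear tsum_add_left tsum_scale_left)

lemma coef_expansion: "coef w k = (\<Sum>j\<in>UNIV. w $ j *s coef (axis j 1) k)"
  by (rule lin_basis_expansion) (simp add: lin_iff coef_linear)

end

context costable_ideal_of_NW
begin

text \<open>
  The coefficients of the quotient comodule \<open>W / U\<close>, that is those with \<open>k\<close> vanishing on \<open>U\<close>, span a
  subcoalgebra. The map \<open>q\<close> stands for the quotient map \<open>W \<rightarrow> W / U\<close> followed by a linear section;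
  when it vanishes on \<open>U\<close>, the forms \<open>v \<mapsto> q v $ j\<close> do so as well, and the first tensor factors below
  are again coefficients of the quotient.
\<close>

lemma coef_comultR:
  assumes k: "lin_form k" "\<And>v. v \<in> U \<Longrightarrow> k v = 0"
    and q: "lin q" "\<And>v. v - q v \<in> U" and b: "bform \<phi>"
  shows "swR (coef w k) \<phi> = (\<Sum>j\<in>UNIV. \<phi> (coef w (\<lambda>v. q v $ j)) (coef (axis j 1) k))"
proof -
  note [simp] = lin_formD[OF k(1)] bformD[OF b] bformD_fun[OF b]
  have zero: "coef (v - q v) k = 0" for v
  proof (rule vec_eq_formI)
    fix f :: "'k ^ 'n \<Rightarrow> 'k" assume f: "lin_form f"
    have "f (coef (v - q v) k) = tev (\<delta> (v - q v)) (\<lambda>d w. f d * k w)"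
      by (simp add: lin_form_coef[OF f] mult.commute)
    also have "\<dots> = 0"
      by (rule U_subcomodule[OF q(2) k f])
    finally show "f (coef (v - q v) k) = f 0"
      by (simp add: lin_formD[OF f])
  qed
  have coef_q: "coef v k = (\<Sum>j\<in>UNIV. q v $ j *s coef (axis j 1) k)" for v
  proof -
    have "coef v k = coef (v - q v) k + coef (q v) k"
      by (simp flip: coef_linear(1))
    then show ?thesis
      by (simp add: zero coef_expansion[of "q v"])
  qed
  have "swR (coef w k) \<phi> = tev (\<delta> w) (\<lambda>d v. swR d (\<lambda>a b. k v * \<phi> a b))"
    using lin_form_coef[of "\<lambda>z. swR z \<phi>" w k] by (simp add: coaction_rules)
  also have "\<dots> = tev (\<delta> w) (\<lambda>d v. tev (\<delta> v) (\<lambda>b u. k u * \<phi> d b))"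
    by (rule delta_coassoc) (simp add: coaction_rules)
  also have "\<dots> = tev (\<delta> w) (\<lambda>d v. \<phi> d (coef v k))"
    by (simp add: lin_form_coef)
  also have "\<dots> = tev (\<delta> w) (\<lambda>d v. \<Sum>j\<in>UNIV. q v $ j * \<phi> d (coef (axis j 1) k))"
    by (subst coef_q) (simp add: lin_form_sum[of "\<phi> _"])
  also have "\<dots> = (\<Sum>j\<in>UNIV. \<phi> (coef w (\<lambda>v. q v $ j)) (coef (axis j 1) k))"
    by (simp add: tev_sum lin_form_coef[of "\<lambda>z. \<phi> z _"])
  finally show ?thesis .
qed

text \<open>
  Averaging \<open>v \<mapsto> g v \<cdot> (h \<otimes> w)\<close> gives an element \<open>y\<close> of \<open>N\<^sub>W\<close>. It maps \<open>U\<close> into \<open>H \<otimes> U\<close>, where \<open>\<epsilon> \<otimes> k\<close>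
  vanishes, and \<open>(\<epsilon> \<otimes> k) (y u)\<close> is the value of \<open>B\<close> in question.
\<close>

lemma B_vanishes:
  assumes "u \<in> U" "lin_form g" "lin_form k" "\<And>v. v \<in> U \<Longrightarrow> k v = 0"
  shows "B (coef u g) (adj H h (coef w k)) = 0"
proof -
  note [simp] = lin_formD[OF assms(2)] lin_formD[OF assms(3)] bformD[OF bform_B] bformD_fun[OF bform_B]
  define s where "s v = g v *s (h \<otimes>\<^sub>k w)" for v
  have "lin s"
    by (simp add: lin_iff s_def vec.scale_left_distrib)
  then obtain y where y: "y \<in> NW H \<delta>" "\<And>u. ap y u = HW_average s u"
    by (rule average_in_NW) blast
  have inner: "tev (\<delta> w) (\<lambda>d' v'. B d (adj H a d') * k v') = B d (adj H a (coef w k))" for d a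
    using lin_form_coef[of "\<lambda>z. B d (adj H a z)" w k] by (simp add: coaction_rules)
  have "0 = k (counit_part (ap y u))"
    using U_stable[OF y(1) assms(1,3,4)] by simp
  also have "\<dots> = tev (\<delta> u) (\<lambda>d v. g v * tev (rhoR H \<delta> (h \<otimes>\<^sub>k w)) (\<lambda>d' v'. B d d' * k (counit_part v')))"
    using lin_form_average[of "\<lambda>t. k (counit_part t)" \<delta> "rhoR H \<delta>" s u]
    by (simp add: y(2) counit_part_linear lin_form_iff s_def rhoR_linear tev_scale_left)
  also have "\<dots> = tev (\<delta> u) (\<lambda>d v. g v * sw h (\<lambda>a b. \<epsilon> b * tev (\<delta> w) (\<lambda>d' v'. B d (adj H a d') * k v')))"
    using tev_scale[of "\<delta> w" "\<epsilon> b" "\<lambda>d' v'. B d (adj H a d') * k v'" for a b d]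
    by (subst tev_rhoR_tens) (simp_all add: coaction_rules counit_part_linear counit_part_tens)
  also have "\<dots> = tev (\<delta> u) (\<lambda>d v. g v * B d (adj H h (coef w k)))"
    unfolding inner by (subst counit_r) (simp_all add: coaction_rules)
  also have "\<dots> = B (coef u g) (adj H h (coef w k))"
    by (rule lin_form_coef[symmetric]) simp
  finally show ?thesis by simp
qed

text \<open>
  This is where minimality of \<open>D\<close> enters. If \<open>U\<close> is proper, then the \<open>H\<close>-span of the coefficients of
  \<open>W / U\<close> is a nonzero adjoint-stable subcoalgebra of \<open>D\<close>, hence all of \<open>D\<close>. So \<open>B\<close> pairs the
  coefficients of \<open>U\<close> to zero with \<open>D\<close>. As \<open>B\<close> restricts to the counit along \<open>\<Delta>\<^sub>R\<close>, the counit vanishes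
  on the coefficients of \<open>U\<close>; then \<open>U\<close> is zero, and so is the ideal.
\<close>

lemma U_full:
  assumes D: "minimal_adj_stable_subcoalgebra H R D"
    and \<delta>D: "\<And>w. \<delta> w \<in> tens_space D UNIV"
    and nz: "I \<noteq> {0}"
  shows "U = UNIV"
proof (rule ccontr)
  assume "U \<noteq> UNIV"
  then obtain v0 where v0: "v0 \<notin> U"
    by blast
  have sU: "vec.subspace U"
    by (simp add: U_def vec.subspace_span)
  obtain k0 where k0: "lin_form k0" "k0 v0 = 1" "\<And>v. v \<in> U \<Longrightarrow> k0 v = 0"
    using exists_separating_form[OF sU v0] by blast
  obtain p where p: "lin p" "\<And>v. p v \<in> U" "\<And>v. v \<in> U \<Longrightarrow> p v = v"
    using exists_projection[OF sU] by blast
  define q where "q v = v - p v" for v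
  have q: "lin q" "\<And>v. v - q v \<in> U"
    using p(1,2) by (simp_all add: q_def lin_iff algebra_simps vec.scale_right_diff_distrib)
  have qj: "lin_form (\<lambda>v. q v $ j)" "\<And>v. v \<in> U \<Longrightarrow> q v $ j = 0" for j
    using lin_form_lin[OF lin_form_nth q(1)] p(3) by (simp_all add: q_def)
  have sD: "vec.subspace D" and aD: "\<And>h d. d \<in> D \<Longrightarrow> adj H h d \<in> D"
    using D by (auto simp: minimal_adj_stable_subcoalgebra_def adj_stable_subcoalgebra_def subcoalgebra_def)
  have coef_D: "coef w k \<in> D" if k: "lin_form k" for w k
    unfolding coef_def
    by (rule tsum_in_subspace[OF \<delta>D _ sD])
      (simp_all add: bilin_def lin_iff lin_formD[OF k] vec.scale_left_distrib vec.scale_right_distrib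
        mult.commute vec.subspace_scale[OF sD])
  define G where "G = {adj H h (coef w k) | h w k. lin_form k \<and> (\<forall>v\<in>U. k v = 0)}"
  define E where "E = vec.span G"
  have sE: "vec.subspace E"
    by (simp add: E_def vec.subspace_span)
  have in_E: "adj H h (coef w k) \<in> E" if "lin_form k" "\<And>v. v \<in> U \<Longrightarrow> k v = 0" for h w k
    using that unfolding E_def G_def by (intro vec.span_base) blast
  have comult_E: "comultR H R x \<in> tens_space E E" if xG: "x \<in> G" for x
  proof -
    obtain h w k where x: "x = adj H h (coef w k)" and k: "lin_form k" "\<And>v. v \<in> U \<Longrightarrow> k v = 0"
      using xG unfolding G_def by blast
    let ?c = "\<lambda>j. coef w (\<lambda>v. q v $ j)" and ?c' = "\<lambda>j. coef (axis j 1) k"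
    have "comultR H R x = (\<Sum>j\<in>UNIV. tsum (comult H h) (\<lambda>a b. adj H a (?c j) \<otimes>\<^sub>k adj H b (?c' j)))"
    proof (rule tens_eqI)
      fix \<phi> :: "'k ^ 'n \<Rightarrow> 'k ^ 'n \<Rightarrow> 'k" assume b: "bform \<phi>"
      note [simp] = bformD[OF b] bformD_fun[OF b]
      have "swR x \<phi> = sw h (\<lambda>a b. swR (coef w k) (\<lambda>x y. \<phi> (adj H a x) (adj H b y)))"
        unfolding x by (rule comultR_adj[OF b])
      also have "\<dots> = sw h (\<lambda>a b. \<Sum>j\<in>UNIV. \<phi> (adj H a (?c j)) (adj H b (?c' j)))"
        by (subst coef_comultR[OF k q]) (simp_all add: coaction_rules)
      also have "\<dots> = tev (\<Sum>j\<in>UNIV. tsum (comult H h) (\<lambda>a b. adj H a (?c j) \<otimes>\<^sub>k adj H b (?c' j))) \<phi>"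
        by (simp add: tev_sum lin_form_sum[OF lin_form_tev] tev_tsum tev_tens[OF b])
      finally show "swR x \<phi> = \<dots>" .
    qed
    also have "\<dots> \<in> tens_space E E"
      by (intro vec.subspace_sum subspace_tens_space subspace_tsum tens_in_tens_space in_E k qj)
    finally show ?thesis .
  qed
  have "vec.subspace {x. comultR H R x \<in> tens_space E E}"
    using vec.subspace_0[OF subspace_tens_space] comultR_linear(2)[of 0 0]
    by (auto simp: vec.subspace_def comultR_linear intro: vec.subspace_add[OF subspace_tens_space]
        vec.subspace_scale[OF subspace_tens_space])
  then have "E \<subseteq> {x. comultR H R x \<in> tens_space E E}"
    unfolding E_def using comult_E by (intro vec.span_minimal) (auto simp: E_def)
  then have "subcoalgebra (comultR H R) E"
    using sE by (auto simp: subcoalgebra_def)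
  moreover have "adj H h x \<in> E" if "x \<in> E" for h x
  proof -
    have "vec.subspace {x. adj H h x \<in> E}"
      using sE adj_linear(4)[of h 0 0] by (auto simp: vec.subspace_def adj_linear)
    moreover have "G \<subseteq> {x. adj H h x \<in> E}"
      using in_E by (auto simp: G_def adj_adj)
    ultimately have "E \<subseteq> {x. adj H h x \<in> E}"
      unfolding E_def by (intro vec.span_minimal) 
    then show ?thesis
      using that by auto
  qed
  moreover have "E \<noteq> {0}"
  proof
    assume "E = {0}"
    moreover have "coef v0 k0 \<in> E"
      using in_E[OF k0(1,3), of \<one> v0] by (simp add: adj_unit)
    ultimately have "\<epsilon> (coef v0 k0) = 0"
      using lin_formD(3)[OF lin_form_counit] by auto
    moreover have "\<epsilon> (coef v0 k0) = k0 v0"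
      using delta_counit[OF k0(1), of v0] by (simp add: lin_form_coef lin_form_counit mult.commute)
    ultimately show False
      using k0(2) by simp
  qed
  moreover have "E \<subseteq> D"
    unfolding E_def using coef_D aD sD by (intro vec.span_minimal) (auto simp: G_def)
  ultimately have "E = D"
    using D by (simp add: minimal_adj_stable_subcoalgebra_def adj_stable_subcoalgebra_def)
  have B0: "B (coef u g) d = 0" if u: "u \<in> U" and g: "lin_form g" and d: "d \<in> D" for u g d
  proof -
    have "vec.subspace {d. B (coef u g) d = 0}"
      using bformD[OF bform_B] by (auto simp: vec.subspace_def lin_formD(3)[OF bformD(5)[OF bform_B]])
    moreover have "G \<subseteq> {d. B (coef u g) d = 0}"
      using B_vanishes[OF u g] by (auto simp: G_def)
    ultimately have "E \<subseteq> {d. B (coef u g) d = 0}"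
      unfolding E_def by (intro vec.span_minimal)
    then show ?thesis
      using d \<open>E = D\<close> by auto
  qed
  have "u = 0" if u: "u \<in> U" for u
  proof (rule vec_eq_formI)
    fix g :: "'k ^ 'w \<Rightarrow> 'k" assume g: "lin_form g"
    note [simp] = lin_formD[OF g] bformD[OF bform_B] bformD_fun[OF bform_B]
    \<comment> \<open>Writing \<open>\<epsilon>\<close> as \<open>B\<close> composed with \<open>\<Delta>\<^sub>R\<close> exhibits \<open>g u\<close> as a sum of values \<open>B (coef u _) (coef _ g)\<close>.\<close>
    have "g u = tev (\<delta> u) (\<lambda>d v. swR d (\<lambda>a b. B a b * g v))"
      using delta_counit[OF g, of u] by (simp add: B_comultR tev_scale2)
    also have "\<dots> = tev (\<delta> u) (\<lambda>d v. tev (\<delta> v) (\<lambda>b w. B d b * g w))"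
      by (rule delta_coassoc) (simp add: coaction_rules)
    also have "\<dots> = tev (\<delta> u) (\<lambda>d v. B d (coef v g))"
      by (simp add: lin_form_coef mult.commute)
    also have "\<dots> = tev (\<delta> u) (\<lambda>d v. \<Sum>j\<in>UNIV. v $ j * B d (coef (axis j 1) g))"
      by (subst coef_expansion) (simp add: lin_form_sum[of "B _"])
    also have "\<dots> = (\<Sum>j\<in>UNIV. B (coef u (\<lambda>v. v $ j)) (coef (axis j 1) g))"
      by (simp add: tev_sum lin_form_coef[of "\<lambda>z. B z _"])
    also have "\<dots> = 0"
      by (simp add: B0[OF u lin_form_nth coef_D[OF g]])
    finally show "g u = g 0" by simp
  qed
  then have cou0: "counit_part (ap x u) = 0" if "x \<in> I" for x u
    using that unfolding U_def by (metis (mono_tags, lifting) mem_Collect_eq vec.span_base)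
  have "x = 0" if x: "x \<in> I" for x
  proof (rule ap_eqI, rule vec_eq_formI)
    fix u and f :: "'k ^ ('n \<times> 'w) \<Rightarrow> 'k" assume f: "lin_form f"
    have "U = {0}"
      using \<open>\<And>u. u \<in> U \<Longrightarrow> u = 0\<close> vec.subspace_0[OF sU] by blast
    moreover have "a \<otimes>\<^sub>k (0 :: 'k ^ 'w) = 0" for a :: "'k ^ 'n"
      by (simp add: tens_def vec_eq_iff)
    moreover have "bform (\<lambda>a b. f (a \<otimes>\<^sub>k b))"
      by (simp add: form_defs tens_simps lin_formD[OF f])
    ultimately have "tev (ap x u) (\<lambda>a b. f (a \<otimes>\<^sub>k b)) = 0"
      by (intro tev_vanishes[OF ap_in_HU[OF x]]) (simp_all add: lin_formD[OF f])
    then show "f (ap x u) = f (ap 0 u)"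
      using ap_linear(3)[of 0 "0 :: 'k ^ ('w \<times> ('n \<times> 'w))" u]
      by (simp add: lin_form_tens_expansion[OF f, of "ap x u"] lin_formD[OF f])
  qed
  then show False
    using nz vec.subspace_0[OF ideal(1)] by blast
qed

text \<open>
  Averages of rank one maps with values in \<open>T\<close> lie in the ideal: for a generator \<open>h \<cdot> x u\<close> of \<open>T\<close> the
  average is \<open>x \<circ> y\<close>, where \<open>y\<close> is the average of the rank one map with value \<open>h \<otimes> u\<close> and the same form.
\<close>

lemma average_in_ideal:
  assumes "t \<in> T" "lin_form g"
  obtains x where "x \<in> I" "\<And>u. ap x u = HW_average (\<lambda>v. g v *s t) u"
proof -
  note [simp] = lin_formD[OF assms(2)] bformD[OF bform_B] bformD_fun[OF bform_B]
  let ?P = "\<lambda>t. \<exists>x\<in>I. \<forall>u. ap x u = HW_average (\<lambda>v. g v *s t) u"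
  have gen: "?P (left_act h (ap x u0))" if x: "x \<in> I" for h x u0
  proof -
    have "lin (\<lambda>v. g v *s (h \<otimes>\<^sub>k u0))"
      by (simp add: lin_iff vec.scale_left_distrib)
    then obtain y where y: "y \<in> NW H \<delta>" "\<And>u. ap y u = HW_average (\<lambda>v. g v *s (h \<otimes>\<^sub>k u0)) u"
      by (rule average_in_NW) blast
    have "ap (NW_mult H x y) u = HW_average (\<lambda>v. g v *s left_act h (ap x u0)) u" for u
    proof (rule vec_eq_formI)
      fix f :: "'k ^ ('n \<times> 'w) \<Rightarrow> 'k" assume f: "lin_form f"
      note [simp] = lin_formD[OF f]
      define F where "F t = tev t (\<lambda>h w. f (left_act h (ap x w)))" for t
      have F: "lin_form F"
        by (simp add: F_def lin_form_iff tev_add_left tev_scale_left)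
      note [simp] = lin_formD[OF F]
      have Ft: "F (h \<otimes>\<^sub>k w) = f (left_act h (ap x w))" for h w
        by (simp add: F_def tev_tens coaction_rules)
      have "f (ap (NW_mult H x y) u) = F (HW_average (\<lambda>v. g v *s (h \<otimes>\<^sub>k u0)) u)"
        by (simp add: lin_form_ap_mult[OF f] F_def y)
      also have "\<dots> = tev (\<delta> u) (\<lambda>d v. g v * tev (rhoR H \<delta> (h \<otimes>\<^sub>k u0)) (\<lambda>d' v'. B d d' * F v'))"
        by (simp add: lin_form_average[OF F] rhoR_linear tev_scale_left)
      also have "\<dots> = tev (\<delta> u) (\<lambda>d v. g v * sw h (\<lambda>a b. tev (\<delta> u0) (\<lambda>d' v'. B d (adj H a d') * f (left_act b (ap x v')))))"
        by (subst tev_rhoR_tens) (simp_all add: coaction_rules Ft)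
      also have "\<dots> = tev (\<delta> u) (\<lambda>d v. g v * sw h (\<lambda>a b. tev (rhoR H \<delta> (ap x u0)) (\<lambda>d' t. B d (adj H a d') * f (left_act b t))))"
        using NW_colinear[OF ideal(2)[OF x], of "\<lambda>d' t. B d (adj H a d') * f (left_act b t)" for d a b]
        by (simp add: coaction_rules)
      also have "\<dots> = tev (\<delta> u) (\<lambda>d v. g v * tev (rhoR H \<delta> (left_act h (ap x u0))) (\<lambda>d' t. B d d' * f t))"
        by (subst tev_rhoR_left_act) (simp_all add: coaction_rules)
      also have "\<dots> = f (HW_average (\<lambda>v. g v *s left_act h (ap x u0)) u)"
        by (simp add: lin_form_average[OF f] rhoR_linear tev_scale_left)
      finally show "f (ap (NW_mult H x y) u) = f (HW_average (\<lambda>v. g v *s left_act h (ap x u0)) u)" .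
    qed
    then show ?thesis
      using ideal(4)[OF y(1) x] by blast
  qed
  have average_add: "HW_average (\<lambda>v. g v *s (s + t)) u = HW_average (\<lambda>v. g v *s s) u + HW_average (\<lambda>v. g v *s t) u" for s t u
    by (simp add: average_def rhoR_linear tsum_add_left tsum_scale_left tsum_add vec.scale_right_distrib)
  have average_scale: "HW_average (\<lambda>v. g v *s (c *s t)) u = c *s HW_average (\<lambda>v. g v *s t) u" for c t u
  proof (rule vec_eq_formI)
    fix f :: "'k ^ ('n \<times> 'w) \<Rightarrow> 'k" assume f: "lin_form f"
    show "f (HW_average (\<lambda>v. g v *s (c *s t)) u) = f (c *s HW_average (\<lambda>v. g v *s t) u)"
      by (simp add: lin_form_average[OF f] lin_formD[OF f] rhoR_linear tev_scale_left mult.left_commute tev_scale mult.assoc)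
  qed
  have "vec.subspace {t. ?P t}"
    unfolding vec.subspace_def
  proof (intro conjI ballI allI)
    have "ap 0 u = HW_average (\<lambda>v. g v *s 0) u" for u
      using average_scale[of 0 0 u] ap_linear(3)[of 0 0 u] by simp
    then show "0 \<in> {t. ?P t}"
      using vec.subspace_0[OF ideal(1)] by blast
  next
    fix s t assume "s \<in> {t. ?P t}" "t \<in> {t. ?P t}"
    then obtain x y where "x \<in> I" "y \<in> I" "\<And>u. ap x u = HW_average (\<lambda>v. g v *s s) u" "\<And>u. ap y u = HW_average (\<lambda>v. g v *s t) u"
      by auto
    then have "x + y \<in> I" "\<And>u. ap (x + y) u = HW_average (\<lambda>v. g v *s (s + t)) u"
      by (simp_all only: ap_linear average_add vec.subspace_add[OF ideal(1)])
    then show "s + t \<in> {t. ?P t}"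
      by blast
  next
    fix c t assume "t \<in> {t. ?P t}"
    then obtain x where "x \<in> I" "\<And>u. ap x u = HW_average (\<lambda>v. g v *s t) u"
      by auto
    then have "c *s x \<in> I" "\<And>u. ap (c *s x) u = HW_average (\<lambda>v. g v *s (c *s t)) u"
      using vec.subspace_scale[OF ideal(1)] by (simp_all only: ap_linear average_scale)
    then show "c *s t \<in> {t. ?P t}"
      by blast
  qed
  then have "T \<subseteq> {t. ?P t}"
    unfolding T_def using gen by (intro vec.span_minimal) auto
  then show ?thesis
    using assms(1) that by blast
qed

text \<open>
  The unit of \<open>N\<^sub>W\<close> is the colinear map \<open>v \<mapsto> \<one> \<otimes> v\<close>. It equals its own average, and it is a sum of rank
  one maps with values in \<open>\<one> \<otimes> U \<subseteq> T\<close>.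
\<close>

lemma unit_in_ideal:
  assumes "U = UNIV"
  shows "NW_unit H \<in> I"
proof -
  note [simp] = bformD[OF bform_B] bformD_fun[OF bform_B]
  have "\<exists>x\<in>I. \<forall>u. ap x u = HW_average (\<lambda>v. v $ j *s (\<one> \<otimes>\<^sub>k axis j 1)) u" for j
    using average_in_ideal[OF unit_tens_in_T lin_form_nth] assms by (metis UNIV_I)
  then obtain x where x: "\<And>j. x j \<in> I" "\<And>j u. ap (x j) u = HW_average (\<lambda>v. v $ j *s (\<one> \<otimes>\<^sub>k axis j 1)) u"
    by metis
  have "ap (\<Sum>j\<in>UNIV. x j) u = ap (NW_unit H) u" for u
  proof (rule vec_eq_formI)
    fix f :: "'k ^ ('n \<times> 'w) \<Rightarrow> 'k" assume f: "lin_form f"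
    note [simp] = lin_formD[OF f]
    have one: "tev (rhoR H \<delta> (\<one> \<otimes>\<^sub>k v)) (\<lambda>d' t. B d d' * f t) = tev (\<delta> v) (\<lambda>b w. B d b * f (\<one> \<otimes>\<^sub>k w))" for d v
      by (subst tev_rhoR_tens) (simp_all add: coaction_rules comult_unit adj_unit)
    have expand: "(\<Sum>j\<in>UNIV. v $ j * tev (rhoR H \<delta> (\<one> \<otimes>\<^sub>k axis j 1)) (\<lambda>d' t. B d d' * f t)) =
        tev (rhoR H \<delta> (\<one> \<otimes>\<^sub>k v)) (\<lambda>d' t. B d d' * f t)" for d v
      by (rule lin_form_expansion[symmetric, of "\<lambda>v. tev (rhoR H \<delta> (\<one> \<otimes>\<^sub>k v)) (\<lambda>d' t. B d d' * f t)"])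
        (simp add: coaction_rules)
    have "f (ap (\<Sum>j\<in>UNIV. x j) u) =
        (\<Sum>j\<in>UNIV. tev (\<delta> u) (\<lambda>d v. v $ j * tev (rhoR H \<delta> (\<one> \<otimes>\<^sub>k axis j 1)) (\<lambda>d' t. B d d' * f t)))"
      by (simp add: ap_sum x lin_form_sum[OF f] lin_form_average[OF f] rhoR_linear tev_scale_left)
    also have "\<dots> = tev (\<delta> u) (\<lambda>d v. tev (rhoR H \<delta> (\<one> \<otimes>\<^sub>k v)) (\<lambda>d' t. B d d' * f t))"
      by (simp only: expand flip: tev_sum)
    also have "\<dots> = tev (\<delta> u) (\<lambda>d v. tev (\<delta> v) (\<lambda>b w. B d b * f (\<one> \<otimes>\<^sub>k w)))"
      by (simp only: one)
    also have "\<dots> = tev (\<delta> u) (\<lambda>d v. swR d (\<lambda>a b. B a b * f (\<one> \<otimes>\<^sub>k v)))"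
      by (rule delta_coassoc[symmetric]) (simp add: coaction_rules)
    also have "\<dots> = f (\<one> \<otimes>\<^sub>k u)"
      using delta_counit[of "\<lambda>v. f (\<one> \<otimes>\<^sub>k v)" u] by (simp add: tev_scale2 B_comultR coaction_rules)
    finally show "f (ap (\<Sum>j\<in>UNIV. x j) u) = f (ap (NW_unit H) u)"
      by (simp add: ap_unit)
  qed
  then have "(\<Sum>j\<in>UNIV. x j) = NW_unit H"
    by (rule ap_eqI)
  then show ?thesis
    using vec.subspace_sum[OF ideal(1), of UNIV x] x(1) by simp
qed

end

section \<open>Simplicity\<close>

theorem proposition5p12:
  fixes H :: "('k::field, 'n::finite) hopf_data"
    and R :: "'k ^ ('n \<times> 'n)"
    and D :: "('k ^ 'n) set"
    and \<delta> :: "'k ^ 'w::finite \<Rightarrow> 'k ^ ('n \<times> 'w)"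
  assumes "hopf_algebra H"
    and "semisimple H"
    and "cosemisimple H"
    and "quasitriangular H R"
    and "minimal_adj_stable_subcoalgebra H R D"
    and "left_comodule (comultR H R) (counit H) D UNIV \<delta>"
  shows "H_simple H (NW H \<delta>) (NW_mult H) (NW_unit H) (NW_coaction H)"
proof -
  interpret hopf H
    by unfold_locales (rule assms(1))
  interpret quasitriangular_hopf H R
    by unfold_locales (rule assms(4))
  interpret R_comodule H R \<delta>
    by unfold_locales (rule left_comodule_imp_Rcomodule[OF assms(6)])
  obtain lam where lam: "lin_form lam" "lam (unit H) = 1"
    "\<And>f h. lin_form f \<Longrightarrow> sw h (\<lambda>a b. lam a * f b) = lam h * f (unit H)"
    "\<And>f h. lin_form f \<Longrightarrow> sw h (\<lambda>a b. lam b * f a) = lam h * f (unit H)"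
    using cosemisimple_imp_integral[OF assms(3)] by blast
  obtain \<Lambda> where \<Lambda>: "counit H \<Lambda> = 1" "\<And>h. mult H h \<Lambda> = counit H h *s \<Lambda>"
    using semisimple_imp_integral[OF assms(2)] by blast
  interpret hopf_integrals H lam \<Lambda>
    by (intro hopf_integrals.intro hopf_integrals_axioms.intro hopf_axioms lam \<Lambda>)
  have "I = {0} \<or> I = NW H \<delta>" if "costable_ideal (NW H \<delta>) (NW_mult H) (NW_coaction H) I" for I
  proof (cases "I = {0}")
    case False
    interpret costable_ideal_of_NW H R \<delta> lam \<Lambda> I
      by unfold_locales (rule that)
    have "U = UNIV"
      using U_full[OF assms(5) _ False] assms(6) by (simp add: left_comodule_def)
    then have "NW_unit H \<in> I"
      by (rule unit_in_ideal)
    then have "x \<in> I" if "x \<in> NW H \<delta>" for x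
      using ideal(3)[OF that] NW_mult_unit(2)[of x] by force
    then show ?thesis
      using ideal(2) by blast
  qed simp
  then show ?thesis
    using NW_comodule_algebra by (simp add: H_simple_def)
qed

end
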